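(* The virtual double functor $Q\colon\mathbb S\mathrm{pan}_\ast\to\mathbb S\mathrm{pan}$ is a universal discrete opfibration with small fibers in $\mathbf{VDBL}$: for any discrete opfibration $P\colon\mathbb X\to\mathbb Y$ with small fibers between large virtual double categories, there is a pullback square in $\mathbf{VDBL}$ exhibiting $P$ as the pullback of $Q$ along the virtual double functor $D_P\colon\mathbb Y\to\mathbb S\mathrm{pan}$.
   Context: Size: fix Grothendieck universes $\mathcal U_1\in\mathcal U_2$; small means in $\mathcal U_1$, large means in $\mathcal U_2$. Virtual double categories. A virtual double category $\mathbb A$ consists of: a category $\mathbb A_{\mathrm{vert}}$, whose objects and morphisms are the objects and vertical morphisms of $\mathbb A$; for each pair of objects a set of horizontal morphisms $\Gamma\colon A\nrightarrow A'$; for each $n\ge0$, each path of horizontal morphisms $\Gamma_i\colon A_{i-1}\nrightarrow A_i$ ($1\le i\le n$), each $\Delta\colon B\nrightarrow B'$ and vertical $u\colon A_0\to B$, $u'\colon A_n\to B'$, a set of multicells, written $\theta\colon(\Gamma_1,\dots,\Gamma_n)\Rightarrow\Delta$ over $(u,u')$ (for $n=0$ the top is a single object $A_0$; a cell is a multicell with $n=1$); identity cells $\mathrm{id}_\Gamma\colon(\Gamma)\Rightarrow\Gamma$ over identities; composites: for $\theta_i\colon(\Gamma_{i,1},\dots,\Gamma_{i,n_i})\Rightarrow\Delta_i$ over $(u_{i-1},u_i)$ ($1\le i\le m$) and $\kappa\colon(\Delta_1,\dots,\Delta_m)\Rightarrow\Lambda$ over $(v,v')$, a multicell $\kappa\circ(\theta_1,\dots,\theta_m)\colon(\Gamma_{1,1},\dots,\Gamma_{m,n_m})\Rightarrow\Lambda$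 over $(vu_0,v'u_m)$; for $m=0$, given $\kappa\colon()\Rightarrow\Lambda$ over $(v,v')$ with top $B$ and vertical $u\colon A\to B$, a composite $\kappa\circ(u)$ over $(vu,v'u)$. Evident unit and associativity axioms hold. A virtual double functor $F\colon\mathbb A\to\mathbb B$ sends objects, vertical and horizontal morphisms and multicells to those of $\mathbb B$, compatibly with boundaries, functorially on vertical morphisms, and preserving identity cells and composites. $\mathbf{VDBL}$ is the 2-category of large virtual double categories, virtual double functors and vertical transformations (a vertical transformation $\alpha\colon F\to G$ has vertical components $\alpha_A\colon FA\to GA$, natural in $A$, and cells $\alpha_\Gamma\colon(F\Gamma)\Rightarrow G\Gamma$ over $(\alpha_A,\alpha_{A'})$ with $\alpha_\Gamma\circ(F\theta)=G\theta\circ(\alpha_{\Gamma_1},\dots,\alpha_{\Gamma_n})$ for each multicell $\theta\colon(\Gamma_1,\dots,\Gamma_n)\Rightarrow\Gamma$). Discrete opfibrations. $P\colon\mathbb X\to\mathbb Y$ is a discrete opfibration if: (i) for each $X\in\mathbb X$ and vertical $v\colon PX\to Y$ there is a unique vertical $\overline v_X\colon X\to v_\ast X$ in $\mathbb X$ with $P\overline v_X=v$; (ii) for each $n\ge0$, path $\Phi_i\colon X_{i-1}\nrightarrow X_i$ ($1\le i\le n$) in $\mathbb X$ and multicell $\nu\colon(P\Phi_1,\dots,P\Phi_n)\Rightarrow\Psi$ over $(v,v')$ in $\mathbb Y$, there is a unique multicell $\overline\nu_{\Phi_1,\dots,\Phi_n}\colon(\Phi_1,\dots,\Phi_n)\Rightarrow\nu_\ast(\Phi_1,\dots,\Phi_n)$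 over $(\overline v_{X_0},\overline{v'}_{X_n})$ in $\mathbb X$ (codomain horizontal morphism included) mapped by $P$ to $\nu$. It has small fibers if for each object $Y$ (resp. horizontal morphism $\Psi$) of $\mathbb Y$ the set $P^{-1}(Y)$ of objects $X$ with $PX=Y$ (resp. $P^{-1}(\Psi)$ of horizontal morphisms $\Phi$ with $P\Phi=\Psi$) is small. Spans. For a category $\mathcal C$ with pullbacks, $\mathbb S\mathrm{pan}(\mathcal C)$ is the virtual double category with vertical category $\mathcal C$, horizontal morphisms $I\nrightarrow I'$ the spans $I\leftarrow S\to I'$ in $\mathcal C$, and multicells $(S_1,\dots,S_n)\Rightarrow S$ over $(v,v')$ the morphisms $S_1\times_{I_1}\cdots\times_{I_{n-1}}S_n\to S$ (domain $I_0$ if $n=0$) compatible with the legs along $v,v'$. $\mathbb S\mathrm{pan}=\mathbb S\mathrm{pan}(\mathbf{Set})$ and $\mathbb S\mathrm{pan}_\ast=\mathbb S\mathrm{pan}(\mathbf{Set}_\ast)$ for small sets and small pointed sets, and $Q$ is induced by the forgetful functor $\mathbf{Set}_\ast\to\mathbf{Set}$; $Q$ is a discrete opfibration. The virtual double functor $D_P\colon\mathbb Y\to\mathbb S\mathrm{pan}$ sends an object $Y$ to $P^{-1}(Y)$, a vertical $v\colon Y\to Y'$ to $v_\ast\colon P^{-1}(Y)\to P^{-1}(Y')$, a horizontal $\Psi\colon Y\nrightarrow Y'$ to the span $P^{-1}(Y)\leftarrow P^{-1}(\Psi)\to P^{-1}(Y')$ whose legs send $\Phi\colon X\nrightarrow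 X'$ to $X$ and $X'$, and a multicell $\nu\colon(\Psi_1,\dots,\Psi_n)\Rightarrow\Psi$ to the function $\nu_\ast\colon P^{-1}(\Psi_1)\times_{P^{-1}(Y_1)}\cdots\times_{P^{-1}(Y_{n-1})}P^{-1}(\Psi_n)\to P^{-1}(\Psi)$. *)

theory Defs
  imports Main "HOL-Library.FuncSet" "HOL-Library.Equipollence"
begin

section \<open>Size\<close>

text \<open>
  The ambient sets are named by the elements of a type \<open>'w\<close>: the code \<open>x\<close> names the set \<open>el x\<close>.
  A collection \<open>U\<close> of codes is a Grothendieck universe if it is transitive and closed under
  unordered pairs, power sets and unions of families indexed by its members. In the third clause
  \<open>z\<close> names the power set of \<open>x\<close>: its elements name exactly the subsets of \<open>el x\<close>.
\<close>

definition grothendieck_universe :: "('w \<Rightarrow> 'w set) \<Rightarrow> 'w set \<Rightarrow> bool" where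
  "grothendieck_universe el U \<longleftrightarrow>
     U \<noteq> {} \<and>
     (\<forall>x\<in>U. el x \<subseteq> U) \<and>
     (\<forall>x\<in>U. \<forall>y\<in>U. \<exists>z\<in>U. el z = {x, y}) \<and>
     (\<forall>x\<in>U. \<exists>z\<in>U. el ` el z = Pow (el x)) \<and>
     (\<forall>i\<in>U. \<forall>f. f ` el i \<subseteq> U \<longrightarrow> (\<exists>z\<in>U. el z = (\<Union>j\<in>el i. el (f j))))"

text \<open>
  The universe \<open>U\<^sub>2\<close> is the whole type \<open>'w\<close> and \<open>U\<^sub>1 = el u1\<close> is a member of it;
  extensionality is injectivity of \<open>el\<close>.
\<close>

definition universe_pair :: "('w \<Rightarrow> 'w set) \<Rightarrow> 'w \<Rightarrow> bool" where
  "universe_pair el u1 \<longleftrightarrow>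
     inj el \<and> grothendieck_universe el UNIV \<and> grothendieck_universe el (el u1)"

definition small_sets :: "('w \<Rightarrow> 'w set) \<Rightarrow> 'w \<Rightarrow> 'w set set" where
  "small_sets el u1 = el ` el u1"

definition large_sets :: "('w \<Rightarrow> 'w set) \<Rightarrow> 'w set set" where
  "large_sets el = range el"

text \<open>
  Sets whose elements are not codes (e.g. the set of all spans between small sets) cannot be literal
  members of a universe; for them membership is meant up to bijection. For subsets of \<open>'w\<close>,
  being large up to bijection is the same as being large, by replacement in \<open>U\<^sub>2\<close>.
\<close>

definition up_to_bij :: "'w set set \<Rightarrow> 'a set set" where
  "up_to_bij S = {A. \<exists>B\<in>S. A \<approx> B}"


section \<open>Virtual double categories\<close>

text \<open>
  A path is given by its initial object together with the list of its horizontal morphisms, so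
  that the empty path at an object is included.
\<close>

fun hpath :: "'o set \<Rightarrow> 'h set \<Rightarrow> ('h \<Rightarrow> 'o) \<Rightarrow> ('h \<Rightarrow> 'o) \<Rightarrow> 'o \<Rightarrow> 'h list \<Rightarrow> 'o \<Rightarrow> bool" where
  "hpath Ob Ho src tgt a [] b \<longleftrightarrow> a \<in> Ob \<and> b = a"
| "hpath Ob Ho src tgt a (h # hs) b \<longleftrightarrow>
     a \<in> Ob \<and> h \<in> Ho \<and> src h = a \<and> hpath Ob Ho src tgt (tgt h) hs b"

text \<open>
  \<open>vcomp A v u\<close> is the vertical composite of \<open>u\<close> followed by \<open>v\<close>. The initial object of the top path
  of a multicell is the domain of its left vertical boundary. \<open>ccomp A k u [t1, \<dots>, tm]\<close> is the
  composite of \<open>k\<close> with \<open>(t1, \<dots>, tm)\<close>, where \<open>u\<close> is the left boundary of \<open>t1\<close>; for \<open>m = 0\<close> it is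
  the composite of the nullary \<open>k\<close> with the vertical morphism \<open>u\<close>.
\<close>

record ('o, 'v, 'h, 'c) vdc =
  Obj :: "'o set"
  Vert :: "'v set"
  vdom :: "'v \<Rightarrow> 'o"
  vcod :: "'v \<Rightarrow> 'o"
  vid :: "'o \<Rightarrow> 'v"
  vcomp :: "'v \<Rightarrow> 'v \<Rightarrow> 'v"
  Hor :: "'h set"
  hsrc :: "'h \<Rightarrow> 'o"
  htgt :: "'h \<Rightarrow> 'o"
  Cell :: "'c set"
  ctop :: "'c \<Rightarrow> 'h list"
  cbot :: "'c \<Rightarrow> 'h"
  cleft :: "'c \<Rightarrow> 'v"
  cright :: "'c \<Rightarrow> 'v"
  cid :: "'h \<Rightarrow> 'c"
  ccomp :: "'c \<Rightarrow> 'v \<Rightarrow> 'c list \<Rightarrow> 'c"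

abbreviation path_in :: "('o, 'v, 'h, 'c) vdc \<Rightarrow> 'o \<Rightarrow> 'h list \<Rightarrow> 'o \<Rightarrow> bool" where
  "path_in A \<equiv> hpath (Obj A) (Hor A) (hsrc A) (htgt A)"

text \<open>Sequences of multicells adjacent along their vertical boundaries, with left boundary \<open>u\<close>.\<close>

fun cell_path :: "('o, 'v, 'h, 'c) vdc \<Rightarrow> 'v \<Rightarrow> 'c list \<Rightarrow> bool" where
  "cell_path A u [] \<longleftrightarrow> u \<in> Vert A"
| "cell_path A u (t # ts) \<longleftrightarrow> t \<in> Cell A \<and> cleft A t = u \<and> cell_path A (cright A t) ts"

definition path_right :: "('o, 'v, 'h, 'c) vdc \<Rightarrow> 'v \<Rightarrow> 'c list \<Rightarrow> 'v" where
  "path_right A u ts = (if ts = [] then u else cright A (last ts))"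

definition composable :: "('o, 'v, 'h, 'c) vdc \<Rightarrow> 'c \<Rightarrow> 'v \<Rightarrow> 'c list \<Rightarrow> bool" where
  "composable A k u ts \<longleftrightarrow>
     k \<in> Cell A \<and> cell_path A u ts \<and> map (cbot A) ts = ctop A k \<and> vcod A u = vdom A (cleft A k)"

text \<open>
  Given multicells \<open>t1, \<dots>, tm\<close> and lists \<open>xs1, \<dots>, xsm\<close> of multicells whose concatenation is a
  sequence of adjacent multicells with left boundary \<open>w\<close>, the list of the composites of \<open>ti\<close>
  with \<open>xsi\<close>.
\<close>

fun row_comps :: "('o, 'v, 'h, 'c) vdc \<Rightarrow> 'v \<Rightarrow> 'c list \<Rightarrow> 'c list list \<Rightarrow> 'c list" where
  "row_comps A w (t # ts) (xs # xss) = ccomp A t w xs # row_comps A (path_right A w xs) ts xss"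
| "row_comps A w _ _ = []"

locale virtual_double_category =
  fixes A :: "('o, 'v, 'h, 'c) vdc"
  assumes vdom_in: "u \<in> Vert A \<Longrightarrow> vdom A u \<in> Obj A"
    and vcod_in: "u \<in> Vert A \<Longrightarrow> vcod A u \<in> Obj A"
    and vid: "a \<in> Obj A \<Longrightarrow> vid A a \<in> Vert A \<and> vdom A (vid A a) = a \<and> vcod A (vid A a) = a"
    and vcomp: "\<lbrakk>u \<in> Vert A; v \<in> Vert A; vcod A u = vdom A v\<rbrakk> \<Longrightarrow>
      vcomp A v u \<in> Vert A \<and> vdom A (vcomp A v u) = vdom A u \<and> vcod A (vcomp A v u) = vcod A v"
    and vcomp_vid_right: "u \<in> Vert A \<Longrightarrow> vcomp A u (vid A (vdom A u)) = u"
    and vcomp_vid_left: "u \<in> Vert A \<Longrightarrow> vcomp A (vid A (vcod A u)) u = u"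
    and vcomp_assoc: "\<lbrakk>u \<in> Vert A; v \<in> Vert A; w \<in> Vert A; vcod A u = vdom A v; vcod A v = vdom A w\<rbrakk> \<Longrightarrow>
      vcomp A w (vcomp A v u) = vcomp A (vcomp A w v) u"
    and hsrc_in: "h \<in> Hor A \<Longrightarrow> hsrc A h \<in> Obj A"
    and htgt_in: "h \<in> Hor A \<Longrightarrow> htgt A h \<in> Obj A"
    and cell_boundary: "t \<in> Cell A \<Longrightarrow>
      cleft A t \<in> Vert A \<and> cright A t \<in> Vert A \<and> cbot A t \<in> Hor A \<and>
      path_in A (vdom A (cleft A t)) (ctop A t) (vdom A (cright A t)) \<and>
      hsrc A (cbot A t) = vcod A (cleft A t) \<and> htgt A (cbot A t) = vcod A (cright A t)"
    and cid: "h \<in> Hor A \<Longrightarrow>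
      cid A h \<in> Cell A \<and> ctop A (cid A h) = [h] \<and> cbot A (cid A h) = h \<and>
      cleft A (cid A h) = vid A (hsrc A h) \<and> cright A (cid A h) = vid A (htgt A h)"
    and ccomp: "composable A k u ts \<Longrightarrow>
      ccomp A k u ts \<in> Cell A \<and>
      ctop A (ccomp A k u ts) = concat (map (ctop A) ts) \<and>
      cbot A (ccomp A k u ts) = cbot A k \<and>
      cleft A (ccomp A k u ts) = vcomp A (cleft A k) u \<and>
      cright A (ccomp A k u ts) = vcomp A (cright A k) (path_right A u ts)"
    and ccomp_cid_right: "t \<in> Cell A \<Longrightarrow>
      ccomp A t (vid A (vdom A (cleft A t))) (map (cid A) (ctop A t)) = t"
    and ccomp_cid_left: "t \<in> Cell A \<Longrightarrow> ccomp A (cid A (cbot A t)) (cleft A t) [t] = t"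
    and ccomp_assoc: "\<lbrakk>composable A k u ts; composable A (ccomp A k u ts) w (concat xss);
        map (map (cbot A)) xss = map (ctop A) ts\<rbrakk> \<Longrightarrow>
      ccomp A k (vcomp A u w) (row_comps A w ts xss) = ccomp A (ccomp A k u ts) w (concat xss)"

definition large_vdc :: "('w \<Rightarrow> 'w set) \<Rightarrow> ('o, 'v, 'h, 'c) vdc \<Rightarrow> bool" where
  "large_vdc el A \<longleftrightarrow> virtual_double_category A \<and>
     Obj A \<in> up_to_bij (large_sets el) \<and> Vert A \<in> up_to_bij (large_sets el) \<and>
     Hor A \<in> up_to_bij (large_sets el) \<and> Cell A \<in> up_to_bij (large_sets el)"


section \<open>Virtual double functors and vertical transformations\<close>

record ('o1, 'v1, 'h1, 'c1, 'o2, 'v2, 'h2, 'c2) vdf =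
  fO :: "'o1 \<Rightarrow> 'o2"
  fV :: "'v1 \<Rightarrow> 'v2"
  fH :: "'h1 \<Rightarrow> 'h2"
  fC :: "'c1 \<Rightarrow> 'c2"

definition vd_functor ::
  "('o1, 'v1, 'h1, 'c1) vdc \<Rightarrow> ('o2, 'v2, 'h2, 'c2) vdc \<Rightarrow>
   ('o1, 'v1, 'h1, 'c1, 'o2, 'v2, 'h2, 'c2) vdf \<Rightarrow> bool" where
  "vd_functor A B F \<longleftrightarrow>
     (\<forall>a\<in>Obj A. fO F a \<in> Obj B) \<and>
     (\<forall>u\<in>Vert A. fV F u \<in> Vert B \<and> vdom B (fV F u) = fO F (vdom A u) \<and> vcod B (fV F u) = fO F (vcod A u)) \<and>
     (\<forall>a\<in>Obj A. fV F (vid A a) = vid B (fO F a)) \<and>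
     (\<forall>u\<in>Vert A. \<forall>v\<in>Vert A. vcod A u = vdom A v \<longrightarrow> fV F (vcomp A v u) = vcomp B (fV F v) (fV F u)) \<and>
     (\<forall>h\<in>Hor A. fH F h \<in> Hor B \<and> hsrc B (fH F h) = fO F (hsrc A h) \<and> htgt B (fH F h) = fO F (htgt A h)) \<and>
     (\<forall>t\<in>Cell A. fC F t \<in> Cell B \<and> ctop B (fC F t) = map (fH F) (ctop A t) \<and>
        cbot B (fC F t) = fH F (cbot A t) \<and>
        cleft B (fC F t) = fV F (cleft A t) \<and> cright B (fC F t) = fV F (cright A t)) \<and>
     (\<forall>h\<in>Hor A. fC F (cid A h) = cid B (fH F h)) \<and>
     (\<forall>k u ts. composable A k u ts \<longrightarrow>
        fC F (ccomp A k u ts) = ccomp B (fC F k) (fV F u) (map (fC F) ts))"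

definition vdf_comp ::
  "('o2, 'v2, 'h2, 'c2, 'o3, 'v3, 'h3, 'c3) vdf \<Rightarrow> ('o1, 'v1, 'h1, 'c1, 'o2, 'v2, 'h2, 'c2) vdf \<Rightarrow>
   ('o1, 'v1, 'h1, 'c1, 'o3, 'v3, 'h3, 'c3) vdf" where
  "vdf_comp G F = \<lparr>fO = fO G \<circ> fO F, fV = fV G \<circ> fV F, fH = fH G \<circ> fH F, fC = fC G \<circ> fC F\<rparr>"

text \<open>
  Functors out of \<open>A\<close> are only meaningful on the carriers of \<open>A\<close>, so this is their equality;
  similarly for vertical transformations below.
\<close>

definition vdf_eq ::
  "('o1, 'v1, 'h1, 'c1) vdc \<Rightarrow> ('o1, 'v1, 'h1, 'c1, 'o2, 'v2, 'h2, 'c2) vdf \<Rightarrow>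
   ('o1, 'v1, 'h1, 'c1, 'o2, 'v2, 'h2, 'c2) vdf \<Rightarrow> bool" where
  "vdf_eq A F G \<longleftrightarrow>
     (\<forall>a\<in>Obj A. fO F a = fO G a) \<and> (\<forall>u\<in>Vert A. fV F u = fV G u) \<and>
     (\<forall>h\<in>Hor A. fH F h = fH G h) \<and> (\<forall>t\<in>Cell A. fC F t = fC G t)"

record ('o1, 'h1, 'v2, 'c2) vtrans =
  tO :: "'o1 \<Rightarrow> 'v2"
  tH :: "'h1 \<Rightarrow> 'c2"

definition vertical_transformation ::
  "('o1, 'v1, 'h1, 'c1) vdc \<Rightarrow> ('o2, 'v2, 'h2, 'c2) vdc \<Rightarrow>
   ('o1, 'v1, 'h1, 'c1, 'o2, 'v2, 'h2, 'c2) vdf \<Rightarrow> ('o1, 'v1, 'h1, 'c1, 'o2, 'v2, 'h2, 'c2) vdf \<Rightarrow>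
   ('o1, 'h1, 'v2, 'c2) vtrans \<Rightarrow> bool" where
  "vertical_transformation A B F G \<alpha> \<longleftrightarrow>
     (\<forall>a\<in>Obj A. tO \<alpha> a \<in> Vert B \<and> vdom B (tO \<alpha> a) = fO F a \<and> vcod B (tO \<alpha> a) = fO G a) \<and>
     (\<forall>u\<in>Vert A. vcomp B (fV G u) (tO \<alpha> (vdom A u)) = vcomp B (tO \<alpha> (vcod A u)) (fV F u)) \<and>
     (\<forall>h\<in>Hor A. tH \<alpha> h \<in> Cell B \<and> ctop B (tH \<alpha> h) = [fH F h] \<and> cbot B (tH \<alpha> h) = fH G h \<and>
        cleft B (tH \<alpha> h) = tO \<alpha> (hsrc A h) \<and> cright B (tH \<alpha> h) = tO \<alpha> (htgt A h)) \<and>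
     (\<forall>t\<in>Cell A. ccomp B (tH \<alpha> (cbot A t)) (fV F (cleft A t)) [fC F t] =
        ccomp B (fC G t) (tO \<alpha> (vdom A (cleft A t))) (map (tH \<alpha>) (ctop A t)))"

definition vt_eq ::
  "('o1, 'v1, 'h1, 'c1) vdc \<Rightarrow> ('o1, 'h1, 'v2, 'c2) vtrans \<Rightarrow> ('o1, 'h1, 'v2, 'c2) vtrans \<Rightarrow> bool" where
  "vt_eq A \<alpha> \<beta> \<longleftrightarrow> (\<forall>a\<in>Obj A. tO \<alpha> a = tO \<beta> a) \<and> (\<forall>h\<in>Hor A. tH \<alpha> h = tH \<beta> h)"

definition whisker ::
  "('o2, 'v2, 'h2, 'c2, 'o3, 'v3, 'h3, 'c3) vdf \<Rightarrow> ('o1, 'h1, 'v2, 'c2) vtrans \<Rightarrow>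
   ('o1, 'h1, 'v3, 'c3) vtrans" where
  "whisker H \<alpha> = \<lparr>tO = fV H \<circ> tO \<alpha>, tH = fC H \<circ> tH \<alpha>\<rparr>"

text \<open>
  The square with sides \<open>P : X \<rightarrow> Y\<close>, \<open>E : X \<rightarrow> Z'\<close>, \<open>D : Y \<rightarrow> Z\<close>, \<open>Q : Z' \<rightarrow> Z\<close> is a (strict) pullback
  in the 2-category of large virtual double categories: the universal property holds both for
  virtual double functors and for vertical transformations. The test objects \<open>W\<close> have carriers that
  are elements of \<open>U\<^sub>2\<close>; up to isomorphism these are all the large virtual double categories.
\<close>

definition VDBL_pullback ::
  "('w \<Rightarrow> 'w set) \<Rightarrow>
   ('xo, 'xv, 'xh, 'xc) vdc \<Rightarrow> ('yo, 'yv, 'yh, 'yc) vdc \<Rightarrow>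
   ('po, 'pv, 'ph, 'pc) vdc \<Rightarrow> ('zo, 'zv, 'zh, 'zc) vdc \<Rightarrow>
   ('xo, 'xv, 'xh, 'xc, 'yo, 'yv, 'yh, 'yc) vdf \<Rightarrow> ('xo, 'xv, 'xh, 'xc, 'po, 'pv, 'ph, 'pc) vdf \<Rightarrow>
   ('yo, 'yv, 'yh, 'yc, 'zo, 'zv, 'zh, 'zc) vdf \<Rightarrow> ('po, 'pv, 'ph, 'pc, 'zo, 'zv, 'zh, 'zc) vdf \<Rightarrow>
   bool" where
  "VDBL_pullback el X Y Z' Z P E D Q \<longleftrightarrow>
     large_vdc el X \<and> large_vdc el Y \<and> large_vdc el Z' \<and> large_vdc el Z \<and>
     vd_functor X Y P \<and> vd_functor X Z' E \<and> vd_functor Y Z D \<and> vd_functor Z' Z Q \<and>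
     vdf_eq X (vdf_comp D P) (vdf_comp Q E) \<and>
     (\<forall>W :: ('w, 'w, 'w, 'w) vdc. large_vdc el W \<longrightarrow>
       (\<forall>G H. vd_functor W Y G \<and> vd_functor W Z' H \<and> vdf_eq W (vdf_comp D G) (vdf_comp Q H) \<longrightarrow>
         (\<exists>K. (vd_functor W X K \<and> vdf_eq W (vdf_comp P K) G \<and> vdf_eq W (vdf_comp E K) H) \<and>
           (\<forall>K'. vd_functor W X K' \<and> vdf_eq W (vdf_comp P K') G \<and> vdf_eq W (vdf_comp E K') H \<longrightarrow>
             vdf_eq W K' K))) \<and>
       (\<forall>K K' \<alpha> \<beta>. vd_functor W X K \<and> vd_functor W X K' \<and>
          vertical_transformation W Y (vdf_comp P K) (vdf_comp P K') \<alpha> \<and>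
          vertical_transformation W Z' (vdf_comp E K) (vdf_comp E K') \<beta> \<and>
          vt_eq W (whisker D \<alpha>) (whisker Q \<beta>) \<longrightarrow>
         (\<exists>\<gamma>. (vertical_transformation W X K K' \<gamma> \<and>
             vt_eq W (whisker P \<gamma>) \<alpha> \<and> vt_eq W (whisker E \<gamma>) \<beta>) \<and>
           (\<forall>\<gamma>'. vertical_transformation W X K K' \<gamma>' \<and>
               vt_eq W (whisker P \<gamma>') \<alpha> \<and> vt_eq W (whisker E \<gamma>') \<beta> \<longrightarrow>
             vt_eq W \<gamma>' \<gamma>))))"


section \<open>Discrete opfibrations\<close>

definition path_end :: "('o, 'v, 'h, 'c) vdc \<Rightarrow> 'o \<Rightarrow> 'h list \<Rightarrow> 'o" where
  "path_end A a hs = (if hs = [] then a else htgt A (last hs))"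

definition is_vlift ::
  "('o1, 'v1, 'h1, 'c1) vdc \<Rightarrow> ('o1, 'v1, 'h1, 'c1, 'o2, 'v2, 'h2, 'c2) vdf \<Rightarrow> 'o1 \<Rightarrow> 'v2 \<Rightarrow> 'v1 \<Rightarrow> bool" where
  "is_vlift X P x v w \<longleftrightarrow> w \<in> Vert X \<and> vdom X w = x \<and> fV P w = v"

definition vlift ::
  "('o1, 'v1, 'h1, 'c1) vdc \<Rightarrow> ('o1, 'v1, 'h1, 'c1, 'o2, 'v2, 'h2, 'c2) vdf \<Rightarrow> 'o1 \<Rightarrow> 'v2 \<Rightarrow> 'v1" where
  "vlift X P x v = (THE w. is_vlift X P x v w)"

text \<open>The path to be lifted along starts at \<open>x\<close> and consists of the horizontal morphisms \<open>hs\<close>.\<close>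

definition is_clift ::
  "('o1, 'v1, 'h1, 'c1) vdc \<Rightarrow> ('o2, 'v2, 'h2, 'c2) vdc \<Rightarrow>
   ('o1, 'v1, 'h1, 'c1, 'o2, 'v2, 'h2, 'c2) vdf \<Rightarrow> 'o1 \<Rightarrow> 'h1 list \<Rightarrow> 'c2 \<Rightarrow> 'c1 \<Rightarrow> bool" where
  "is_clift X Y P x hs \<nu> c \<longleftrightarrow>
     c \<in> Cell X \<and> ctop X c = hs \<and>
     cleft X c = vlift X P x (cleft Y \<nu>) \<and> cright X c = vlift X P (path_end X x hs) (cright Y \<nu>) \<and>
     fC P c = \<nu>"

definition clift ::
  "('o1, 'v1, 'h1, 'c1) vdc \<Rightarrow> ('o2, 'v2, 'h2, 'c2) vdc \<Rightarrow>
   ('o1, 'v1, 'h1, 'c1, 'o2, 'v2, 'h2, 'c2) vdf \<Rightarrow> 'o1 \<Rightarrow> 'h1 list \<Rightarrow> 'c2 \<Rightarrow> 'c1" where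
  "clift X Y P x hs \<nu> = (THE c. is_clift X Y P x hs \<nu> c)"

definition discrete_opfibration ::
  "('o1, 'v1, 'h1, 'c1) vdc \<Rightarrow> ('o2, 'v2, 'h2, 'c2) vdc \<Rightarrow>
   ('o1, 'v1, 'h1, 'c1, 'o2, 'v2, 'h2, 'c2) vdf \<Rightarrow> bool" where
  "discrete_opfibration X Y P \<longleftrightarrow>
     vd_functor X Y P \<and>
     (\<forall>x\<in>Obj X. \<forall>v\<in>Vert Y. vdom Y v = fO P x \<longrightarrow> (\<exists>!w. is_vlift X P x v w)) \<and>
     (\<forall>x hs x'. path_in X x hs x' \<longrightarrow>
        (\<forall>\<nu>\<in>Cell Y. vdom Y (cleft Y \<nu>) = fO P x \<and> ctop Y \<nu> = map (fH P) hs \<longrightarrow>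
           (\<exists>!c. is_clift X Y P x hs \<nu> c)))"

definition fibO ::
  "('o1, 'v1, 'h1, 'c1) vdc \<Rightarrow> ('o1, 'v1, 'h1, 'c1, 'o2, 'v2, 'h2, 'c2) vdf \<Rightarrow> 'o2 \<Rightarrow> 'o1 set" where
  "fibO X P y = {x \<in> Obj X. fO P x = y}"

definition fibH ::
  "('o1, 'v1, 'h1, 'c1) vdc \<Rightarrow> ('o1, 'v1, 'h1, 'c1, 'o2, 'v2, 'h2, 'c2) vdf \<Rightarrow> 'h2 \<Rightarrow> 'h1 set" where
  "fibH X P \<psi> = {\<phi> \<in> Hor X. fH P \<phi> = \<psi>}"

text \<open>
  \<open>S\<close> and \<open>T\<close> are the collections of small sets of objects and of small sets of horizontal morphisms
  of \<open>X\<close>; they are two parameters only because these have different types.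
\<close>

definition has_fibers_in ::
  "'o1 set set \<Rightarrow> 'h1 set set \<Rightarrow> ('o1, 'v1, 'h1, 'c1) vdc \<Rightarrow> ('o2, 'v2, 'h2, 'c2) vdc \<Rightarrow>
   ('o1, 'v1, 'h1, 'c1, 'o2, 'v2, 'h2, 'c2) vdf \<Rightarrow> bool" where
  "has_fibers_in S T X Y P \<longleftrightarrow>
     (\<forall>y\<in>Obj Y. fibO X P y \<in> S) \<and> (\<forall>\<psi>\<in>Hor Y. fibH X P \<psi> \<in> T)"


section \<open>Spans of sets and of pointed sets\<close>

text \<open>
  The object type \<open>'o\<close> is \<open>'w set\<close> for sets and \<open>'w set \<times> 'w\<close> for pointed sets; the argument
  \<open>car :: 'o \<Rightarrow> 'w set\<close> of the operations below is the underlying set. All functions are extensional.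
\<close>

datatype ('o, 'w) arr = Arr (adom: 'o) (acod: 'o) (afn: "'w \<Rightarrow> 'w")

datatype ('o, 'w) span =
  Span (ssrc: 'o) (sapex: 'o) (stgt: 'o) (sleg: "'w \<Rightarrow> 'w") (sleg': "'w \<Rightarrow> 'w")

text \<open>
  The function \<open>mfn\<close> of a multicell is defined on the limit of the zigzag
  \<open>I\<^sub>0 \<leftarrow> S\<^sub>1 \<rightarrow> I\<^sub>1 \<leftarrow> \<dots> \<leftarrow> S\<^sub>n \<rightarrow> I\<^sub>n\<close>. Its elements are the pairs \<open>(i, [s\<^sub>1, \<dots>, s\<^sub>n])\<close> with \<open>i\<close>
  in \<open>I\<^sub>0\<close> the image of \<open>s\<^sub>1\<close> and consecutive \<open>s\<^sub>j\<close> matching. For \<open>n > 0\<close> the component \<open>i\<close> is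
  redundant and this is the iterated fibre product of the \<open>S\<^sub>j\<close>; for \<open>n = 0\<close> it is \<open>I\<^sub>0\<close>.
\<close>

datatype ('o, 'w) mcell =
  MCell (mleft: "('o, 'w) arr") (mright: "('o, 'w) arr")
    (mtop: "('o, 'w) span list") (mbot: "('o, 'w) span") (mfn: "'w \<times> 'w list \<Rightarrow> 'w")

fun matching :: "('o \<Rightarrow> 'w set) \<Rightarrow> 'w \<Rightarrow> ('o, 'w) span list \<Rightarrow> 'w list \<Rightarrow> bool" where
  "matching car i [] [] \<longleftrightarrow> True"
| "matching car i (S # Ss) (s # ss) \<longleftrightarrow>
     s \<in> car (sapex S) \<and> sleg S s = i \<and> matching car (sleg' S s) Ss ss"
| "matching car i _ _ \<longleftrightarrow> False"

definition fibprod :: "('o \<Rightarrow> 'w set) \<Rightarrow> 'o \<Rightarrow> ('o, 'w) span list \<Rightarrow> ('w \<times> 'w list) set" where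
  "fibprod car I Ss = {(i, ss). i \<in> car I \<and> matching car i Ss ss}"

definition tuple_end :: "('o, 'w) span list \<Rightarrow> 'w \<times> 'w list \<Rightarrow> 'w" where
  "tuple_end Ss = (\<lambda>(i, ss). if ss = [] then i else sleg' (last Ss) (last ss))"

definition arr_comp :: "('o \<Rightarrow> 'w set) \<Rightarrow> ('o, 'w) arr \<Rightarrow> ('o, 'w) arr \<Rightarrow> ('o, 'w) arr" where
  "arr_comp car g f = Arr (adom f) (acod g) (\<lambda>x\<in>car (adom f). afn g (afn f x))"

definition arr_id :: "('o \<Rightarrow> 'w set) \<Rightarrow> 'o \<Rightarrow> ('o, 'w) arr" where
  "arr_id car I = Arr I I (\<lambda>x\<in>car I. x)"

definition mcell_id :: "('o \<Rightarrow> 'w set) \<Rightarrow> ('o, 'w) span \<Rightarrow> ('o, 'w) mcell" where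
  "mcell_id car S = MCell (arr_id car (ssrc S)) (arr_id car (stgt S)) [S] S
     (\<lambda>(i, ss)\<in>fibprod car (ssrc S) [S]. hd ss)"

text \<open>
  Apply the multicells \<open>t1, \<dots>, tm\<close> to the consecutive blocks of a tuple over the concatenation of
  their tops.
\<close>

fun apply_mcells :: "('o, 'w) mcell list \<Rightarrow> 'w \<times> 'w list \<Rightarrow> 'w list" where
  "apply_mcells [] (i, ss) = []"
| "apply_mcells (t # ts) (i, ss) =
     (let ss1 = take (length (mtop t)) ss; ss2 = drop (length (mtop t)) ss
      in mfn t (i, ss1) # apply_mcells ts (tuple_end (mtop t) (i, ss1), ss2))"

definition mcell_comp ::
  "('o \<Rightarrow> 'w set) \<Rightarrow> ('o, 'w) mcell \<Rightarrow> ('o, 'w) arr \<Rightarrow> ('o, 'w) mcell list \<Rightarrow> ('o, 'w) mcell" where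
  "mcell_comp car k u ts =
     MCell (arr_comp car (mleft k) u)
       (arr_comp car (mright k) (if ts = [] then u else mright (last ts)))
       (concat (map mtop ts)) (mbot k)
       (\<lambda>(i, ss)\<in>fibprod car (adom u) (concat (map mtop ts)). mfn k (afn u i, apply_mcells ts (i, ss)))"

definition Set_arrs :: "'w set set \<Rightarrow> ('w set, 'w) arr set" where
  "Set_arrs S = {f. adom f \<in> S \<and> acod f \<in> S \<and> afn f \<in> adom f \<rightarrow>\<^sub>E acod f}"

definition Set_spans :: "'w set set \<Rightarrow> ('w set, 'w) span set" where
  "Set_spans S = {R. ssrc R \<in> S \<and> sapex R \<in> S \<and> stgt R \<in> S \<and>
     sleg R \<in> sapex R \<rightarrow>\<^sub>E ssrc R \<and> sleg' R \<in> sapex R \<rightarrow>\<^sub>E stgt R}"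

definition Set_mcells :: "'w set set \<Rightarrow> ('w set, 'w) mcell set" where
  "Set_mcells S = {t.
     mleft t \<in> Set_arrs S \<and> mright t \<in> Set_arrs S \<and> mbot t \<in> Set_spans S \<and>
     hpath S (Set_spans S) ssrc stgt (adom (mleft t)) (mtop t) (adom (mright t)) \<and>
     ssrc (mbot t) = acod (mleft t) \<and> stgt (mbot t) = acod (mright t) \<and>
     mfn t \<in> fibprod id (adom (mleft t)) (mtop t) \<rightarrow>\<^sub>E sapex (mbot t) \<and>
     (\<forall>(i, ss) \<in> fibprod id (adom (mleft t)) (mtop t).
        sleg (mbot t) (mfn t (i, ss)) = afn (mleft t) i \<and>
        sleg' (mbot t) (mfn t (i, ss)) = afn (mright t) (tuple_end (mtop t) (i, ss)))}"

text \<open>Spans in the category of sets belonging to \<open>S\<close>.\<close>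

definition SPAN :: "'w set set \<Rightarrow> ('w set, ('w set, 'w) arr, ('w set, 'w) span, ('w set, 'w) mcell) vdc" where
  "SPAN S = \<lparr>
     Obj = S,
     Vert = Set_arrs S, vdom = adom, vcod = acod, vid = arr_id id, vcomp = arr_comp id,
     Hor = Set_spans S, hsrc = ssrc, htgt = stgt,
     Cell = Set_mcells S, ctop = mtop, cbot = mbot, cleft = mleft, cright = mright,
     cid = mcell_id id, ccomp = mcell_comp id\<rparr>"

text \<open>
  A pointed set is a pair \<open>(A, a)\<close> with \<open>a \<in> A\<close>. Arrows, spans and multicells of pointed sets are those
  of the underlying sets whose functions preserve base points. The base point of a fibre product
  consists of the base points of the factors.
\<close>

definition Ptd_sets :: "'w set set \<Rightarrow> ('w set \<times> 'w) set" where
  "Ptd_sets S = {(A, a). A \<in> S \<and> a \<in> A}"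

definition Ptd_arrs :: "'w set set \<Rightarrow> ('w set \<times> 'w, 'w) arr set" where
  "Ptd_arrs S = {f. map_arr fst f \<in> Set_arrs S \<and> adom f \<in> Ptd_sets S \<and> acod f \<in> Ptd_sets S \<and>
     afn f (snd (adom f)) = snd (acod f)}"

definition Ptd_spans :: "'w set set \<Rightarrow> ('w set \<times> 'w, 'w) span set" where
  "Ptd_spans S = {R. map_span fst R \<in> Set_spans S \<and>
     ssrc R \<in> Ptd_sets S \<and> sapex R \<in> Ptd_sets S \<and> stgt R \<in> Ptd_sets S \<and>
     sleg R (snd (sapex R)) = snd (ssrc R) \<and> sleg' R (snd (sapex R)) = snd (stgt R)}"

definition Ptd_mcells :: "'w set set \<Rightarrow> ('w set \<times> 'w, 'w) mcell set" where
  "Ptd_mcells S = {t. map_mcell fst t \<in> Set_mcells S \<and>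
     mleft t \<in> Ptd_arrs S \<and> mright t \<in> Ptd_arrs S \<and> mbot t \<in> Ptd_spans S \<and>
     hpath (Ptd_sets S) (Ptd_spans S) ssrc stgt (adom (mleft t)) (mtop t) (adom (mright t)) \<and>
     ssrc (mbot t) = acod (mleft t) \<and> stgt (mbot t) = acod (mright t) \<and>
     mfn t (snd (adom (mleft t)), map (snd \<circ> sapex) (mtop t)) = snd (sapex (mbot t))}"

definition SPAN_pt ::
  "'w set set \<Rightarrow> ('w set \<times> 'w, ('w set \<times> 'w, 'w) arr, ('w set \<times> 'w, 'w) span, ('w set \<times> 'w, 'w) mcell) vdc" where
  "SPAN_pt S = \<lparr>
     Obj = Ptd_sets S,
     Vert = Ptd_arrs S, vdom = adom, vcod = acod, vid = arr_id fst, vcomp = arr_comp fst,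
     Hor = Ptd_spans S, hsrc = ssrc, htgt = stgt,
     Cell = Ptd_mcells S, ctop = mtop, cbot = mbot, cleft = mleft, cright = mright,
     cid = mcell_id fst, ccomp = mcell_comp fst\<rparr>"

text \<open>The functor induced by the forgetful functor from pointed sets to sets.\<close>

definition Q_functor ::
  "('w set \<times> 'w, ('w set \<times> 'w, 'w) arr, ('w set \<times> 'w, 'w) span, ('w set \<times> 'w, 'w) mcell,
    'w set, ('w set, 'w) arr, ('w set, 'w) span, ('w set, 'w) mcell) vdf" where
  "Q_functor = \<lparr>fO = fst, fV = map_arr fst, fH = map_span fst, fC = map_mcell fst\<rparr>"


section \<open>The classifying functor of a discrete opfibration\<close>

text \<open>
  Objects and horizontal morphisms of \<open>X\<close> are taken in the type of elements of sets, so that the fibres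
  are themselves objects of the category of sets.
\<close>

definition D_vert ::
  "('w, 'xv, 'w, 'xc) vdc \<Rightarrow> ('yo, 'yv, 'yh, 'yc) vdc \<Rightarrow> ('w, 'xv, 'w, 'xc, 'yo, 'yv, 'yh, 'yc) vdf \<Rightarrow>
   'yv \<Rightarrow> ('w set, 'w) arr" where
  "D_vert X Y P v =
     Arr (fibO X P (vdom Y v)) (fibO X P (vcod Y v))
       (\<lambda>x\<in>fibO X P (vdom Y v). vcod X (vlift X P x v))"

definition D_hor ::
  "('w, 'xv, 'w, 'xc) vdc \<Rightarrow> ('yo, 'yv, 'yh, 'yc) vdc \<Rightarrow> ('w, 'xv, 'w, 'xc, 'yo, 'yv, 'yh, 'yc) vdf \<Rightarrow>
   'yh \<Rightarrow> ('w set, 'w) span" where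
  "D_hor X Y P \<psi> =
     Span (fibO X P (hsrc Y \<psi>)) (fibH X P \<psi>) (fibO X P (htgt Y \<psi>))
       (restrict (hsrc X) (fibH X P \<psi>)) (restrict (htgt X) (fibH X P \<psi>))"

definition D_cell ::
  "('w, 'xv, 'w, 'xc) vdc \<Rightarrow> ('yo, 'yv, 'yh, 'yc) vdc \<Rightarrow> ('w, 'xv, 'w, 'xc, 'yo, 'yv, 'yh, 'yc) vdf \<Rightarrow>
   'yc \<Rightarrow> ('w set, 'w) mcell" where
  "D_cell X Y P \<nu> =
     MCell (D_vert X Y P (cleft Y \<nu>)) (D_vert X Y P (cright Y \<nu>))
       (map (D_hor X Y P) (ctop Y \<nu>)) (D_hor X Y P (cbot Y \<nu>))
       (\<lambda>(x, hs)\<in>fibprod id (fibO X P (vdom Y (cleft Y \<nu>))) (map (D_hor X Y P) (ctop Y \<nu>)).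
          cbot X (clift X Y P x hs \<nu>))"

definition D_functor ::
  "('w, 'xv, 'w, 'xc) vdc \<Rightarrow> ('yo, 'yv, 'yh, 'yc) vdc \<Rightarrow> ('w, 'xv, 'w, 'xc, 'yo, 'yv, 'yh, 'yc) vdf \<Rightarrow>
   ('yo, 'yv, 'yh, 'yc, 'w set, ('w set, 'w) arr, ('w set, 'w) span, ('w set, 'w) mcell) vdf" where
  "D_functor X Y P =
     \<lparr>fO = fibO X P, fV = D_vert X Y P, fH = D_hor X Y P, fC = D_cell X Y P\<rparr>"

end

theory Submission
  imports Defs
begin

text \<open>
  Pointing a set is choosing one of its elements. For a discrete opfibration \<open>P : X \<rightarrow> Y\<close> the object
  \<open>x\<close> of \<open>X\<close> is the same thing as the object \<open>P x\<close> of \<open>Y\<close> together with a point of the set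
  \<open>fibO X P (P x)\<close>, and a horizontal morphism \<open>h\<close> is the same thing as \<open>P h\<close> together with a point
  of the apex of the span \<open>D_hor X Y P (P h)\<close>. A vertical morphism or a multicell of \<open>X\<close> is
  determined, by unique lifting, by its image under \<open>P\<close> and its domain; on the other side, an arrow
  or a multicell of spans of pointed sets is determined by the underlying one and the base points of
  its domain, because \<open>Q_functor\<close> is a discrete opfibration too. Hence \<open>X\<close> is, level by level, the
  set-theoretic pullback of pointed spans along \<open>D_functor X Y P\<close>; this is the content of
  \<open>ex1_Obj_over\<close>, \<open>ex1_Vert_over\<close>, \<open>ex1_Hor_over\<close> and \<open>ex1_Cell_over\<close>. The fourth side of the
  square, \<open>E_functor\<close>, sends \<open>x\<close> to the fibre through \<open>x\<close> pointed by \<open>x\<close>.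

  A commuting square of virtual double functors that is a pullback of sets on objects, vertical
  morphisms, horizontal morphisms and multicells is a pullback in the 2-category (locale
  \<open>levelwise_pullback\<close>). Data into \<open>X\<close> are pairs of data into \<open>Y\<close> and into pointed spans,
  and every equation that such data must satisfy can be checked after applying \<open>P\<close> and
  \<open>E_functor\<close>, where it holds by assumption.

  Four things remain to be verified. That spans form a virtual double category is shown once for
  sets with a distinguished subset (\<open>struct_span\<close>), of which plain and pointed sets are both
  instances. That these virtual double categories are large follows from the closure of the universe
  under products, lists and power sets (\<open>large_size\<close>). That \<open>D_functor\<close> preserves composites
  is uniqueness of lifts: lifting a composite multicell step by step gives a lift of the composite
  (\<open>D_cell_ccomp\<close>). That \<open>Q_functor\<close> is a discrete opfibration with small fibres holds because a
  function out of a pointed set has exactly one pointed lift, whose codomain is pointed by the image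
  of the base point (\<open>pt_arr\<close>, \<open>pt_span\<close>, \<open>pt_cell\<close>).
\<close>

section \<open>Closure properties of the large universe\<close>

text \<open>
  Being dominated by a set of the universe is easier to propagate than being in bijection with one,
  and the two agree, since subsets of sets of the universe belong to it (\<open>large_size_imp_up_to_bij\<close>).
\<close>

definition large_size :: "('w \<Rightarrow> 'w set) \<Rightarrow> 'a set \<Rightarrow> bool" where
  "large_size el A \<longleftrightarrow> (\<exists>z. A \<lesssim> el z)"

text \<open>
  A finite universe would have a member with the greatest number of elements, but the power
  set of that member has more.
\<close>

lemma grothendieck_universe_infinite:
  assumes "inj el" and U: "grothendieck_universe el U"
  shows "infinite U"
proof
  assume fin: "finite U"
  have "U \<noteq> {}" using U by (simp add: grothendieck_universe_def)
  let ?m = "Max ((\<lambda>x. card (el x)) ` U)"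
  have "?m \<in> (\<lambda>x. card (el x)) ` U" using fin \<open>U \<noteq> {}\<close> by (intro Max_in) auto
  then obtain x where x: "x \<in> U" and m: "?m = card (el x)" by blast
  have max: "card (el y) \<le> card (el x)" if "y \<in> U" for y
    unfolding m[symmetric] using fin that by (intro Max_ge) auto
  have finx: "finite (el x)" using U x fin finite_subset[of "el x" U] by (auto simp: grothendieck_universe_def)
  have "\<forall>x\<in>U. \<exists>z\<in>U. el ` el z = Pow (el x)"
    using U by (simp add: grothendieck_universe_def)
  with x obtain z where z: "z \<in> U" "el ` el z = Pow (el x)" by blast
  have "card (el z) = card (Pow (el x))"
    using card_image[OF inj_on_subset[OF \<open>inj el\<close> subset_UNIV], of "el z"] z(2) by simp
  also have "\<dots> = 2 ^ card (el x)" using finx by (simp add: card_Pow)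
  finally have "card (el x) < card (el z)" by simp
  with max[OF z(1)] show False by simp
qed

lemma large_size_lepoll: "large_size el B \<Longrightarrow> A \<lesssim> B \<Longrightarrow> large_size el A"
  unfolding large_size_def using lepoll_trans by metis

lemma large_size_inj_on: "large_size el B \<Longrightarrow> inj_on f A \<Longrightarrow> f ` A \<subseteq> B \<Longrightarrow> large_size el A"
  by (rule large_size_lepoll) (unfold lepoll_def, blast+)

lemma large_size_subset: "large_size el B \<Longrightarrow> A \<subseteq> B \<Longrightarrow> large_size el A"
  by (rule large_size_lepoll[OF _ subset_imp_lepoll])

context
  fixes el :: "'w \<Rightarrow> 'w set" and u1 :: 'w
  assumes univ: "universe_pair el u1"
begin

lemma inj_el: "inj el" and U1: "grothendieck_universe el (el u1)"
  using univ by (auto simp: universe_pair_def)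

lemma pair_code: "\<exists>z. el z = {x, y}"
  and pow_code: "\<exists>p. el ` el p = Pow (el z)"
  and union_code: "\<exists>z. el z = (\<Union>j\<in>el i. el (f j))"
  using univ by (simp_all add: universe_pair_def grothendieck_universe_def)

lemma large_size_Pow:
  assumes "large_size el A"
  shows "large_size el (Pow A)"
proof -
  obtain z where z: "A \<lesssim> el z" using assms by (auto simp: large_size_def)
  then obtain f where f: "inj_on f A" "f ` A \<subseteq> el z" by (auto simp: lepoll_def)
  obtain p where p: "el ` el p = Pow (el z)" using pow_code by blast
  have "Pow A \<lesssim> Pow (el z)"
    using f by (auto simp: lepoll_def intro!: exI[of _ "image f"] inj_on_image_Pow)
  also have "Pow (el z) \<lesssim> el p" using p image_lepoll by metis
  finally show ?thesis by (auto simp: large_size_def)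
qed

text \<open>
  The set with code \<open>u1\<close> is infinite, so both factors embed into one infinite set of the
  universe, and an infinite set is equinumerous with its square.
\<close>

lemma large_size_Times:
  assumes "large_size el A" "large_size el B"
  shows "large_size el (A \<times> B)"
proof -
  obtain x y where xy: "A \<lesssim> el x" "B \<lesssim> el y" using assms by (auto simp: large_size_def)
  obtain q where q: "el q = {x, y}" using pair_code by blast
  obtain r where r: "el r = {q, u1}" using pair_code by blast
  obtain s where s: "el s = el x \<union> el y" using union_code[of id q] q by auto
  obtain t where t: "el t = {s, u1}" using pair_code by blast
  obtain c where c: "el c = el s \<union> el u1" using union_code[of id t] t by auto
  have "infinite (el c)"
    using grothendieck_universe_infinite[OF inj_el U1] c by simp
  then have "el c \<times> el c \<approx> el c"
    by (simp add: card_of_Times_same_infinite eqpoll_iff_card_of_ordIso)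
  moreover have "A \<lesssim> el c" "B \<lesssim> el c"
    using xy lepoll_trans[OF _ subset_imp_lepoll] c s by (metis Un_upper1 Un_upper2 sup.coboundedI1)+
  then have "A \<times> B \<lesssim> el c \<times> el c" by (rule times_lepoll_mono)
  ultimately show ?thesis unfolding large_size_def by (blast intro: lepoll_trans2)
qed

text \<open>
  A list embeds as its graph, a set of pairs of a position and an entry.
\<close>

lemma large_size_lists:
  assumes "large_size el A"
  shows "large_size el (lists A)"
proof (rule large_size_inj_on)
  have "(UNIV :: nat set) \<lesssim> el u1"
    using grothendieck_universe_infinite[OF inj_el U1] by (simp add: infinite_le_lepoll)
  then show "large_size el (Pow ((UNIV :: nat set) \<times> A))"
    using assms by (intro large_size_Pow large_size_Times) (auto simp: large_size_def)
  let ?f = "\<lambda>xs. {(i, xs ! i) | i. i < length xs}"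
  show "?f ` lists A \<subseteq> Pow (UNIV \<times> A)" by (auto simp: in_lists_conv_set)
  show "inj_on ?f (lists A)"
  proof (rule inj_onI, rule nth_equalityI)
    fix xs ys :: "'b list" assume eq: "?f xs = ?f ys"
    have dom: "fst ` ?f zs = {..<length zs}" for zs :: "'b list" by force
    show "length xs = length ys" using dom[of xs] dom[of ys] eq by simp
    fix i assume "i < length xs"
    then have "(i, xs ! i) \<in> ?f ys" unfolding eq[symmetric] by blast
    then show "xs ! i = ys ! i" by blast
  qed
qed

text \<open>
  An extensional function is determined by its domain and its graph. The domain \<open>D (k x)\<close> is
  allowed to vary, since the function underlying an arrow, leg or multicell has a domain that depends
  on the boundary \<open>k x\<close>.
\<close>

lemma large_size_PiE:
  assumes K: "large_size el K" and A: "large_size el A" and B: "large_size el B"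
    and k: "k ` X \<subseteq> K" and f: "\<And>x. x \<in> X \<Longrightarrow> f x \<in> D (k x) \<rightarrow>\<^sub>E C (k x)"
    and sub: "\<And>x. x \<in> X \<Longrightarrow> D (k x) \<subseteq> A \<and> C (k x) \<subseteq> B"
    and inj: "inj_on (\<lambda>x. (k x, f x)) X"
  shows "large_size el X"
proof (rule large_size_inj_on)
  show "large_size el (K \<times> Pow (A \<times> B))"
    by (intro large_size_Times large_size_Pow K A B)
  let ?g = "\<lambda>x. (k x, (\<lambda>a. (a, f x a)) ` D (k x))"
  show "?g ` X \<subseteq> K \<times> Pow (A \<times> B)" 
  proof (intro image_subsetI SigmaI PowI)
    fix x a assume "x \<in> X" "a \<in> D (k x)"
    then show "a \<in> A" "f x a \<in> B" using f[of x] sub[of x] by (auto dest: PiE_mem)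
  qed (use k in auto)
  show "inj_on ?g X"
  proof (rule inj_onI)
    fix x y assume xy: "x \<in> X" "y \<in> X" and eq: "?g x = ?g y"
    then have "k x = k y" by simp
    moreover have "f x = f y"
    proof (rule PiE_ext)
      show "f x \<in> D (k x) \<rightarrow>\<^sub>E C (k x)" using f xy(1) .
      show "f y \<in> D (k x) \<rightarrow>\<^sub>E C (k x)" using f[OF xy(2)] \<open>k x = k y\<close> by simp
      show "f x a = f y a" if "a \<in> D (k x)" for a
        using eq that by auto
    qed
    ultimately show "x = y" using inj xy by (auto dest: inj_onD)
  qed
qed

lemma large_size_imp_up_to_bij:
  assumes "large_size el A"
  shows "A \<in> up_to_bij (large_sets el)"
proof -
  obtain z where "A \<lesssim> el z" using assms by (auto simp: large_size_def)
  then obtain f where f: "inj_on f A" "f ` A \<subseteq> el z" by (auto simp: lepoll_def)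
  obtain p where "el ` el p = Pow (el z)" using pow_code by blast
  with f(2) obtain b where "el b = f ` A" by (metis PowI imageE)
  moreover have "A \<approx> f ` A" using f(1) by (auto simp: eqpoll_def bij_betw_def)
  ultimately have "A \<approx> el b" by simp
  then show ?thesis by (auto simp: up_to_bij_def large_sets_def)
qed

lemma small_sets_subset: "A \<in> small_sets el u1 \<Longrightarrow> A \<subseteq> el u1"
  using U1 by (auto simp: small_sets_def grothendieck_universe_def)

lemma large_size_U1: "large_size el (el u1)" and large_size_small_sets: "large_size el (small_sets el u1)"
  unfolding large_size_def small_sets_def using image_lepoll by blast+

end

section \<open>Paths, boundaries and functors\<close>

lemma hpath_ends: "hpath Ob Ho s t a hs b \<Longrightarrow> a \<in> Ob \<and> b \<in> Ob \<and> set hs \<subseteq> Ho"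
  by (induction hs arbitrary: a) auto

lemma hpath_append:
  "hpath Ob Ho s t a (xs @ ys) c \<longleftrightarrow> (\<exists>b. hpath Ob Ho s t a xs b \<and> hpath Ob Ho s t b ys c)"
  by (induction xs arbitrary: a) (auto dest: hpath_ends)

lemma hpath_unique: "hpath Ob Ho s t a hs b \<Longrightarrow> hpath Ob Ho s t a hs b' \<Longrightarrow> b = b'"
  by (induction hs arbitrary: a) auto

lemma hpath_map:
  assumes "hpath Ob Ho s t a hs b"
    and "\<And>x. x \<in> Ob \<Longrightarrow> f x \<in> Ob'"
    and "\<And>h. h \<in> Ho \<Longrightarrow> g h \<in> Ho' \<and> s' (g h) = f (s h) \<and> t' (g h) = f (t h)"
  shows "hpath Ob' Ho' s' t' (f a) (map g hs) (f b)"
  using assms(1) by (induction hs arbitrary: a) (auto simp: assms(2,3))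

lemma path_end_simps [simp]:
  "path_end A a [] = a" "path_end A a (h # hs) = path_end A (htgt A h) hs"
  by (auto simp: path_end_def)

lemma hpath_path_end: "path_in A a hs b \<Longrightarrow> path_end A a hs = b"
  by (induction hs arbitrary: a) auto

lemma path_right_simps [simp]:
  "path_right A u [] = u" "path_right A u (t # ts) = path_right A (cright A t) ts"
  by (auto simp: path_right_def)

text \<open>
  The typing part of the axioms is isolated because it already determines which paths
  and rows of multicells fit together, which is needed to prove the remaining axioms for spans.
\<close>

locale vdc_boundaries =
  fixes A :: "('o, 'v, 'h, 'c) vdc"
  assumes vdom_in: "u \<in> Vert A \<Longrightarrow> vdom A u \<in> Obj A"
    and vcod_in: "u \<in> Vert A \<Longrightarrow> vcod A u \<in> Obj A"
    and cell_boundary: "t \<in> Cell A \<Longrightarrow>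
      cleft A t \<in> Vert A \<and> cright A t \<in> Vert A \<and> cbot A t \<in> Hor A \<and>
      path_in A (vdom A (cleft A t)) (ctop A t) (vdom A (cright A t)) \<and>
      hsrc A (cbot A t) = vcod A (cleft A t) \<and> htgt A (cbot A t) = vcod A (cright A t)"
begin

lemma cell_path_in: "cell_path A u ts \<Longrightarrow> u \<in> Vert A \<and> path_right A u ts \<in> Vert A \<and> set ts \<subseteq> Cell A"
  by (induction ts arbitrary: u) (auto dest: cell_boundary)

lemma cell_path_top:
  "cell_path A u ts \<Longrightarrow> path_in A (vdom A u) (concat (map (ctop A) ts)) (vdom A (path_right A u ts))"
  by (induction ts arbitrary: u) (auto simp: hpath_append vdom_in dest: cell_boundary)

lemma cell_path_bot:
  "cell_path A u ts \<Longrightarrow> path_in A (vcod A u) (map (cbot A) ts) (vcod A (path_right A u ts))"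
  by (induction ts arbitrary: u) (auto simp: vcod_in dest: cell_boundary)

text \<open>
  Composability only demands that the left boundaries match. The right ones then match as well,
  because a path has a unique end.
\<close>

lemma composable_right:
  assumes "composable A k u ts"
  shows "vcod A (path_right A u ts) = vdom A (cright A k)"
  using assms cell_path_bot[of u ts] cell_boundary[of k] hpath_unique
  unfolding composable_def by metis

lemma cell_path_append:
  "cell_path A u (xs @ ys) \<longleftrightarrow> cell_path A u xs \<and> cell_path A (path_right A u xs) ys"
  by (induction xs arbitrary: u) (auto dest: cell_path_in)

end

sublocale virtual_double_category \<subseteq> vdc_boundaries
  by unfold_locales (fact vdom_in vcod_in cell_boundary)+

text \<open>
  A virtual double functor without the preservation of identities and composites: enough to
  transport composability, hence a first step towards proving functoriality.
\<close>

definition boundary_preserving ::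
  "('o1, 'v1, 'h1, 'c1) vdc \<Rightarrow> ('o2, 'v2, 'h2, 'c2) vdc \<Rightarrow>
   ('o1, 'v1, 'h1, 'c1, 'o2, 'v2, 'h2, 'c2) vdf \<Rightarrow> bool" where
  "boundary_preserving A B F \<longleftrightarrow>
     (\<forall>a\<in>Obj A. fO F a \<in> Obj B) \<and>
     (\<forall>u\<in>Vert A. fV F u \<in> Vert B \<and> vdom B (fV F u) = fO F (vdom A u) \<and> vcod B (fV F u) = fO F (vcod A u)) \<and>
     (\<forall>h\<in>Hor A. fH F h \<in> Hor B \<and> hsrc B (fH F h) = fO F (hsrc A h) \<and> htgt B (fH F h) = fO F (htgt A h)) \<and>
     (\<forall>t\<in>Cell A. fC F t \<in> Cell B \<and> ctop B (fC F t) = map (fH F) (ctop A t) \<and>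
        cbot B (fC F t) = fH F (cbot A t) \<and>
        cleft B (fC F t) = fV F (cleft A t) \<and> cright B (fC F t) = fV F (cright A t))"

lemma vd_functor_iff:
  "vd_functor A B F \<longleftrightarrow> boundary_preserving A B F \<and>
     (\<forall>a\<in>Obj A. fV F (vid A a) = vid B (fO F a)) \<and>
     (\<forall>u\<in>Vert A. \<forall>v\<in>Vert A. vcod A u = vdom A v \<longrightarrow> fV F (vcomp A v u) = vcomp B (fV F v) (fV F u)) \<and>
     (\<forall>h\<in>Hor A. fC F (cid A h) = cid B (fH F h)) \<and>
     (\<forall>k u ts. composable A k u ts \<longrightarrow>
        fC F (ccomp A k u ts) = ccomp B (fC F k) (fV F u) (map (fC F) ts))"
  unfolding vd_functor_def boundary_preserving_def by blast

lemma vd_functor_boundary: "vd_functor A B F \<Longrightarrow> boundary_preserving A B F"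
  by (simp add: vd_functor_iff)

lemma boundary_preservingD:
  assumes "boundary_preserving A B F"
  shows "a \<in> Obj A \<Longrightarrow> fO F a \<in> Obj B"
    and "u \<in> Vert A \<Longrightarrow> fV F u \<in> Vert B"
    and "u \<in> Vert A \<Longrightarrow> vdom B (fV F u) = fO F (vdom A u)"
    and "u \<in> Vert A \<Longrightarrow> vcod B (fV F u) = fO F (vcod A u)"
    and "h \<in> Hor A \<Longrightarrow> fH F h \<in> Hor B"
    and "h \<in> Hor A \<Longrightarrow> hsrc B (fH F h) = fO F (hsrc A h)"
    and "h \<in> Hor A \<Longrightarrow> htgt B (fH F h) = fO F (htgt A h)"
    and "t \<in> Cell A \<Longrightarrow> fC F t \<in> Cell B"
    and "t \<in> Cell A \<Longrightarrow> ctop B (fC F t) = map (fH F) (ctop A t)"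
    and "t \<in> Cell A \<Longrightarrow> cbot B (fC F t) = fH F (cbot A t)"
    and "t \<in> Cell A \<Longrightarrow> cleft B (fC F t) = fV F (cleft A t)"
    and "t \<in> Cell A \<Longrightarrow> cright B (fC F t) = fV F (cright A t)"
  using assms unfolding boundary_preserving_def by auto

lemma boundary_preserving_path:
  assumes "boundary_preserving A B F" "path_in A a hs b"
  shows "path_in B (fO F a) (map (fH F) hs) (fO F b)"
  using assms(2) by (rule hpath_map) (simp_all add: boundary_preservingD[OF assms(1)])

lemma boundary_preserving_cell_path:
  assumes "boundary_preserving A B F" "cell_path A u ts"
  shows "cell_path B (fV F u) (map (fC F) ts)"
  using assms(2) by (induction ts arbitrary: u) (auto simp: boundary_preservingD[OF assms(1)])

lemma boundary_preserving_composable: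
  assumes "virtual_double_category A" "boundary_preserving A B F" "composable A k u ts"
  shows "composable B (fC F k) (fV F u) (map (fC F) ts)"
proof -
  interpret virtual_double_category A by fact
  have c: "k \<in> Cell A" "cell_path A u ts" "map (cbot A) ts = ctop A k" "vcod A u = vdom A (cleft A k)"
    using assms(3) by (auto simp: composable_def)
  have "map (cbot B) (map (fC F) ts) = map (fH F) (map (cbot A) ts)"
    using cell_path_in[OF c(2)] by (auto simp: boundary_preservingD[OF assms(2)])
  with c cell_path_in[OF c(2)] cell_boundary[OF c(1)] show ?thesis
    using boundary_preserving_cell_path[OF assms(2) c(2)]
    by (auto simp: composable_def boundary_preservingD[OF assms(2)])
qed

lemma vd_functor_composites:
  assumes "vd_functor A B F"
  shows "a \<in> Obj A \<Longrightarrow> fV F (vid A a) = vid B (fO F a)"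
    and "u \<in> Vert A \<Longrightarrow> v \<in> Vert A \<Longrightarrow> vcod A u = vdom A v \<Longrightarrow>
      fV F (vcomp A v u) = vcomp B (fV F v) (fV F u)"
    and "h \<in> Hor A \<Longrightarrow> fC F (cid A h) = cid B (fH F h)"
    and "composable A k u ts \<Longrightarrow>
      fC F (ccomp A k u ts) = ccomp B (fC F k) (fV F u) (map (fC F) ts)"
  using assms unfolding vd_functor_iff by blast+

section \<open>Pullbacks computed on objects, morphisms and multicells\<close>

lemma vdf_eq_compD:
  assumes "vdf_eq W (vdf_comp P K) G"
  shows "a \<in> Obj W \<Longrightarrow> fO P (fO K a) = fO G a"
    and "u \<in> Vert W \<Longrightarrow> fV P (fV K u) = fV G u"
    and "h \<in> Hor W \<Longrightarrow> fH P (fH K h) = fH G h"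
    and "t \<in> Cell W \<Longrightarrow> fC P (fC K t) = fC G t"
  using assms by (simp_all add: vdf_eq_def vdf_comp_def)

text \<open>
  The hypotheses say that on each of the four levels \<open>X\<close> is the pullback of sets.
\<close>

locale levelwise_pullback =
  X: virtual_double_category X + Y: virtual_double_category Y + Z': virtual_double_category Z'
  for X :: "('xo, 'xv, 'xh, 'xc) vdc" and Y :: "('yo, 'yv, 'yh, 'yc) vdc"
    and Z' :: "('po, 'pv, 'ph, 'pc) vdc" +
  fixes P :: "('xo, 'xv, 'xh, 'xc, 'yo, 'yv, 'yh, 'yc) vdf"
    and E :: "('xo, 'xv, 'xh, 'xc, 'po, 'pv, 'ph, 'pc) vdf"
    and D :: "('yo, 'yv, 'yh, 'yc, 'zo, 'zv, 'zh, 'zc) vdf"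
    and Q :: "('po, 'pv, 'ph, 'pc, 'zo, 'zv, 'zh, 'zc) vdf"
  assumes P: "vd_functor X Y P" and E: "vd_functor X Z' E"
    and square: "vdf_eq X (vdf_comp D P) (vdf_comp Q E)"
    and ex1_Obj: "\<lbrakk>y \<in> Obj Y; z \<in> Obj Z'; fO D y = fO Q z\<rbrakk> \<Longrightarrow>
      \<exists>!x. x \<in> Obj X \<and> fO P x = y \<and> fO E x = z"
    and ex1_Vert: "\<lbrakk>v \<in> Vert Y; f \<in> Vert Z'; fV D v = fV Q f\<rbrakk> \<Longrightarrow>
      \<exists>!w. w \<in> Vert X \<and> fV P w = v \<and> fV E w = f"
    and ex1_Hor: "\<lbrakk>\<psi> \<in> Hor Y; R \<in> Hor Z'; fH D \<psi> = fH Q R\<rbrakk> \<Longrightarrow>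
      \<exists>!h. h \<in> Hor X \<and> fH P h = \<psi> \<and> fH E h = R"
    and ex1_Cell: "\<lbrakk>\<nu> \<in> Cell Y; t \<in> Cell Z'; fC D \<nu> = fC Q t\<rbrakk> \<Longrightarrow>
      \<exists>!c. c \<in> Cell X \<and> fC P c = \<nu> \<and> fC E c = t"
begin

lemmas Pb = boundary_preservingD[OF vd_functor_boundary[OF P]]
lemmas Eb = boundary_preservingD[OF vd_functor_boundary[OF E]]
lemmas Pc = vd_functor_composites[OF P]
lemmas Ec = vd_functor_composites[OF E]

lemma square_eqs:
  "x \<in> Obj X \<Longrightarrow> fO D (fO P x) = fO Q (fO E x)"
  "w \<in> Vert X \<Longrightarrow> fV D (fV P w) = fV Q (fV E w)"
  "h \<in> Hor X \<Longrightarrow> fH D (fH P h) = fH Q (fH E h)"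
  "c \<in> Cell X \<Longrightarrow> fC D (fC P c) = fC Q (fC E c)"
  using square by (simp_all add: vdf_eq_def vdf_comp_def)

lemma joint_Obj: "\<lbrakk>x \<in> Obj X; x' \<in> Obj X; fO P x = fO P x'; fO E x = fO E x'\<rbrakk> \<Longrightarrow> x = x'"
  using ex1_Obj[OF Pb(1) Eb(1) square_eqs(1), of x] by auto

lemma joint_Vert: "\<lbrakk>x \<in> Vert X; x' \<in> Vert X; fV P x = fV P x'; fV E x = fV E x'\<rbrakk> \<Longrightarrow> x = x'"
  using ex1_Vert[OF Pb(2) Eb(2) square_eqs(2), of x] by auto

lemma joint_Hor: "\<lbrakk>x \<in> Hor X; x' \<in> Hor X; fH P x = fH P x'; fH E x = fH E x'\<rbrakk> \<Longrightarrow> x = x'"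
  using ex1_Hor[OF Pb(5) Eb(5) square_eqs(3), of x] by auto

lemma joint_Cell: "\<lbrakk>x \<in> Cell X; x' \<in> Cell X; fC P x = fC P x'; fC E x = fC E x'\<rbrakk> \<Longrightarrow> x = x'"
  using ex1_Cell[OF Pb(8) Eb(8) square_eqs(4), of x] by auto

lemma joint_Hor_list:
  "\<lbrakk>set hs \<subseteq> Hor X; set hs' \<subseteq> Hor X; map (fH P) hs = map (fH P) hs'; map (fH E) hs = map (fH E) hs'\<rbrakk>
    \<Longrightarrow> hs = hs'"
proof (induction hs arbitrary: hs')
  case (Cons h hs)
  then obtain h' hs'' where "hs' = h' # hs''" by (cases hs') auto
  with Cons show ?case by (auto intro: joint_Hor)
qed simp

definition "pair_Obj y z = (THE x. x \<in> Obj X \<and> fO P x = y \<and> fO E x = z)"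
definition "pair_Vert v f = (THE w. w \<in> Vert X \<and> fV P w = v \<and> fV E w = f)"
definition "pair_Hor \<psi> R = (THE h. h \<in> Hor X \<and> fH P h = \<psi> \<and> fH E h = R)"
definition "pair_Cell \<nu> t = (THE c. c \<in> Cell X \<and> fC P c = \<nu> \<and> fC E c = t)"

lemma pair_Obj: "\<lbrakk>y \<in> Obj Y; z \<in> Obj Z'; fO D y = fO Q z\<rbrakk> \<Longrightarrow>
    pair_Obj y z \<in> Obj X \<and> fO P (pair_Obj y z) = y \<and> fO E (pair_Obj y z) = z"
  unfolding pair_Obj_def by (rule theI') (rule ex1_Obj)

lemma pair_Vert: "\<lbrakk>v \<in> Vert Y; f \<in> Vert Z'; fV D v = fV Q f\<rbrakk> \<Longrightarrow>
    pair_Vert v f \<in> Vert X \<and> fV P (pair_Vert v f) = v \<and> fV E (pair_Vert v f) = f"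
  unfolding pair_Vert_def by (rule theI') (rule ex1_Vert)

lemma pair_Hor: "\<lbrakk>\<psi> \<in> Hor Y; R \<in> Hor Z'; fH D \<psi> = fH Q R\<rbrakk> \<Longrightarrow>
    pair_Hor \<psi> R \<in> Hor X \<and> fH P (pair_Hor \<psi> R) = \<psi> \<and> fH E (pair_Hor \<psi> R) = R"
  unfolding pair_Hor_def by (rule theI') (rule ex1_Hor)

lemma pair_Cell: "\<lbrakk>\<nu> \<in> Cell Y; t \<in> Cell Z'; fC D \<nu> = fC Q t\<rbrakk> \<Longrightarrow>
    pair_Cell \<nu> t \<in> Cell X \<and> fC P (pair_Cell \<nu> t) = \<nu> \<and> fC E (pair_Cell \<nu> t) = t"
  unfolding pair_Cell_def by (rule theI') (rule ex1_Cell)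

text \<open>
  The two functors \<open>P\<close> and \<open>E\<close> are jointly injective on every level, so \<open>K\<close> has the right boundaries as
  soon as its composites with both have them. The next lemma does the same for identities
  and composites.
\<close>

lemma joint_boundary_preserving:
  assumes "virtual_double_category W"
    and G: "boundary_preserving W Y G" and H: "boundary_preserving W Z' H"
    and K: "\<And>a. a \<in> Obj W \<Longrightarrow> fO K a \<in> Obj X" "\<And>u. u \<in> Vert W \<Longrightarrow> fV K u \<in> Vert X"
      "\<And>h. h \<in> Hor W \<Longrightarrow> fH K h \<in> Hor X" "\<And>t. t \<in> Cell W \<Longrightarrow> fC K t \<in> Cell X"
    and PK: "vdf_eq W (vdf_comp P K) G" and EK: "vdf_eq W (vdf_comp E K) H"
  shows "boundary_preserving W X K"
proof -
  interpret W: virtual_double_category W by fact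
  note simps = K vdf_eq_compD[OF PK] vdf_eq_compD[OF EK] Pb(3,4,6,7,9-12)[symmetric] Eb(3,4,6,7,9-12)[symmetric]
    boundary_preservingD[OF G] boundary_preservingD[OF H]
    W.vdom_in W.vcod_in W.hsrc_in W.htgt_in X.vdom_in X.vcod_in X.hsrc_in X.htgt_in
  have ctop: "ctop X (fC K t) = map (fH K) (ctop W t)" if t: "t \<in> Cell W" for t
  proof (rule joint_Hor_list)
    have sub: "set (ctop W t) \<subseteq> Hor W" using W.cell_boundary[OF t] by (auto dest: hpath_ends)
    show "set (ctop X (fC K t)) \<subseteq> Hor X"
      using X.cell_boundary[OF K(4)[OF t]] by (auto dest: hpath_ends)
    show "set (map (fH K) (ctop W t)) \<subseteq> Hor X" using sub K(3) by auto
    have "map (fH P) (ctop X (fC K t)) = map (fH G) (ctop W t)"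
      by (simp add: simps t)
    also have "\<dots> = map (fH P) (map (fH K) (ctop W t))"
      using sub by (auto simp: simps)
    finally show "map (fH P) (ctop X (fC K t)) = map (fH P) (map (fH K) (ctop W t))" .
    have "map (fH E) (ctop X (fC K t)) = map (fH H) (ctop W t)"
      by (simp add: simps t)
    also have "\<dots> = map (fH E) (map (fH K) (ctop W t))"
      using sub by (auto simp: simps)
    finally show "map (fH E) (ctop X (fC K t)) = map (fH E) (map (fH K) (ctop W t))" .
  qed
  show ?thesis
    unfolding boundary_preserving_def
  proof (intro conjI ballI)
    fix u assume u: "u \<in> Vert W"
    show "vdom X (fV K u) = fO K (vdom W u)" "vcod X (fV K u) = fO K (vcod W u)"
      by (rule joint_Obj; simp add: simps u)+
  next
    fix h assume h: "h \<in> Hor W"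
    show "hsrc X (fH K h) = fO K (hsrc W h)" "htgt X (fH K h) = fO K (htgt W h)"
      by (rule joint_Obj; simp add: simps h)+
  next
    fix t assume t: "t \<in> Cell W"
    note b = W.cell_boundary[OF t] X.cell_boundary[OF K(4)[OF t]]
    show "cbot X (fC K t) = fH K (cbot W t)"
      by (rule joint_Hor) (simp_all add: simps t b)
    show "cleft X (fC K t) = fV K (cleft W t)" "cright X (fC K t) = fV K (cright W t)"
      by (rule joint_Vert; simp add: simps t b)+
  qed (simp_all add: K ctop)
qed

lemma joint_vd_functor:
  assumes W: "virtual_double_category W"
    and G: "vd_functor W Y G" and H: "vd_functor W Z' H"
    and K: "\<And>a. a \<in> Obj W \<Longrightarrow> fO K a \<in> Obj X" "\<And>u. u \<in> Vert W \<Longrightarrow> fV K u \<in> Vert X"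
      "\<And>h. h \<in> Hor W \<Longrightarrow> fH K h \<in> Hor X" "\<And>t. t \<in> Cell W \<Longrightarrow> fC K t \<in> Cell X"
    and PK: "vdf_eq W (vdf_comp P K) G" and EK: "vdf_eq W (vdf_comp E K) H"
  shows "vd_functor W X K"
proof -
  interpret W: virtual_double_category W by fact
  have bK: "boundary_preserving W X K"
    by (rule joint_boundary_preserving[OF W vd_functor_boundary[OF G] vd_functor_boundary[OF H] K PK EK])
  note bKs = boundary_preservingD[OF bK]
  note eqs = vdf_eq_compD[OF PK] vdf_eq_compD[OF EK]
  note comps = vd_functor_composites[OF G] vd_functor_composites[OF H] Pc Ec
  show ?thesis
    unfolding vd_functor_iff
  proof (intro conjI ballI allI impI bK)
    fix a assume a: "a \<in> Obj W"
    show "fV K (vid W a) = vid X (fO K a)"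
      by (rule joint_Vert) (simp_all add: a eqs comps bKs W.vid X.vid)
  next
    fix u v assume uv: "u \<in> Vert W" "v \<in> Vert W" "vcod W u = vdom W v"
    show "fV K (vcomp W v u) = vcomp X (fV K v) (fV K u)"
      by (rule joint_Vert) (simp_all add: uv eqs comps bKs W.vcomp X.vcomp)
  next
    fix h assume h: "h \<in> Hor W"
    show "fC K (cid W h) = cid X (fH K h)"
      by (rule joint_Cell) (simp_all add: h eqs comps bKs W.cid X.cid)
  next
    fix k u ts assume c: "composable W k u ts"
    have in_W: "k \<in> Cell W" "u \<in> Vert W" "set ts \<subseteq> Cell W"
      using c W.cell_path_in by (auto simp: composable_def)
    have cX: "composable X (fC K k) (fV K u) (map (fC K) ts)"
      by (rule boundary_preserving_composable[OF W bK c])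
    show "fC K (ccomp W k u ts) = ccomp X (fC K k) (fV K u) (map (fC K) ts)"
    proof (rule joint_Cell)
      have "map (fC P) (map (fC K) ts) = map (fC G) ts" "map (fC E) (map (fC K) ts) = map (fC H) ts"
        using in_W by (auto simp: eqs)
      then show "fC P (fC K (ccomp W k u ts)) = fC P (ccomp X (fC K k) (fV K u) (map (fC K) ts))"
        "fC E (fC K (ccomp W k u ts)) = fC E (ccomp X (fC K k) (fV K u) (map (fC K) ts))"
        by (simp_all add: W.ccomp[OF c] comps(4,8)[OF c] Pc(4)[OF cX] Ec(4)[OF cX] eqs in_W
            del: map_map)
    qed (simp_all add: W.ccomp[OF c] X.ccomp[OF cX] K)
  qed
qed

lemma functor_universal:
  assumes W: "virtual_double_category W"
    and G: "vd_functor W Y G" and H: "vd_functor W Z' H"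
    and DG: "vdf_eq W (vdf_comp D G) (vdf_comp Q H)"
  shows "\<exists>K. (vd_functor W X K \<and> vdf_eq W (vdf_comp P K) G \<and> vdf_eq W (vdf_comp E K) H) \<and>
    (\<forall>K'. vd_functor W X K' \<and> vdf_eq W (vdf_comp P K') G \<and> vdf_eq W (vdf_comp E K') H \<longrightarrow> vdf_eq W K' K)"
proof -
  define K where "K = \<lparr>fO = \<lambda>a. pair_Obj (fO G a) (fO H a), fV = \<lambda>u. pair_Vert (fV G u) (fV H u),
    fH = \<lambda>h. pair_Hor (fH G h) (fH H h), fC = \<lambda>t. pair_Cell (fC G t) (fC H t)\<rparr>"
  note Gb = boundary_preservingD[OF vd_functor_boundary[OF G]]
  note Hb = boundary_preservingD[OF vd_functor_boundary[OF H]]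
  have eq: "a \<in> Obj W \<Longrightarrow> fO D (fO G a) = fO Q (fO H a)" "u \<in> Vert W \<Longrightarrow> fV D (fV G u) = fV Q (fV H u)"
    "h \<in> Hor W \<Longrightarrow> fH D (fH G h) = fH Q (fH H h)" "t \<in> Cell W \<Longrightarrow> fC D (fC G t) = fC Q (fC H t)"
    for a u h t using DG by (simp_all add: vdf_eq_def vdf_comp_def)
  note pairs = pair_Obj[OF Gb(1) Hb(1) eq(1)] pair_Vert[OF Gb(2) Hb(2) eq(2)]
    pair_Hor[OF Gb(5) Hb(5) eq(3)] pair_Cell[OF Gb(8) Hb(8) eq(4)]
  have PK: "vdf_eq W (vdf_comp P K) G" and EK: "vdf_eq W (vdf_comp E K) H"
    by (simp_all add: vdf_eq_def vdf_comp_def K_def pairs)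
  have K: "vd_functor W X K"
    by (rule joint_vd_functor[OF W G H _ _ _ _ PK EK]) (simp_all add: K_def pairs)
  have "vdf_eq W K' K" if K': "vd_functor W X K'" "vdf_eq W (vdf_comp P K') G" "vdf_eq W (vdf_comp E K') H" for K'
  proof -
    note simps = boundary_preservingD[OF vd_functor_boundary[OF K]]
      boundary_preservingD[OF vd_functor_boundary[OF K'(1)]]
      vdf_eq_compD[OF PK] vdf_eq_compD[OF EK] vdf_eq_compD[OF K'(2)] vdf_eq_compD[OF K'(3)]
    show ?thesis unfolding vdf_eq_def
      by (intro conjI ballI; rule joint_Obj joint_Vert joint_Hor joint_Cell; simp add: simps)
  qed
  with K PK EK show ?thesis by blast
qed

text \<open>
  The components of \<open>\<gamma>\<close> are the elements of \<open>X\<close> over the pairs of components of \<open>\<alpha>\<close> and \<open>\<beta>\<close>; both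
  naturality conditions hold because they hold after applying \<open>P\<close> and \<open>E\<close>.
\<close>

lemma transformation_universal:
  assumes W: "virtual_double_category W"
    and K: "vd_functor W X K" and K': "vd_functor W X K'"
    and \<alpha>: "vertical_transformation W Y (vdf_comp P K) (vdf_comp P K') \<alpha>"
    and \<beta>: "vertical_transformation W Z' (vdf_comp E K) (vdf_comp E K') \<beta>"
    and eq: "vt_eq W (whisker D \<alpha>) (whisker Q \<beta>)"
  shows "\<exists>\<gamma>. (vertical_transformation W X K K' \<gamma> \<and>
             vt_eq W (whisker P \<gamma>) \<alpha> \<and> vt_eq W (whisker E \<gamma>) \<beta>) \<and>
           (\<forall>\<gamma>'. vertical_transformation W X K K' \<gamma>' \<and>
               vt_eq W (whisker P \<gamma>') \<alpha> \<and> vt_eq W (whisker E \<gamma>') \<beta> \<longrightarrow>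
             vt_eq W \<gamma>' \<gamma>)"
proof -
  interpret W: virtual_double_category W by fact
  define \<gamma> where "\<gamma> = \<lparr>tO = \<lambda>a. pair_Vert (tO \<alpha> a) (tO \<beta> a), tH = \<lambda>h. pair_Cell (tH \<alpha> h) (tH \<beta> h)\<rparr>"
  have \<alpha>O: "tO \<alpha> a \<in> Vert Y \<and> vdom Y (tO \<alpha> a) = fO P (fO K a) \<and> vcod Y (tO \<alpha> a) = fO P (fO K' a)"
    and \<beta>O: "tO \<beta> a \<in> Vert Z' \<and> vdom Z' (tO \<beta> a) = fO E (fO K a) \<and> vcod Z' (tO \<beta> a) = fO E (fO K' a)"
    and eqO: "fV D (tO \<alpha> a) = fV Q (tO \<beta> a)" if "a \<in> Obj W" for a
    using \<alpha> \<beta> eq that by (simp_all add: vertical_transformation_def vdf_comp_def vt_eq_def whisker_def)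
  have \<alpha>H: "tH \<alpha> h \<in> Cell Y \<and> ctop Y (tH \<alpha> h) = [fH P (fH K h)] \<and> cbot Y (tH \<alpha> h) = fH P (fH K' h) \<and>
      cleft Y (tH \<alpha> h) = tO \<alpha> (hsrc W h) \<and> cright Y (tH \<alpha> h) = tO \<alpha> (htgt W h)"
    and \<beta>H: "tH \<beta> h \<in> Cell Z' \<and> ctop Z' (tH \<beta> h) = [fH E (fH K h)] \<and> cbot Z' (tH \<beta> h) = fH E (fH K' h) \<and>
      cleft Z' (tH \<beta> h) = tO \<beta> (hsrc W h) \<and> cright Z' (tH \<beta> h) = tO \<beta> (htgt W h)"
    and eqH: "fC D (tH \<alpha> h) = fC Q (tH \<beta> h)" if "h \<in> Hor W" for h
    using \<alpha> \<beta> eq that by (simp_all add: vertical_transformation_def vdf_comp_def vt_eq_def whisker_def)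
  have \<gamma>O: "tO \<gamma> a \<in> Vert X \<and> fV P (tO \<gamma> a) = tO \<alpha> a \<and> fV E (tO \<gamma> a) = tO \<beta> a" if "a \<in> Obj W" for a
    using pair_Vert[of "tO \<alpha> a" "tO \<beta> a"] \<alpha>O \<beta>O eqO that by (simp add: \<gamma>_def)
  have \<gamma>H: "tH \<gamma> h \<in> Cell X \<and> fC P (tH \<gamma> h) = tH \<alpha> h \<and> fC E (tH \<gamma> h) = tH \<beta> h" if "h \<in> Hor W" for h
    using pair_Cell[of "tH \<alpha> h" "tH \<beta> h"] \<alpha>H \<beta>H eqH that by (simp add: \<gamma>_def)
  note Kb = boundary_preservingD[OF vd_functor_boundary[OF K]]
  note Kb' = boundary_preservingD[OF vd_functor_boundary[OF K']]
  note ins = W.vdom_in W.vcod_in W.hsrc_in W.htgt_in X.vdom_in X.vcod_in X.hsrc_in X.htgt_in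
  have bO: "vdom X (tO \<gamma> a) = fO K a \<and> vcod X (tO \<gamma> a) = fO K' a" if a: "a \<in> Obj W" for a
    by (intro conjI; rule joint_Obj; simp add: \<gamma>O \<alpha>O \<beta>O a ins Kb Kb' Pb(3,4,6,7,9-12)[symmetric] Eb(3,4,6,7,9-12)[symmetric])
  have bH: "ctop X (tH \<gamma> h) = [fH K h] \<and> cbot X (tH \<gamma> h) = fH K' h \<and>
      cleft X (tH \<gamma> h) = tO \<gamma> (hsrc W h) \<and> cright X (tH \<gamma> h) = tO \<gamma> (htgt W h)" if h: "h \<in> Hor W" for h
  proof -
    note c = X.cell_boundary[OF conjunct1[OF \<gamma>H[OF h]]]
    have sub: "set (ctop X (tH \<gamma> h)) \<subseteq> Hor X" using c by (auto dest: hpath_ends)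
    note simps = \<gamma>H \<gamma>O \<alpha>O \<beta>O \<alpha>H \<beta>H h ins Kb Kb' c Pb(3,4,6,7,9-12)[symmetric] Eb(3,4,6,7,9-12)[symmetric]
    have "ctop X (tH \<gamma> h) = [fH K h]"
      by (rule joint_Hor_list) (use sub in \<open>simp_all add: simps\<close>)
    moreover have "cbot X (tH \<gamma> h) = fH K' h"
      by (rule joint_Hor) (simp_all add: simps)
    moreover have "cleft X (tH \<gamma> h) = tO \<gamma> (hsrc W h)" "cright X (tH \<gamma> h) = tO \<gamma> (htgt W h)"
      by (rule joint_Vert; simp add: simps)+
    ultimately show ?thesis by simp
  qed
  have path: "cell_path X (tO \<gamma> a) (map (tH \<gamma>) hs)" if "path_in W a hs b" for a hs b
    using that by (induction hs arbitrary: a) (auto simp: \<gamma>O \<gamma>H bH)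
  have nat: "vcomp X (fV K' u) (tO \<gamma> (vdom W u)) = vcomp X (tO \<gamma> (vcod W u)) (fV K u)" if u: "u \<in> Vert W" for u
  proof (rule joint_Vert)
    have "vcomp Y (fV P (fV K' u)) (tO \<alpha> (vdom W u)) = vcomp Y (tO \<alpha> (vcod W u)) (fV P (fV K u))"
      "vcomp Z' (fV E (fV K' u)) (tO \<beta> (vdom W u)) = vcomp Z' (tO \<beta> (vcod W u)) (fV E (fV K u))"
      using \<alpha> \<beta> u by (simp_all add: vertical_transformation_def vdf_comp_def)
    then show "fV P (vcomp X (fV K' u) (tO \<gamma> (vdom W u))) = fV P (vcomp X (tO \<gamma> (vcod W u)) (fV K u))"
      "fV E (vcomp X (fV K' u) (tO \<gamma> (vdom W u))) = fV E (vcomp X (tO \<gamma> (vcod W u)) (fV K u))"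
      by (simp_all add: Pc Ec \<gamma>O bO Kb Kb' u ins)
  qed (simp_all add: X.vcomp \<gamma>O bO Kb Kb' u ins)
  have cnat: "ccomp X (tH \<gamma> (cbot W t)) (fV K (cleft W t)) [fC K t] =
      ccomp X (fC K' t) (tO \<gamma> (vdom W (cleft W t))) (map (tH \<gamma>) (ctop W t))" if t: "t \<in> Cell W" for t
  proof -
    note bt = W.cell_boundary[OF t]
    have sub: "set (ctop W t) \<subseteq> Hor W" using bt by (auto dest: hpath_ends)
    have c1: "composable X (tH \<gamma> (cbot W t)) (fV K (cleft W t)) [fC K t]"
      by (simp add: composable_def \<gamma>H bH bO Kb t bt ins)
    have c2: "composable X (fC K' t) (tO \<gamma> (vdom W (cleft W t))) (map (tH \<gamma>) (ctop W t))"
      using path[of "vdom W (cleft W t)" "ctop W t" "vdom W (cright W t)"] sub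
      by (auto simp: composable_def bH bO Kb' t bt ins)
    have maps: "map (fC P) (map (tH \<gamma>) (ctop W t)) = map (tH \<alpha>) (ctop W t)"
      "map (fC E) (map (tH \<gamma>) (ctop W t)) = map (tH \<beta>) (ctop W t)"
      using sub by (auto simp: \<gamma>H)
    have "ccomp Y (tH \<alpha> (cbot W t)) (fV P (fV K (cleft W t))) [fC P (fC K t)] =
        ccomp Y (fC P (fC K' t)) (tO \<alpha> (vdom W (cleft W t))) (map (tH \<alpha>) (ctop W t))"
      "ccomp Z' (tH \<beta> (cbot W t)) (fV E (fV K (cleft W t))) [fC E (fC K t)] =
        ccomp Z' (fC E (fC K' t)) (tO \<beta> (vdom W (cleft W t))) (map (tH \<beta>) (ctop W t))"
      using \<alpha> \<beta> t by (simp_all add: vertical_transformation_def vdf_comp_def)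
    then show ?thesis
      by (intro joint_Cell)
        (simp_all add: X.ccomp[OF c1] X.ccomp[OF c2] Pc(4)[OF c1] Pc(4)[OF c2] Ec(4)[OF c1] Ec(4)[OF c2]
          maps \<gamma>H \<gamma>O bt ins del: map_map)
  qed
  have "vertical_transformation W X K K' \<gamma>"
    unfolding vertical_transformation_def using \<gamma>O \<gamma>H bO bH nat cnat by blast
  moreover have "vt_eq W (whisker P \<gamma>) \<alpha>" "vt_eq W (whisker E \<gamma>) \<beta>"
    by (simp_all add: vt_eq_def whisker_def \<gamma>O \<gamma>H)
  moreover have "vt_eq W \<gamma>' \<gamma>"
    if "vertical_transformation W X K K' \<gamma>'" "vt_eq W (whisker P \<gamma>') \<alpha>" "vt_eq W (whisker E \<gamma>') \<beta>" for \<gamma>'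
    unfolding vt_eq_def
  proof (intro conjI ballI)
    fix a assume "a \<in> Obj W"
    then show "tO \<gamma>' a = tO \<gamma> a"
      using that by (intro joint_Vert) (simp_all add: \<gamma>O vertical_transformation_def vt_eq_def whisker_def)
  next
    fix h assume "h \<in> Hor W"
    then show "tH \<gamma>' h = tH \<gamma> h"
      using that by (intro joint_Cell) (simp_all add: \<gamma>H vertical_transformation_def vt_eq_def whisker_def)
  qed
  ultimately show ?thesis by blast
qed

lemma VDBL_pullback:
  assumes "large_vdc el X" "large_vdc el Y" "large_vdc el Z'" "large_vdc el Z"
    and "vd_functor Y Z D" "vd_functor Z' Z Q"
  shows "VDBL_pullback el X Y Z' Z P E D Q"
proof -
  have W: "virtual_double_category W" if "large_vdc el W" for W :: "('w, 'w, 'w, 'w) vdc"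
    using that by (simp add: large_vdc_def)
  show ?thesis
    unfolding VDBL_pullback_def
    by (intro conjI allI impI assms P E square; elim conjE;
        rule functor_universal[OF W] transformation_universal[OF W]; assumption)
qed

end

section \<open>Spans of sets with a distinguished subset\<close>

text \<open>
  Every \<open>A\<close> in \<open>Ob\<close> has an underlying set \<open>car A\<close> and a distinguished subset \<open>K A\<close> that all functions
  must respect. With \<open>K A\<close> empty this is the theory of spans of sets; with \<open>K A\<close> the singleton
  of a base point, that of pointed sets. A multicell respects the distinguished subsets if it maps the fibre product
  of those of its top into that of its bottom, which specializes correctly to both.
\<close>

definition struct_arrs :: "('o \<Rightarrow> 'w set) \<Rightarrow> ('o \<Rightarrow> 'w set) \<Rightarrow> 'o set \<Rightarrow> ('o, 'w) arr set" where
  "struct_arrs car K Ob = {f. adom f \<in> Ob \<and> acod f \<in> Ob \<and>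
     afn f \<in> car (adom f) \<rightarrow>\<^sub>E car (acod f) \<and> afn f ` K (adom f) \<subseteq> K (acod f)}"

definition struct_spans :: "('o \<Rightarrow> 'w set) \<Rightarrow> ('o \<Rightarrow> 'w set) \<Rightarrow> 'o set \<Rightarrow> ('o, 'w) span set" where
  "struct_spans car K Ob = {R. ssrc R \<in> Ob \<and> sapex R \<in> Ob \<and> stgt R \<in> Ob \<and>
     sleg R \<in> car (sapex R) \<rightarrow>\<^sub>E car (ssrc R) \<and> sleg R ` K (sapex R) \<subseteq> K (ssrc R) \<and>
     sleg' R \<in> car (sapex R) \<rightarrow>\<^sub>E car (stgt R) \<and> sleg' R ` K (sapex R) \<subseteq> K (stgt R)}"

definition struct_cells :: "('o \<Rightarrow> 'w set) \<Rightarrow> ('o \<Rightarrow> 'w set) \<Rightarrow> 'o set \<Rightarrow> ('o, 'w) mcell set" where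
  "struct_cells car K Ob = {t.
     mleft t \<in> struct_arrs car K Ob \<and> mright t \<in> struct_arrs car K Ob \<and>
     mbot t \<in> struct_spans car K Ob \<and>
     hpath Ob (struct_spans car K Ob) ssrc stgt (adom (mleft t)) (mtop t) (adom (mright t)) \<and>
     ssrc (mbot t) = acod (mleft t) \<and> stgt (mbot t) = acod (mright t) \<and>
     mfn t \<in> fibprod car (adom (mleft t)) (mtop t) \<rightarrow>\<^sub>E car (sapex (mbot t)) \<and>
     mfn t ` fibprod K (adom (mleft t)) (mtop t) \<subseteq> K (sapex (mbot t)) \<and>
     (\<forall>(i, ss) \<in> fibprod car (adom (mleft t)) (mtop t).
        sleg (mbot t) (mfn t (i, ss)) = afn (mleft t) i \<and>
        sleg' (mbot t) (mfn t (i, ss)) = afn (mright t) (tuple_end (mtop t) (i, ss)))}"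

definition struct_span ::
  "('o \<Rightarrow> 'w set) \<Rightarrow> ('o \<Rightarrow> 'w set) \<Rightarrow> 'o set \<Rightarrow>
   ('o, ('o, 'w) arr, ('o, 'w) span, ('o, 'w) mcell) vdc" where
  "struct_span car K Ob = \<lparr>
     Obj = Ob,
     Vert = struct_arrs car K Ob, vdom = adom, vcod = acod, vid = arr_id car, vcomp = arr_comp car,
     Hor = struct_spans car K Ob, hsrc = ssrc, htgt = stgt,
     Cell = struct_cells car K Ob, ctop = mtop, cbot = mbot, cleft = mleft, cright = mright,
     cid = mcell_id car, ccomp = mcell_comp car\<rparr>"

lemma struct_span_simps [simp]:
  "Obj (struct_span car K Ob) = Ob"
  "Vert (struct_span car K Ob) = struct_arrs car K Ob"
  "vdom (struct_span car K Ob) = adom"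
  "vcod (struct_span car K Ob) = acod"
  "vid (struct_span car K Ob) = arr_id car"
  "vcomp (struct_span car K Ob) = arr_comp car"
  "Hor (struct_span car K Ob) = struct_spans car K Ob"
  "hsrc (struct_span car K Ob) = ssrc"
  "htgt (struct_span car K Ob) = stgt"
  "Cell (struct_span car K Ob) = struct_cells car K Ob"
  "ctop (struct_span car K Ob) = mtop"
  "cbot (struct_span car K Ob) = mbot"
  "cleft (struct_span car K Ob) = mleft"
  "cright (struct_span car K Ob) = mright"
  "cid (struct_span car K Ob) = mcell_id car"
  "ccomp (struct_span car K Ob) = mcell_comp car"
  by (simp_all add: struct_span_def)

lemma tuple_end_Nil [simp]: "tuple_end Ss (i, []) = i"
  by (simp add: tuple_end_def)

lemma tuple_end_Cons [simp]:
  "length ss = length Ss \<Longrightarrow> tuple_end (S # Ss) (i, s # ss) = tuple_end Ss (sleg' S s, ss)"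
  by (auto simp: tuple_end_def)

lemma tuple_end_append:
  "length ss = length Ss \<Longrightarrow> length ts = length Ts \<Longrightarrow>
    tuple_end (Ss @ Ts) (i, ss @ ts) = tuple_end Ts (tuple_end Ss (i, ss), ts)"
  by (induction ss Ss arbitrary: i rule: list_induct2) simp_all

lemma matching_length: "matching L i Ss ss \<Longrightarrow> length ss = length Ss"
  by (induction L i Ss ss rule: matching.induct) auto

lemma matching_append:
  "matching L i (Ss @ Ts) ss \<longleftrightarrow> matching L i Ss (take (length Ss) ss) \<and>
     matching L (tuple_end Ss (i, take (length Ss) ss)) Ts (drop (length Ss) ss)"
proof (induction Ss arbitrary: i ss)
  case (Cons S Ss)
  show ?case
  proof (cases ss)
    case (Cons s ss')
    have "matching L (sleg' S s) Ss (take (length Ss) ss') \<Longrightarrow>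
        tuple_end (S # Ss) (i, s # take (length Ss) ss') = tuple_end Ss (sleg' S s, take (length Ss) ss')"
      by (rule tuple_end_Cons) (rule matching_length)
    then show ?thesis using Cons.IH[of "sleg' S s" ss'] Cons by auto
  qed simp
qed simp

lemma apply_mcells_length [simp]: "length (apply_mcells ts (i, ss)) = length ts"
  by (induction ts arbitrary: i ss) (auto simp: Let_def)

lemma apply_mcells_append:
  assumes "length ss = length (concat (map mtop xs))" "length ss' = length (concat (map mtop ys))"
  shows "apply_mcells (xs @ ys) (i, ss @ ss') =
    apply_mcells xs (i, ss) @ apply_mcells ys (tuple_end (concat (map mtop xs)) (i, ss), ss')"
  using assms(1)
proof (induction xs arbitrary: i ss)
  case (Cons x xs)
  let ?n = "length (mtop x)"
  have l: "length (take ?n ss) = ?n" "length (drop ?n ss) = length (concat (map mtop xs))"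
    using Cons.prems by simp_all
  have "tuple_end (mtop x @ concat (map mtop xs)) (i, take ?n ss @ drop ?n ss) =
      tuple_end (concat (map mtop xs)) (tuple_end (mtop x) (i, take ?n ss), drop ?n ss)"
    using l by (rule tuple_end_append)
  with Cons l show ?case by (simp add: Let_def)
qed simp

lemma arr_comp_simps [simp]:
  "adom (arr_comp car g f) = adom f" "acod (arr_comp car g f) = acod g"
  "i \<in> car (adom f) \<Longrightarrow> afn (arr_comp car g f) i = afn g (afn f i)"
  by (simp_all add: arr_comp_def)

lemma arr_id_simps [simp]:
  "adom (arr_id car A) = A" "acod (arr_id car A) = A" "i \<in> car A \<Longrightarrow> afn (arr_id car A) i = i"
  by (simp_all add: arr_id_def)

lemma mcell_comp_simps [simp]:
  "mleft (mcell_comp car k u ts) = arr_comp car (mleft k) u"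
  "mtop (mcell_comp car k u ts) = concat (map mtop ts)"
  "mbot (mcell_comp car k u ts) = mbot k"
  "p \<in> fibprod car (adom u) (concat (map mtop ts)) \<Longrightarrow>
    mfn (mcell_comp car k u ts) p = mfn k (afn u (fst p), apply_mcells ts p)"
  by (auto simp: mcell_comp_def split: prod.splits)

text \<open>
  The right boundary does not depend on \<open>K\<close> and \<open>Ob\<close>, which occur only on the right-hand side and
  must be instantiated when rewriting.
\<close>

lemma mright_mcell_comp:
  "mright (mcell_comp car k u ts) = arr_comp car (mright k) (path_right (struct_span car K Ob) u ts)"
  by (simp add: mcell_comp_def path_right_def)

lemma mcell_id_simps [simp]:
  "mleft (mcell_id car S) = arr_id car (ssrc S)" "mright (mcell_id car S) = arr_id car (stgt S)"
  "mtop (mcell_id car S) = [S]" "mbot (mcell_id car S) = S"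
  "p \<in> fibprod car (ssrc S) [S] \<Longrightarrow> mfn (mcell_id car S) p = hd (snd p)"
  by (auto simp: mcell_id_def split: prod.splits)

lemma fibprod_iff [simp]: "(i, ss) \<in> fibprod L a Ss \<longleftrightarrow> i \<in> L a \<and> matching L i Ss ss"
  by (simp add: fibprod_def)

locale structured_sets =
  fixes car K :: "'o \<Rightarrow> 'w set" and Ob :: "'o set"
  assumes K_sub: "A \<in> Ob \<Longrightarrow> K A \<subseteq> car A"
begin

abbreviation "SS \<equiv> struct_span car K Ob"
abbreviation "spath \<equiv> hpath Ob (struct_spans car K Ob) ssrc stgt"

sublocale vdc_boundaries SS
  by unfold_locales (auto simp: struct_arrs_def struct_cells_def)

lemma matching_mono: "spath a Ss b \<Longrightarrow> matching K i Ss ss \<Longrightarrow> matching car i Ss ss"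
proof (induction Ss arbitrary: a i ss)
  case (Cons S Ss)
  then have "K (sapex S) \<subseteq> car (sapex S)" by (intro K_sub) (simp add: struct_spans_def)
  with Cons show ?case by (cases ss) auto
next
  case Nil
  then show ?case by (cases ss) auto
qed

lemma K_car: "a \<in> Ob \<Longrightarrow> i \<in> K a \<Longrightarrow> i \<in> car a"
  using K_sub by blast

lemma tuple_end_in:
  assumes "spath a Ss b" "i \<in> L a" "matching L i Ss ss" and L: "L = car \<or> L = K"
  shows "tuple_end Ss (i, ss) \<in> L b"
  using assms(1-3)
proof (induction Ss arbitrary: a i ss)
  case Nil
  then show ?case by (cases ss) auto
next
  case (Cons S Ss)
  then obtain s ss' where ss: "ss = s # ss'" by (cases ss) auto
  with Cons.prems L have "sleg' S s \<in> L (stgt S)" by (auto simp: struct_spans_def)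
  moreover have "length ss' = length Ss" using Cons.prems(3) ss by (auto dest: matching_length)
  ultimately show ?case using Cons ss by auto
qed

lemma arr_apply: "f \<in> struct_arrs car K Ob \<Longrightarrow> i \<in> L (adom f) \<Longrightarrow> L = car \<or> L = K \<Longrightarrow> afn f i \<in> L (acod f)"
  by (auto simp: struct_arrs_def)

lemma cell_apply:
  assumes t: "t \<in> struct_cells car K Ob" and L: "L = car \<or> L = K"
    and i: "i \<in> L (adom (mleft t))" "matching L i (mtop t) ss"
  shows "mfn t (i, ss) \<in> L (sapex (mbot t))"
    and "sleg (mbot t) (mfn t (i, ss)) = afn (mleft t) i"
    and "sleg' (mbot t) (mfn t (i, ss)) = afn (mright t) (tuple_end (mtop t) (i, ss))"
proof -
  have p: "spath (adom (mleft t)) (mtop t) (adom (mright t))"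
    using t by (simp add: struct_cells_def)
  have L': "(i, ss) \<in> fibprod L (adom (mleft t)) (mtop t)" using i by simp
  have car: "(i, ss) \<in> fibprod car (adom (mleft t)) (mtop t)"
    using i L matching_mono[OF p] K_car hpath_ends[OF p] by auto
  have "mfn t \<in> fibprod car (adom (mleft t)) (mtop t) \<rightarrow>\<^sub>E car (sapex (mbot t))"
    and "mfn t ` fibprod K (adom (mleft t)) (mtop t) \<subseteq> K (sapex (mbot t))"
    using t by (simp_all add: struct_cells_def)
  then show "mfn t (i, ss) \<in> L (sapex (mbot t))"
    using L L' by (auto dest: PiE_mem)
  have "\<forall>(i, ss) \<in> fibprod car (adom (mleft t)) (mtop t).
        sleg (mbot t) (mfn t (i, ss)) = afn (mleft t) i \<and>
        sleg' (mbot t) (mfn t (i, ss)) = afn (mright t) (tuple_end (mtop t) (i, ss))"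
    using t by (simp add: struct_cells_def)
  with car show "sleg (mbot t) (mfn t (i, ss)) = afn (mleft t) i"
    "sleg' (mbot t) (mfn t (i, ss)) = afn (mright t) (tuple_end (mtop t) (i, ss))" by blast+
qed

text \<open>
  A row of multicells maps tuples over its top to tuples over its bottom, and the end of a
  tuple along its right boundary. The parameter \<open>L\<close> makes this one induction serve both for
  the functions being well defined (\<open>L = car\<close>) and for their respecting distinguished subsets
  (\<open>L = K\<close>).
\<close>

lemma apply_mcells_matching:
  assumes "cell_path SS u ts" "i \<in> L (adom u)" "matching L i (concat (map mtop ts)) ss"
    and L: "L = car \<or> L = K"
  shows "matching L (afn u i) (map mbot ts) (apply_mcells ts (i, ss)) \<and>
    tuple_end (map mbot ts) (afn u i, apply_mcells ts (i, ss)) =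
      afn (path_right SS u ts) (tuple_end (concat (map mtop ts)) (i, ss))"
  using assms(1-3)
proof (induction ts arbitrary: u i ss)
  case Nil
  then show ?case by (cases ss) auto
next
  case (Cons t ts)
  let ?n = "length (mtop t)"
  let ?j = "tuple_end (mtop t) (i, take ?n ss)"
  have t: "t \<in> struct_cells car K Ob" and u: "u = mleft t" and ts: "cell_path SS (mright t) ts"
    using Cons.prems by auto
  have p: "spath (adom (mleft t)) (mtop t) (adom (mright t))"
    using t by (simp add: struct_cells_def)
  have m1: "matching L i (mtop t) (take ?n ss)"
    and m2: "matching L ?j (concat (map mtop ts)) (drop ?n ss)"
    using Cons.prems(3) by (simp_all add: matching_append)
  have i: "i \<in> L (adom (mleft t))" using Cons.prems(2) u by simp
  note a = cell_apply[OF t L i m1]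
  have j: "?j \<in> L (adom (mright t))" by (rule tuple_end_in[OF p i m1 L])
  note IH = Cons.IH[OF ts j m2]
  have "tuple_end (mtop t @ concat (map mtop ts)) (i, take ?n ss @ drop ?n ss) =
      tuple_end (concat (map mtop ts)) (?j, drop ?n ss)"
    by (rule tuple_end_append[OF matching_length[OF m1] matching_length[OF m2]])
  then show ?case using a IH u by (simp add: Let_def)
qed

lemma arr_comp_in:
  "f \<in> struct_arrs car K Ob \<Longrightarrow> g \<in> struct_arrs car K Ob \<Longrightarrow> acod f = adom g \<Longrightarrow>
    arr_comp car g f \<in> struct_arrs car K Ob"
  using K_sub by (fastforce simp: struct_arrs_def arr_comp_def)

lemma arr_id_in: "A \<in> Ob \<Longrightarrow> arr_id car A \<in> struct_arrs car K Ob"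
  using K_sub by (auto simp: struct_arrs_def arr_id_def)

lemma arr_eqI:
  assumes "f \<in> struct_arrs car K Ob" "g \<in> struct_arrs car K Ob" "adom f = adom g" "acod f = acod g"
    "\<And>x. x \<in> car (adom g) \<Longrightarrow> afn f x = afn g x"
  shows "f = g"
proof (rule arr.expand, intro conjI)
  show "afn f = afn g"
    by (rule PiE_ext[where k = "car (adom g)" and s = "\<lambda>_. car (acod g)"])
      (use assms in \<open>auto simp: struct_arrs_def\<close>)
qed (use assms in auto)

lemma arr_comp_assoc:
  assumes "u \<in> struct_arrs car K Ob" "v \<in> struct_arrs car K Ob" "w \<in> struct_arrs car K Ob"
    "acod u = adom v" "acod v = adom w"
  shows "arr_comp car w (arr_comp car v u) = arr_comp car (arr_comp car w v) u"
  using assms arr_apply[of u _ car] by (intro arr_eqI) (simp_all add: arr_comp_in)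

lemma arr_comp_id_right: "f \<in> struct_arrs car K Ob \<Longrightarrow> arr_comp car f (arr_id car (adom f)) = f"
  using vdom_in[of f] by (intro arr_eqI) (simp_all add: arr_comp_in arr_id_in)

lemma arr_comp_id_left: "f \<in> struct_arrs car K Ob \<Longrightarrow> arr_comp car (arr_id car (acod f)) f = f"
  using vcod_in[of f] arr_apply[of f _ car]
  by (intro arr_eqI) (simp_all add: arr_comp_in arr_id_in)

lemma cell_eqI:
  assumes "s \<in> struct_cells car K Ob" "t \<in> struct_cells car K Ob"
    and "mleft s = mleft t" "mright s = mright t" "mtop s = mtop t" "mbot s = mbot t"
    and "\<And>i ss. i \<in> car (adom (mleft t)) \<Longrightarrow> matching car i (mtop t) ss \<Longrightarrow> mfn s (i, ss) = mfn t (i, ss)"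
  shows "s = t"
proof (rule mcell.expand, intro conjI)
  show "mfn s = mfn t"
  proof (rule PiE_ext)
    show "mfn s \<in> fibprod car (adom (mleft t)) (mtop t) \<rightarrow>\<^sub>E car (sapex (mbot t))"
      "mfn t \<in> fibprod car (adom (mleft t)) (mtop t) \<rightarrow>\<^sub>E car (sapex (mbot t))"
      using assms(1-6) by (simp_all add: struct_cells_def)
  qed (auto simp: assms(7))
qed (use assms in auto)

lemma mcell_id_in:
  assumes S: "S \<in> struct_spans car K Ob"
  shows "mcell_id car S \<in> struct_cells car K Ob"
proof -
  have m: "matching L i [S] ss \<longleftrightarrow> (\<exists>s. ss = [s] \<and> s \<in> L (sapex S) \<and> sleg S s = i)" for L i ss
    by (cases ss; cases "tl ss") auto
  have obj: "ssrc S \<in> Ob" "sapex S \<in> Ob" "stgt S \<in> Ob" using S by (auto simp: struct_spans_def)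
  have leg: "s \<in> car (sapex S) \<Longrightarrow> sleg S s \<in> car (ssrc S) \<and> sleg' S s \<in> car (stgt S)" for s
    using S by (auto simp: struct_spans_def)
  have *: "mfn (mcell_id car S) \<in> fibprod car (ssrc S) [S] \<rightarrow>\<^sub>E car (sapex S)"
    by (rule PiE_I) (auto simp: mcell_id_def m)
  show ?thesis
    using S obj K_sub[OF obj(1)] K_sub[OF obj(2)] leg *
    by (auto simp: struct_cells_def arr_id_in m subset_iff)
qed

lemma mcell_comp_in:
  assumes c: "composable SS k u ts"
  shows "mcell_comp car k u ts \<in> struct_cells car K Ob"
proof -
  let ?t = "mcell_comp car k u ts" and ?Ss = "concat (map mtop ts)" and ?v = "path_right SS u ts"
  have k: "k \<in> struct_cells car K Ob" and ts: "cell_path SS u ts" and top: "mtop k = map mbot ts"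
    and u: "acod u = adom (mleft k)" using c by (auto simp: composable_def)
  have uv: "u \<in> struct_arrs car K Ob" "?v \<in> struct_arrs car K Ob"
    using cell_path_in[OF ts] by auto
  have v: "acod ?v = adom (mright k)" using composable_right[OF c] by simp
  have k': "mleft k \<in> struct_arrs car K Ob" "mright k \<in> struct_arrs car K Ob"
    "mbot k \<in> struct_spans car K Ob" "ssrc (mbot k) = acod (mleft k)" "stgt (mbot k) = acod (mright k)"
    using k by (simp_all add: struct_cells_def)
  have p: "spath (adom u) ?Ss (adom ?v)" using cell_path_top[OF ts] by simp
  have key: "mfn ?t (i, ss) \<in> L (sapex (mbot k)) \<and> sleg (mbot k) (mfn ?t (i, ss)) = afn (mleft ?t) i \<and>
      sleg' (mbot k) (mfn ?t (i, ss)) = afn (mright ?t) (tuple_end ?Ss (i, ss))"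
    if i: "i \<in> L (adom u)" "matching L i ?Ss ss" and L: "L = car \<or> L = K" for L i ss
  proof -
    have car: "i \<in> car (adom u)" "matching car i ?Ss ss"
      using i L matching_mono[OF p] K_car hpath_ends[OF p] by auto
    have e: "tuple_end ?Ss (i, ss) \<in> car (adom ?v)" by (rule tuple_end_in[OF p car]) simp
    note m = apply_mcells_matching[OF ts i L]
    have ui: "afn u i \<in> L (adom (mleft k))" using arr_apply[OF uv(1), of i L] i(1) L u by simp
    note a = cell_apply[OF k L ui, unfolded top, OF conjunct1[OF m]]
    show ?thesis using a m car e by (simp add: mright_mcell_comp[where K = K and Ob = Ob])
  qed
  have "mfn ?t \<in> fibprod car (adom u) ?Ss \<rightarrow>\<^sub>E car (sapex (mbot k))"
  proof (rule PiE_I)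
    fix p assume "p \<in> fibprod car (adom u) ?Ss"
    then show "mfn ?t p \<in> car (sapex (mbot k))" using key[of _ car] by (cases p) auto
  next
    fix p assume "p \<notin> fibprod car (adom u) ?Ss"
    then show "mfn ?t p = undefined" by (simp add: mcell_comp_def)
  qed
  moreover have "mfn ?t ` fibprod K (adom u) ?Ss \<subseteq> K (sapex (mbot k))"
    using key[of _ K] by auto
  moreover have "\<forall>(i, ss) \<in> fibprod car (adom u) ?Ss. sleg (mbot k) (mfn ?t (i, ss)) = afn (mleft ?t) i \<and>
      sleg' (mbot k) (mfn ?t (i, ss)) = afn (mright ?t) (tuple_end ?Ss (i, ss))"
    using key[of _ car] by auto
  ultimately show ?thesis
    using p k' uv u v unfolding struct_cells_def
    by (simp add: arr_comp_in mright_mcell_comp[where K = K and Ob = Ob])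
qed

lemma apply_mcell_ids:
  "spath a Ss b \<Longrightarrow> i \<in> car a \<Longrightarrow> matching car i Ss ss \<Longrightarrow> apply_mcells (map (mcell_id car) Ss) (i, ss) = ss"
proof (induction Ss arbitrary: a i ss)
  case Nil
  then show ?case by (cases ss) auto
next
  case (Cons S Ss)
  then obtain s ss' where ss: "ss = s # ss'" by (cases ss) auto
  with Cons.prems have "sleg' S s \<in> car (stgt S)" by (auto simp: struct_spans_def)
  with Cons ss show ?case by (auto simp: Let_def)
qed

lemma row_comps_top:
  "map (map mbot) xss = map mtop ts \<Longrightarrow>
    concat (map mtop (row_comps SS w ts xss)) = concat (map mtop (concat xss)) \<and>
    path_right SS (arr_comp car u w) (row_comps SS w ts xss) =
      arr_comp car (path_right SS u ts) (path_right SS w (concat xss))"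
proof (induction ts arbitrary: xss u w)
  case (Cons t ts)
  then obtain xs xss' where xss: "xss = xs # xss'" by (cases xss) auto
  have "path_right SS w (xs @ ys) = path_right SS (path_right SS w xs) ys" for ys
    by (induction xs arbitrary: w) auto
  then show ?case
    using Cons.IH[of xss' "path_right SS w xs" "mright t"] Cons.prems xss
    by (simp add: mright_mcell_comp[where K = K and Ob = Ob])
qed simp

text \<open>
  Associativity of composition on the level of functions: composing two rows block by block and
  then evaluating is the same as evaluating first the upper and then the lower row.
\<close>

lemma apply_row_comps:
  assumes "cell_path SS w (concat xss)" "map (map mbot) xss = map mtop ts" "i \<in> car (adom w)"
    "matching car i (concat (map mtop (concat xss))) ss"
  shows "apply_mcells (row_comps SS w ts xss) (i, ss) =
    apply_mcells ts (afn w i, apply_mcells (concat xss) (i, ss))"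
  using assms
proof (induction ts arbitrary: w xss i ss)
  case (Cons t ts)
  then obtain xs xss' where xss: "xss = xs # xss'" by (cases xss) auto
  let ?S1 = "concat (map mtop xs)" and ?S2 = "concat (map mtop (concat xss'))"
  let ?ss1 = "take (length ?S1) ss" and ?ss2 = "drop (length ?S1) ss"
  let ?j = "tuple_end ?S1 (i, ?ss1)"
  have xs: "cell_path SS w xs" and xss': "cell_path SS (path_right SS w xs) (concat xss')"
    using Cons.prems(1) xss by (auto simp: cell_path_append)
  have bot: "mtop t = map mbot xs" and bots: "map (map mbot) xss' = map mtop ts"
    using Cons.prems(2) xss by auto
  have m1: "matching car i ?S1 ?ss1" and m2: "matching car ?j ?S2 ?ss2"
    using Cons.prems(4) xss by (simp_all add: matching_append)
  have p: "spath (adom w) ?S1 (adom (path_right SS w xs))" using cell_path_top[OF xs] by simp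
  have j: "?j \<in> car (adom (path_right SS w xs))"
    by (rule tuple_end_in[OF p Cons.prems(3) m1]) simp
  note IH = Cons.IH[OF xss' bots j m2]
  note A1 = apply_mcells_matching[OF xs Cons.prems(3) m1]
  have "apply_mcells (xs @ concat xss') (i, ?ss1 @ ?ss2) =
      apply_mcells xs (i, ?ss1) @ apply_mcells (concat xss') (?j, ?ss2)"
    by (rule apply_mcells_append[OF matching_length[OF m1] matching_length[OF m2]])
  then have split: "apply_mcells (xs @ concat xss') (i, ss) =
      apply_mcells xs (i, ?ss1) @ apply_mcells (concat xss') (?j, ?ss2)"
    by simp
  have head: "mfn (mcell_comp car t w xs) (i, ?ss1) = mfn t (afn w i, apply_mcells xs (i, ?ss1))"
    using m1 Cons.prems(3) by simp
  show ?case
    using IH A1 head bot by (simp add: xss split Let_def)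
qed simp

lemma virtual_double_category: "virtual_double_category SS"
proof
  fix k u ts w xss
  assume c: "composable SS k u ts" and c': "composable SS (ccomp SS k u ts) w (concat xss)"
    and xss: "map (map (cbot SS)) xss = map (ctop SS) ts"
  have k: "k \<in> struct_cells car K Ob" and ts: "cell_path SS u ts" and top: "mtop k = map mbot ts"
    and u: "acod u = adom (mleft k)" using c by (auto simp: composable_def)
  have w: "cell_path SS w (concat xss)" "map mbot (concat xss) = concat (map mtop ts)" "acod w = adom u"
    using c' by (auto simp: composable_def)
  have xss': "map (map mbot) xss = map mtop ts" using xss by simp
  have in_arrs: "u \<in> struct_arrs car K Ob" "path_right SS u ts \<in> struct_arrs car K Ob"
    "w \<in> struct_arrs car K Ob" "path_right SS w (concat xss) \<in> struct_arrs car K Ob"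
    "mleft k \<in> struct_arrs car K Ob" "mright k \<in> struct_arrs car K Ob"
    using cell_path_in[OF ts] cell_path_in[OF w(1)] k by (auto simp: struct_cells_def)
  have v: "acod (path_right SS u ts) = adom (mright k)"
    "acod (path_right SS w (concat xss)) = adom (path_right SS u ts)"
    using composable_right[OF c] composable_right[OF c']
    by (simp_all add: mright_mcell_comp[where K = K and Ob = Ob])
  let ?r = "row_comps SS w ts xss"
  note rt = row_comps_top[OF xss', of w u]
  have "mcell_comp car k (arr_comp car u w) ?r = mcell_comp car (mcell_comp car k u ts) w (concat xss)"
  proof (rule mcell.expand, intro conjI)
    let ?l = "mcell_comp car k (arr_comp car u w) ?r"
    let ?R = "mcell_comp car (mcell_comp car k u ts) w (concat xss)"
    show "mleft ?l = mleft ?R" using in_arrs w u by (simp add: arr_comp_assoc)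
    show "mright ?l = mright ?R"
      using in_arrs v rt by (simp add: mright_mcell_comp[where K = K and Ob = Ob] arr_comp_assoc)
    show "mtop ?l = mtop ?R" "mbot ?l = mbot ?R" using rt by simp_all
    show "mfn ?l = mfn ?R"
    proof
      fix p
      show "mfn ?l p = mfn ?R p"
      proof (cases "p \<in> fibprod car (adom w) (concat (map mtop (concat xss)))")
        case True
        obtain i ss where p: "p = (i, ss)" by fastforce
        have i: "i \<in> car (adom w)" "matching car i (concat (map mtop (concat xss))) ss"
          using True p by simp_all
        have "matching car (afn w i) (concat (map mtop ts)) (apply_mcells (concat xss) (i, ss))"
          using apply_mcells_matching[OF w(1) i] unfolding w(2) by simp
        moreover have "afn w i \<in> car (adom u)" using arr_apply[OF in_arrs(3), of i car] i(1) w(3) by simp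
        ultimately show ?thesis using True p i rt apply_row_comps[OF w(1) xss' i] by simp
      qed (use rt in \<open>simp add: mcell_comp_def\<close>)
    qed
  qed
  then show "ccomp SS k (vcomp SS u w) (row_comps SS w ts xss) = ccomp SS (ccomp SS k u ts) w (concat xss)"
    by simp
next
  fix t assume "t \<in> Cell SS"
  then have t: "t \<in> struct_cells car K Ob" by simp
  then have b: "mleft t \<in> struct_arrs car K Ob" "mright t \<in> struct_arrs car K Ob"
    "mbot t \<in> struct_spans car K Ob" "spath (adom (mleft t)) (mtop t) (adom (mright t))"
    "ssrc (mbot t) = acod (mleft t)" "stgt (mbot t) = acod (mright t)"
    by (simp_all add: struct_cells_def)
  have bO: "adom (mleft t) \<in> Ob" "adom (mright t) \<in> Ob"
    using b(1,2) by (auto simp: struct_arrs_def)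
  have ids: "cell_path SS (arr_id car a) (map (mcell_id car) Ss) \<and>
      path_right SS (arr_id car a) (map (mcell_id car) Ss) = arr_id car b" if "spath a Ss b" for a Ss b
    using that by (induction Ss arbitrary: a) (auto simp: arr_id_in mcell_id_in)
  have cc: "map mtop (map (mcell_id car) Ss) = map (\<lambda>S. [S]) Ss" "concat (map (\<lambda>S. [S]) Ss) = Ss" for Ss
    by (induction Ss) auto
  have "composable SS t (arr_id car (adom (mleft t))) (map (mcell_id car) (mtop t))"
    using ids[OF b(4)] t by (simp add: composable_def comp_def)
  then have "mcell_comp car t (arr_id car (adom (mleft t))) (map (mcell_id car) (mtop t)) \<in> struct_cells car K Ob"
    by (rule mcell_comp_in)
  then have "mcell_comp car t (arr_id car (adom (mleft t))) (map (mcell_id car) (mtop t)) = t"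
    using t ids[OF b(4)] b apply_mcell_ids[OF b(4)]
    by (intro cell_eqI) (simp_all add: mright_mcell_comp[where K = K and Ob = Ob] arr_comp_id_right cc del: map_map)
  then show "ccomp SS t (vid SS (vdom SS (cleft SS t))) (map (cid SS) (ctop SS t)) = t" by simp
  have "composable SS (mcell_id car (mbot t)) (mleft t) [t]"
    using b t by (simp add: composable_def mcell_id_in)
  then have "mcell_comp car (mcell_id car (mbot t)) (mleft t) [t] \<in> struct_cells car K Ob"
    by (rule mcell_comp_in)
  then have "mcell_comp car (mcell_id car (mbot t)) (mleft t) [t] = t"
    using t b cell_apply[OF t, of car] arr_apply[OF b(1), of _ car]
    by (intro cell_eqI)
      (simp_all add: mright_mcell_comp[where K = K and Ob = Ob] arr_comp_id_left Let_def matching_length)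
  then show "ccomp SS (cid SS (cbot SS t)) (cleft SS t) [t] = t" by simp
next
  fix u v w assume "u \<in> Vert SS" "v \<in> Vert SS" "w \<in> Vert SS" "vcod SS u = vdom SS v" "vcod SS v = vdom SS w"
  then show "vcomp SS w (vcomp SS v u) = vcomp SS (vcomp SS w v) u" by (simp add: arr_comp_assoc)
next
  fix k u ts assume c: "composable SS k u ts"
  then show "ccomp SS k u ts \<in> Cell SS \<and>
       ctop SS (ccomp SS k u ts) = concat (map (ctop SS) ts) \<and>
       cbot SS (ccomp SS k u ts) = cbot SS k \<and>
       cleft SS (ccomp SS k u ts) = vcomp SS (cleft SS k) u \<and>
       cright SS (ccomp SS k u ts) = vcomp SS (cright SS k) (path_right SS u ts)"
    by (simp add: mcell_comp_in mright_mcell_comp[where K = K and Ob = Ob])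
next
  fix f assume f: "f \<in> Vert SS"
  then show "vcomp SS f (vid SS (vdom SS f)) = f" "vcomp SS (vid SS (vcod SS f)) f = f"
    by (simp_all add: arr_comp_id_right arr_comp_id_left)
next
  fix h assume "h \<in> Hor SS"
  then show "hsrc SS h \<in> Obj SS" "htgt SS h \<in> Obj SS" by (simp_all add: struct_spans_def)
qed (use vdom_in vcod_in cell_boundary in \<open>simp_all add: arr_id_in arr_comp_in mcell_id_in\<close>)

text \<open>
  An arrow is determined by its boundary and its graph, a span by its two legs regarded as arrows out of the
  apex, and a multicell by its boundary and the graph of its function on tuples.
\<close>

lemma large_vdc:
  assumes univ: "universe_pair el u1" and Ob: "large_size el Ob"
    and U: "large_size el U" "\<And>A. A \<in> Ob \<Longrightarrow> car A \<subseteq> U"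
  shows "large_vdc el SS"
proof -
  note Times = large_size_Times[OF univ]
  have arrs: "large_size el (struct_arrs car K Ob)"
  proof (rule large_size_PiE[OF univ Times[OF Ob Ob] U(1) U(1),
        where k = "\<lambda>f. (adom f, acod f)" and f = afn and D = "\<lambda>x. car (fst x)" and C = "\<lambda>x. car (snd x)"])
    show "inj_on (\<lambda>f. ((adom f, acod f), afn f)) (struct_arrs car K Ob)"
      by (intro inj_onI arr.expand) auto
  qed (use U(2) in \<open>auto simp: struct_arrs_def\<close>)
  have spans: "large_size el (struct_spans car K Ob)"
  proof (rule large_size_inj_on[OF Times[OF arrs arrs]])
    let ?g = "\<lambda>R. (Arr (sapex R) (ssrc R) (sleg R), Arr (sapex R) (stgt R) (sleg' R))"
    show "inj_on ?g (struct_spans car K Ob)" by (intro inj_onI span.expand) auto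
    show "?g ` struct_spans car K Ob \<subseteq> struct_arrs car K Ob \<times> struct_arrs car K Ob"
      by (auto simp: struct_spans_def struct_arrs_def image_subset_iff)
  qed
  have lists: "large_size el (lists (struct_spans car K Ob))" by (rule large_size_lists[OF univ spans])
  have cells: "large_size el (struct_cells car K Ob)"
  proof (rule large_size_PiE[OF univ Times[OF arrs Times[OF arrs Times[OF lists spans]]]
        Times[OF U(1) large_size_lists[OF univ U(1)]] U(1),
        where k = "\<lambda>t. (mleft t, mright t, mtop t, mbot t)" and f = mfn
          and D = "\<lambda>(l, r, Ss, S). fibprod car (adom l) Ss" and C = "\<lambda>(l, r, Ss, S). car (sapex S)"])
    show "inj_on (\<lambda>t. ((mleft t, mright t, mtop t, mbot t), mfn t)) (struct_cells car K Ob)"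
      by (intro inj_onI mcell.expand) auto
    show "(\<lambda>t. (mleft t, mright t, mtop t, mbot t)) ` struct_cells car K Ob \<subseteq>
        struct_arrs car K Ob \<times> struct_arrs car K Ob \<times> lists (struct_spans car K Ob) \<times> struct_spans car K Ob"
      by (auto simp: struct_cells_def dest: hpath_ends)
    have sub: "matching car i Ss ss \<Longrightarrow> set Ss \<subseteq> struct_spans car K Ob \<Longrightarrow> set ss \<subseteq> U" for i Ss ss
    proof (induction Ss arbitrary: i ss)
      case (Cons S Ss)
      then show ?case using U(2)[of "sapex S"] by (cases ss) (auto simp: struct_spans_def)
    next
      case Nil then show ?case by (cases ss) auto
    qed
    fix t assume t: "t \<in> struct_cells car K Ob"
    then show "mfn t \<in> (case (mleft t, mright t, mtop t, mbot t) of (l, r, Ss, S) \<Rightarrow> fibprod car (adom l) Ss) \<rightarrow>\<^sub>E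
        (case (mleft t, mright t, mtop t, mbot t) of (l, r, Ss, S) \<Rightarrow> car (sapex S))"
      by (simp add: struct_cells_def)
    have "spath (adom (mleft t)) (mtop t) (adom (mright t))" "sapex (mbot t) \<in> Ob"
      using t by (simp_all add: struct_cells_def struct_spans_def)
    then show "(case (mleft t, mright t, mtop t, mbot t) of (l, r, Ss, S) \<Rightarrow> fibprod car (adom l) Ss) \<subseteq> U \<times> lists U \<and>
        (case (mleft t, mright t, mtop t, mbot t) of (l, r, Ss, S) \<Rightarrow> car (sapex S)) \<subseteq> U"
      using U(2) sub by (fastforce dest: hpath_ends)
  qed
  show ?thesis
    unfolding large_vdc_def
    by (simp add: virtual_double_category large_size_imp_up_to_bij[OF univ] Ob arrs spans cells)
qed

end

section \<open>Spans of sets and of pointed sets\<close>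

lemma map_arr_sel [simp]:
  "adom (map_arr g f) = g (adom f)" "acod (map_arr g f) = g (acod f)" "afn (map_arr g f) = afn f"
  by (simp_all add: arr.map_sel)

lemma map_span_sel [simp]:
  "ssrc (map_span g R) = g (ssrc R)" "sapex (map_span g R) = g (sapex R)" "stgt (map_span g R) = g (stgt R)"
  "sleg (map_span g R) = sleg R" "sleg' (map_span g R) = sleg' R"
  by (simp_all add: span.map_sel)

lemma map_mcell_sel [simp]:
  "mleft (map_mcell g t) = map_arr g (mleft t)" "mright (map_mcell g t) = map_arr g (mright t)"
  "mtop (map_mcell g t) = map (map_span g) (mtop t)" "mbot (map_mcell g t) = map_span g (mbot t)"
  "mfn (map_mcell g t) = mfn t"
  by (simp_all add: mcell.map_sel)

lemma matching_map_span: "matching L i (map (map_span g) Ss) ss = matching (L \<circ> g) i Ss ss"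
  by (induction "L \<circ> g" i Ss ss rule: matching.induct) simp_all

lemma fibprod_map_span: "fibprod L (g a) (map (map_span g) Ss) = fibprod (L \<circ> g) a Ss"
  by (simp add: fibprod_def matching_map_span)

text \<open>
  If \<open>Ss\<close> is empty and \<open>ss\<close> is not, both sides refer to the unspecified last element of the empty list.
\<close>

lemma tuple_end_map_span [simp]:
  "length ss \<le> length Ss \<Longrightarrow> tuple_end (map (map_span g) Ss) (i, ss) = tuple_end Ss (i, ss)"
  by (cases "Ss = []") (auto simp: tuple_end_def last_map)

lemma apply_mcells_map [simp]: "apply_mcells (map (map_mcell g) ts) (i, ss) = apply_mcells ts (i, ss)"
  by (induction ts arbitrary: i ss) (simp_all add: Let_def)

lemma SPAN_struct: "SPAN S = struct_span id (\<lambda>_. {}) S"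
proof -
  have "fibprod (\<lambda>_. {}) a Ss = {}" for a :: "'a set" and Ss :: "('a set, 'a) span list"
    by (simp add: fibprod_def)
  moreover have "Set_arrs S = struct_arrs id (\<lambda>_. {}) S" "Set_spans S = struct_spans id (\<lambda>_. {}) S"
    by (auto simp: Set_arrs_def struct_arrs_def Set_spans_def struct_spans_def)
  ultimately have "Set_mcells S = struct_cells id (\<lambda>_. {}) S"
    by (simp add: Set_mcells_def struct_cells_def)
  with \<open>Set_arrs S = _\<close> \<open>Set_spans S = _\<close> show ?thesis
    by (simp add: SPAN_def struct_span_def)
qed

text \<open>
  The fibre product of the base points is a single point because the legs preserve base points.
\<close>

lemma fibprod_basepoint:
  assumes "hpath Ob (struct_spans car (\<lambda>A. {pt A}) Ob) ssrc stgt a Ss b"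
  shows "fibprod (\<lambda>A. {pt A}) a Ss = {(pt a, map (pt \<circ> sapex) Ss)}"
proof -
  have "matching (\<lambda>A. {pt A}) (pt a) Ss ss \<longleftrightarrow> ss = map (pt \<circ> sapex) Ss" for ss
    using assms
  proof (induction Ss arbitrary: a ss)
    case Nil
    then show ?case by (cases ss) auto
  next
    case (Cons R Ss)
    then show ?case by (cases ss) (auto simp: struct_spans_def)
  qed
  then show ?thesis by (auto simp: fibprod_def)
qed

lemma SPAN_pt_struct: "SPAN_pt S = struct_span fst (\<lambda>A. {snd A}) (Ptd_sets S)"
proof -
  have arrs: "Ptd_arrs S = struct_arrs fst (\<lambda>A. {snd A}) (Ptd_sets S)"
    by (auto simp: Ptd_arrs_def Set_arrs_def struct_arrs_def Ptd_sets_def)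
  have spans: "Ptd_spans S = struct_spans fst (\<lambda>A. {snd A}) (Ptd_sets S)"
    by (auto simp: Ptd_spans_def Set_spans_def struct_spans_def Ptd_sets_def)
  have cells: "t \<in> Ptd_mcells S \<longleftrightarrow> t \<in> struct_cells fst (\<lambda>A. {snd A}) (Ptd_sets S)" for t
  proof (cases "mleft t \<in> Ptd_arrs S \<and> mright t \<in> Ptd_arrs S \<and> mbot t \<in> Ptd_spans S \<and>
     hpath (Ptd_sets S) (Ptd_spans S) ssrc stgt (adom (mleft t)) (mtop t) (adom (mright t))")
    case True
    then have "hpath S (Set_spans S) ssrc stgt (fst (adom (mleft t))) (map (map_span fst) (mtop t)) (fst (adom (mright t)))"
      by (auto intro!: hpath_map[of "Ptd_sets S" "Ptd_spans S" ssrc stgt] simp: Ptd_sets_def Ptd_spans_def)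
    moreover have "fibprod (\<lambda>A. {snd A}) (adom (mleft t)) (mtop t) =
        {(snd (adom (mleft t)), map (snd \<circ> sapex) (mtop t))}"
      by (rule fibprod_basepoint[of "Ptd_sets S" fst snd _ _ "adom (mright t)"]) (use True spans in simp)
    moreover have "fibprod id (fst (adom (mleft t))) (map (map_span fst) (mtop t)) =
        fibprod fst (adom (mleft t)) (mtop t)"
      by (simp add: fibprod_map_span)
    moreover have "(\<forall>(i, ss) \<in> fibprod fst (adom (mleft t)) (mtop t).
        sleg (mbot t) (mfn t (i, ss)) = afn (mleft t) i \<and>
        sleg' (mbot t) (mfn t (i, ss)) = afn (mright t) (tuple_end (map (map_span fst) (mtop t)) (i, ss))) \<longleftrightarrow>
      (\<forall>(i, ss) \<in> fibprod fst (adom (mleft t)) (mtop t).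
        sleg (mbot t) (mfn t (i, ss)) = afn (mleft t) i \<and>
        sleg' (mbot t) (mfn t (i, ss)) = afn (mright t) (tuple_end (mtop t) (i, ss)))"
      by (rule ball_cong) (auto simp: matching_length)
    moreover have "map_arr fst (mleft t) \<in> Set_arrs S" "map_arr fst (mright t) \<in> Set_arrs S"
      "map_span fst (mbot t) \<in> Set_spans S"
      using True by (simp_all add: Ptd_arrs_def Ptd_spans_def)
    ultimately show ?thesis
      using True unfolding Ptd_mcells_def Set_mcells_def struct_cells_def arrs[symmetric] spans[symmetric]
      by auto
  next
    case False
    then show ?thesis
      unfolding Ptd_mcells_def struct_cells_def arrs[symmetric] spans[symmetric] by blast
  qed
  then have "Ptd_mcells S = struct_cells fst (\<lambda>A. {snd A}) (Ptd_sets S)" by blast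
  with arrs spans show ?thesis by (simp add: SPAN_pt_def struct_span_def)
qed

lemma SPAN_simps [simp]:
  "Obj (SPAN S) = S" "Vert (SPAN S) = Set_arrs S" "vdom (SPAN S) = adom" "vcod (SPAN S) = acod"
  "vid (SPAN S) = arr_id id" "vcomp (SPAN S) = arr_comp id" "Hor (SPAN S) = Set_spans S"
  "hsrc (SPAN S) = ssrc" "htgt (SPAN S) = stgt" "Cell (SPAN S) = Set_mcells S"
  "ctop (SPAN S) = mtop" "cbot (SPAN S) = mbot" "cleft (SPAN S) = mleft" "cright (SPAN S) = mright"
  "cid (SPAN S) = mcell_id id" "ccomp (SPAN S) = mcell_comp id"
  by (simp_all add: SPAN_def)

lemma SPAN_pt_simps [simp]:
  "Obj (SPAN_pt S) = Ptd_sets S" "Vert (SPAN_pt S) = Ptd_arrs S" "vdom (SPAN_pt S) = adom" "vcod (SPAN_pt S) = acod"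
  "vid (SPAN_pt S) = arr_id fst" "vcomp (SPAN_pt S) = arr_comp fst" "Hor (SPAN_pt S) = Ptd_spans S"
  "hsrc (SPAN_pt S) = ssrc" "htgt (SPAN_pt S) = stgt" "Cell (SPAN_pt S) = Ptd_mcells S"
  "ctop (SPAN_pt S) = mtop" "cbot (SPAN_pt S) = mbot" "cleft (SPAN_pt S) = mleft" "cright (SPAN_pt S) = mright"
  "cid (SPAN_pt S) = mcell_id fst" "ccomp (SPAN_pt S) = mcell_comp fst"
  by (simp_all add: SPAN_pt_def)

lemma Q_functor_simps [simp]:
  "fO Q_functor = fst" "fV Q_functor = map_arr fst" "fH Q_functor = map_span fst" "fC Q_functor = map_mcell fst"
  by (simp_all add: Q_functor_def)

lemma structured_sets_SPAN: "structured_sets id (\<lambda>_. {}) S"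
  by unfold_locales auto

lemma structured_sets_SPAN_pt: "structured_sets fst (\<lambda>A. {snd A}) (Ptd_sets S)"
  by unfold_locales (auto simp: Ptd_sets_def)

lemma virtual_double_category_SPAN_pt: "virtual_double_category (SPAN_pt S)"
  unfolding SPAN_pt_struct by (rule structured_sets.virtual_double_category[OF structured_sets_SPAN_pt])

lemma map_arr_comp: "map_arr fst (arr_comp fst g f) = arr_comp id (map_arr fst g) (map_arr fst f)"
  by (rule arr.expand) (simp add: arr_comp_def)

lemma map_mcell_comp:
  "map_mcell fst (mcell_comp fst k u ts) = mcell_comp id (map_mcell fst k) (map_arr fst u) (map (map_mcell fst) ts)"
proof -
  have tops: "concat (map (mtop \<circ> map_mcell fst) ts) = map (map_span fst) (concat (map mtop ts))"
    by (induction ts) simp_all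
  have "fibprod id (fst (adom u)) (map (map_span fst) (concat (map mtop ts))) = fibprod fst (adom u) (concat (map mtop ts))"
    by (simp add: fibprod_map_span)
  then show ?thesis
    by (intro mcell.expand conjI)
      (simp_all add: mcell_comp_def map_arr_comp tops last_map if_distrib[of "map_arr fst"] fun_eq_iff restrict_def)
qed

lemma Q_vd_functor: "vd_functor (SPAN_pt S) (SPAN S) Q_functor"
proof -
  have id: "map_arr fst (arr_id fst A) = arr_id id (fst A)" for A :: "'a set \<times> 'a"
    by (rule arr.expand) (simp add: arr_id_def)
  have "fibprod id (fst (ssrc R)) [map_span fst R] = fibprod fst (ssrc R) [R]" for R :: "('a set \<times> 'a, 'a) span"
    using fibprod_map_span[of id fst "ssrc R" "[R]"] by simp
  then have cid: "map_mcell fst (mcell_id fst R) = mcell_id id (map_span fst R)" for R :: "('a set \<times> 'a, 'a) span"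
    by (intro mcell.expand) (simp add: mcell_id_def id)
  have "A \<in> Ptd_sets S \<Longrightarrow> fst A \<in> S" "u \<in> Ptd_arrs S \<Longrightarrow> map_arr fst u \<in> Set_arrs S"
    "R \<in> Ptd_spans S \<Longrightarrow> map_span fst R \<in> Set_spans S" "t \<in> Ptd_mcells S \<Longrightarrow> map_mcell fst t \<in> Set_mcells S"
    for A u R t by (auto simp: Ptd_sets_def Ptd_arrs_def Ptd_spans_def Ptd_mcells_def)
  then show ?thesis
    unfolding vd_functor_def by (simp add: id cid map_arr_comp map_mcell_comp)
qed

section \<open>The universal discrete opfibration\<close>

text \<open>
  The pointed lifts of a function, a span and a multicell. Only the point of the domain, of the apex,
  or of the domain and all top apices can be chosen; the remaining base points are images of these.
\<close>

definition pt_arr :: "'w set \<times> 'w \<Rightarrow> ('w set, 'w) arr \<Rightarrow> ('w set \<times> 'w, 'w) arr" where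
  "pt_arr x v = Arr x (acod v, afn v (snd x)) (afn v)"

definition pt_span :: "('w set, 'w) span \<Rightarrow> 'w \<Rightarrow> ('w set \<times> 'w, 'w) span" where
  "pt_span R s = Span (ssrc R, sleg R s) (sapex R, s) (stgt R, sleg' R s) (sleg R) (sleg' R)"

definition pt_cell ::
  "'w set \<times> 'w \<Rightarrow> ('w set \<times> 'w, 'w) span list \<Rightarrow> ('w set, 'w) mcell \<Rightarrow> ('w set \<times> 'w, 'w) mcell" where
  "pt_cell x Rs \<nu> = MCell (pt_arr x (mleft \<nu>)) (pt_arr (if Rs = [] then x else stgt (last Rs)) (mright \<nu>)) Rs
     (pt_span (mbot \<nu>) (mfn \<nu> (snd x, map (snd \<circ> sapex) Rs))) (mfn \<nu>)"

lemma pt_arr_in: "x \<in> Ptd_sets S \<Longrightarrow> v \<in> Set_arrs S \<Longrightarrow> adom v = fst x \<Longrightarrow> pt_arr x v \<in> Ptd_arrs S \<and> map_arr fst (pt_arr x v) = v"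
  by (cases v) (auto simp: pt_arr_def Ptd_arrs_def Set_arrs_def Ptd_sets_def)

lemma pt_arr_collapse: "f \<in> Ptd_arrs S \<Longrightarrow> pt_arr (adom f) (map_arr fst f) = f"
  by (cases f) (auto simp: pt_arr_def Ptd_arrs_def)

lemma pt_span_in: "R \<in> Set_spans S \<Longrightarrow> s \<in> sapex R \<Longrightarrow> pt_span R s \<in> Ptd_spans S \<and> map_span fst (pt_span R s) = R"
  by (cases R) (auto simp: pt_span_def Ptd_spans_def Set_spans_def Ptd_sets_def)

lemma pt_span_collapse: "R \<in> Ptd_spans S \<Longrightarrow> pt_span (map_span fst R) (snd (sapex R)) = R"
  by (cases R) (auto simp: pt_span_def Ptd_spans_def)

lemma path_end_SPAN_pt: "path_end (SPAN_pt S) x Rs = (if Rs = [] then x else stgt (last Rs))"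
  by (simp add: path_end_def)

lemma path_in_SPAN_pt:
  assumes "path_in (SPAN_pt S) x Rs x'"
  shows "(snd x, map (snd \<circ> sapex) Rs) \<in> fibprod id (fst x) (map (map_span fst) Rs) \<and>
    tuple_end Rs (snd x, map (snd \<circ> sapex) Rs) = snd x'"
proof -
  have "path_in (SPAN_pt S) x Rs x' \<Longrightarrow> matching fst (snd x) Rs (map (snd \<circ> sapex) Rs) \<and>
      tuple_end Rs (snd x, map (snd \<circ> sapex) Rs) = snd x'"
    by (induction Rs arbitrary: x) (auto simp: Ptd_spans_def Ptd_sets_def)
  with assms hpath_ends[OF assms] show ?thesis
    by (auto simp: matching_map_span Ptd_sets_def)
qed

text \<open>
  The pointed bottom span has its legs pointed correctly because \<open>\<nu>\<close> is compatible with the legs.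
\<close>

lemma pt_cell_in:
  assumes p: "path_in (SPAN_pt S) x Rs x'" and \<nu>: "\<nu> \<in> Set_mcells S"
    and "adom (mleft \<nu>) = fst x" "mtop \<nu> = map (map_span fst) Rs"
  shows "pt_cell x Rs \<nu> \<in> Ptd_mcells S \<and> map_mcell fst (pt_cell x Rs \<nu>) = \<nu>"
proof -
  let ?p = "(snd x, map (snd \<circ> sapex) Rs)"
  have e: "(if Rs = [] then x else stgt (last Rs)) = x'"
    using hpath_path_end[OF p] unfolding path_end_SPAN_pt .
  have xx': "x \<in> Ptd_sets S" "x' \<in> Ptd_sets S" using hpath_ends[OF p] by auto
  have "path_in (SPAN S) (fst x) (map (map_span fst) Rs) (fst x')"
    using boundary_preserving_path[OF vd_functor_boundary[OF Q_vd_functor] p] by simp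
  moreover have "path_in (SPAN S) (fst x) (map (map_span fst) Rs) (adom (mright \<nu>))"
    using \<nu> assms(3,4) by (simp add: Set_mcells_def)
  ultimately have r: "adom (mright \<nu>) = fst x'" by (rule hpath_unique[symmetric])
  note pp = path_in_SPAN_pt[OF p]
  have \<nu>': "mleft \<nu> \<in> Set_arrs S" "mright \<nu> \<in> Set_arrs S" "mbot \<nu> \<in> Set_spans S"
    "ssrc (mbot \<nu>) = acod (mleft \<nu>)" "stgt (mbot \<nu>) = acod (mright \<nu>)"
    using \<nu> by (simp_all add: Set_mcells_def)
  have pin: "?p \<in> fibprod id (adom (mleft \<nu>)) (mtop \<nu>)" using pp assms(3,4) by simp
  have fn: "mfn \<nu> \<in> fibprod id (adom (mleft \<nu>)) (mtop \<nu>) \<rightarrow>\<^sub>E sapex (mbot \<nu>)"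
    and legs: "\<forall>(i, ss) \<in> fibprod id (adom (mleft \<nu>)) (mtop \<nu>).
        sleg (mbot \<nu>) (mfn \<nu> (i, ss)) = afn (mleft \<nu>) i \<and>
        sleg' (mbot \<nu>) (mfn \<nu> (i, ss)) = afn (mright \<nu>) (tuple_end (mtop \<nu>) (i, ss))"
    using \<nu> by (simp_all add: Set_mcells_def)
  have "mfn \<nu> ?p \<in> sapex (mbot \<nu>)" by (rule PiE_mem[OF fn pin])
  moreover have "sleg (mbot \<nu>) (mfn \<nu> ?p) = afn (mleft \<nu>) (snd x)"
     "sleg' (mbot \<nu>) (mfn \<nu> ?p) = afn (mright \<nu>) (tuple_end (mtop \<nu>) ?p)"
    using bspec[OF legs pin] by (simp_all del: fibprod_iff)
  moreover have "tuple_end (mtop \<nu>) ?p = snd x'" using pp assms(4) by simp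
  ultimately have m: "mfn \<nu> ?p \<in> sapex (mbot \<nu>)" "sleg (mbot \<nu>) (mfn \<nu> ?p) = afn (mleft \<nu>) (snd x)"
     "sleg' (mbot \<nu>) (mfn \<nu> ?p) = afn (mright \<nu>) (snd x')" by simp_all
  note parts = pt_arr_in[OF xx'(1) \<nu>'(1) assms(3)] pt_arr_in[OF xx'(2) \<nu>'(2) r] pt_span_in[OF \<nu>'(3) m(1)]
  have Q: "map_mcell fst (pt_cell x Rs \<nu>) = \<nu>"
    by (rule mcell.expand) (simp add: pt_cell_def e parts assms(4))
  moreover have "pt_cell x Rs \<nu> \<in> Ptd_mcells S"
    unfolding Ptd_mcells_def mem_Collect_eq Q
    using p \<nu> \<nu>' m parts r by (simp add: pt_cell_def e) (simp add: pt_arr_def pt_span_def)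
  ultimately show ?thesis by blast
qed

lemma pt_cell_collapse:
  assumes t: "t \<in> Ptd_mcells S"
  shows "pt_cell (adom (mleft t)) (mtop t) (map_mcell fst t) = t"
proof -
  have p: "path_in (SPAN_pt S) (adom (mleft t)) (mtop t) (adom (mright t))"
    using t by (simp add: Ptd_mcells_def)
  have e: "(if mtop t = [] then adom (mleft t) else stgt (last (mtop t))) = adom (mright t)"
    using hpath_path_end[OF p] unfolding path_end_SPAN_pt .
  have b: "mleft t \<in> Ptd_arrs S" "mright t \<in> Ptd_arrs S" "mbot t \<in> Ptd_spans S"
    "mfn t (snd (adom (mleft t)), map (snd \<circ> sapex) (mtop t)) = snd (sapex (mbot t))"
    using t by (simp_all add: Ptd_mcells_def)
  show ?thesis
    by (rule mcell.expand)
      (simp add: pt_cell_def e b pt_arr_collapse[OF b(1)] pt_arr_collapse[OF b(2)]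
        pt_span_collapse[OF b(3)])
qed

lemma pt_sel [simp]: "adom (pt_arr x v) = x" "sapex (pt_span R s) = (sapex R, s)"
  "mleft (pt_cell x Rs \<nu>) = pt_arr x (mleft \<nu>)" "mtop (pt_cell x Rs \<nu>) = Rs"
  by (simp_all add: pt_arr_def pt_span_def pt_cell_def)

lemma Q_discrete_opfibration: "discrete_opfibration (SPAN_pt S) (SPAN S) Q_functor"
proof -
  let ?Q = "Q_functor :: ('a set \<times> 'a, ('a set \<times> 'a, 'a) arr, ('a set \<times> 'a, 'a) span, ('a set \<times> 'a, 'a) mcell,
    'a set, ('a set, 'a) arr, ('a set, 'a) span, ('a set, 'a) mcell) vdf"
  have v: "is_vlift (SPAN_pt S) ?Q x v w \<longleftrightarrow> w = pt_arr x v"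
    if "x \<in> Ptd_sets S" "v \<in> Set_arrs S" "adom v = fst x" for x v w
    using pt_arr_in[OF that] pt_arr_collapse[of w S] by (auto simp: is_vlift_def)
  have vl: "vlift (SPAN_pt S) ?Q x v = pt_arr x v"
    if "x \<in> Ptd_sets S" "v \<in> Set_arrs S" "adom v = fst x" for x v
    unfolding vlift_def v[OF that] by simp
  have "\<exists>!c. is_clift (SPAN_pt S) (SPAN S) ?Q x Rs \<nu> c"
    if p: "path_in (SPAN_pt S) x Rs x'" and \<nu>: "\<nu> \<in> Set_mcells S"
      and l: "adom (mleft \<nu>) = fst x" and top: "mtop \<nu> = map (map_span fst) Rs" for x Rs x' \<nu>
  proof (rule ex1I)
    let ?c = "pt_cell x Rs \<nu>"
    note c = pt_cell_in[OF p \<nu> l top]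
    have e: "(if Rs = [] then x else stgt (last Rs)) = x'"
    using hpath_path_end[OF p] unfolding path_end_SPAN_pt .
    have xx': "x \<in> Ptd_sets S" "x' \<in> Ptd_sets S" using hpath_ends[OF p] by auto
    have \<nu>': "mleft \<nu> \<in> Set_arrs S" "mright \<nu> \<in> Set_arrs S" using \<nu> by (simp_all add: Set_mcells_def)
    have r: "mright ?c = pt_arr x' (mright \<nu>)" by (simp add: pt_cell_def e)
    then have "adom (mright \<nu>) = fst x'" using c by (metis map_arr_sel(1) map_mcell_sel(2) pt_sel(1))
    then show "is_clift (SPAN_pt S) (SPAN S) ?Q x Rs \<nu> ?c"
      using c r l by (simp add: is_clift_def path_end_SPAN_pt e vl xx' \<nu>')
    fix d assume "is_clift (SPAN_pt S) (SPAN S) ?Q x Rs \<nu> d"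
    then show "d = ?c"
      using pt_cell_collapse[of d S] by (auto simp: is_clift_def vl xx' \<nu>' l)
  qed
  moreover have "\<exists>!w. is_vlift (SPAN_pt S) ?Q x v w"
    if "x \<in> Ptd_sets S" "v \<in> Set_arrs S" "adom v = fst x" for x v
    using v[OF that] by simp
  ultimately show ?thesis
    unfolding discrete_opfibration_def by (intro conjI Q_vd_functor) simp_all
qed

text \<open>
  The fibre over \<open>A\<close> is in bijection with \<open>A\<close>, and the fibre over a span with its apex.
\<close>

lemma Q_fibers:
  "has_fibers_in (up_to_bij S) (up_to_bij S) (SPAN_pt S) (SPAN S) Q_functor"
proof -
  have "fibO (SPAN_pt S) Q_functor A \<in> up_to_bij S" if A: "A \<in> S" for A
  proof -
    have "bij_betw snd (fibO (SPAN_pt S) Q_functor A) A"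
      by (rule bij_betw_byWitness[where f' = "\<lambda>a. (A, a)"]) (use A in \<open>auto simp: fibO_def Ptd_sets_def\<close>)
    then show ?thesis using A by (auto simp: up_to_bij_def eqpoll_def)
  qed
  moreover have "fibH (SPAN_pt S) Q_functor R \<in> up_to_bij S" if R: "R \<in> Set_spans S" for R
  proof -
    have "bij_betw (snd \<circ> sapex) (fibH (SPAN_pt S) Q_functor R) (sapex R)"
    proof (rule bij_betw_byWitness[where f' = "pt_span R"])
      show "\<forall>h\<in>fibH (SPAN_pt S) Q_functor R. pt_span R ((snd \<circ> sapex) h) = h"
        by (auto simp: fibH_def dest: pt_span_collapse)
      show "(snd \<circ> sapex) ` fibH (SPAN_pt S) Q_functor R \<subseteq> sapex R"
        by (auto simp: fibH_def Ptd_spans_def Ptd_sets_def)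
      show "pt_span R ` sapex R \<subseteq> fibH (SPAN_pt S) Q_functor R"
        using pt_span_in[OF R] by (auto simp: fibH_def)
    qed simp
    moreover have "sapex R \<in> S" using R by (simp add: Set_spans_def)
    ultimately show ?thesis by (auto simp: up_to_bij_def eqpoll_def)
  qed
  ultimately show ?thesis by (simp add: has_fibers_in_def)
qed

lemma large_vdc_SPAN:
  assumes "universe_pair el u1"
  shows "large_vdc el (SPAN (small_sets el u1))"
  unfolding SPAN_struct
  by (rule structured_sets.large_vdc[OF structured_sets_SPAN assms large_size_small_sets[OF assms]
        large_size_U1[OF assms]])
    (use small_sets_subset[OF assms] in auto)

lemma large_vdc_SPAN_pt:
  assumes "universe_pair el u1"
  shows "large_vdc el (SPAN_pt (small_sets el u1))"
proof -
  have "large_size el (small_sets el u1 \<times> el u1)"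
    by (intro large_size_Times[OF assms] large_size_small_sets[OF assms] large_size_U1[OF assms])
  then have "large_size el (Ptd_sets (small_sets el u1))"
    by (rule large_size_subset) (use small_sets_subset[OF assms] in \<open>auto simp: Ptd_sets_def\<close>)
  then show ?thesis
    unfolding SPAN_pt_struct
    by (rule structured_sets.large_vdc[OF structured_sets_SPAN_pt assms _ large_size_U1[OF assms]])
      (auto simp: Ptd_sets_def dest: subsetD[OF small_sets_subset[OF assms]])
qed

section \<open>The classifying functor\<close>

locale fibred_in_sets =
  X: virtual_double_category X + Y: virtual_double_category Y
  for X :: "('w, 'xv, 'w, 'xc) vdc" and Y :: "('yo, 'yv, 'yh, 'yc) vdc" +
  fixes P :: "('w, 'xv, 'w, 'xc, 'yo, 'yv, 'yh, 'yc) vdf" and S :: "'w set set"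
  assumes opfibration: "discrete_opfibration X Y P"
    and fibers: "has_fibers_in S S X Y P"
begin

abbreviation "Dv \<equiv> D_vert X Y P"
abbreviation "Dh \<equiv> D_hor X Y P"
abbreviation "Dc \<equiv> D_cell X Y P"

lemma P: "vd_functor X Y P"
  and ex1_vlift: "x \<in> Obj X \<Longrightarrow> v \<in> Vert Y \<Longrightarrow> vdom Y v = fO P x \<Longrightarrow> \<exists>!w. is_vlift X P x v w"
  using opfibration by (simp_all add: discrete_opfibration_def)

lemma ex1_clift: "path_in X x hs x' \<Longrightarrow> \<nu> \<in> Cell Y \<Longrightarrow> vdom Y (cleft Y \<nu>) = fO P x \<Longrightarrow>
    ctop Y \<nu> = map (fH P) hs \<Longrightarrow> \<exists>!c. is_clift X Y P x hs \<nu> c"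
  using opfibration unfolding discrete_opfibration_def by (elim conjE allE impE) auto

lemmas Pb = boundary_preservingD[OF vd_functor_boundary[OF P]]
lemmas Pc = vd_functor_composites[OF P]

lemma vlift:
  assumes "x \<in> Obj X" "v \<in> Vert Y" "vdom Y v = fO P x"
  shows "vlift X P x v \<in> Vert X" "vdom X (vlift X P x v) = x" "fV P (vlift X P x v) = v"
proof -
  have "is_vlift X P x v (vlift X P x v)" unfolding vlift_def by (rule theI'[OF ex1_vlift[OF assms]])
  then show "vlift X P x v \<in> Vert X" "vdom X (vlift X P x v) = x" "fV P (vlift X P x v) = v"
    by (simp_all add: is_vlift_def)
qed

lemma vlift_eq:
  assumes "w \<in> Vert X"
  shows "vlift X P (vdom X w) (fV P w) = w"
proof -
  have "\<exists>!w'. is_vlift X P (vdom X w) (fV P w) w'"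
    by (rule ex1_vlift[OF X.vdom_in[OF assms] Pb(2,3)[OF assms]])
  then show ?thesis unfolding vlift_def
    by (rule the1_equality) (simp add: is_vlift_def assms)
qed

lemma cell_lift:
  assumes "path_in X x hs x'" "\<nu> \<in> Cell Y" "vdom Y (cleft Y \<nu>) = fO P x" "ctop Y \<nu> = map (fH P) hs"
  shows "\<exists>c\<in>Cell X. fC P c = \<nu> \<and> vdom X (cleft X c) = x \<and> ctop X c = hs"
proof -
  obtain c where "is_clift X Y P x hs \<nu> c" using ex1_clift[OF assms] by (rule ex1E)
  then have c: "c \<in> Cell X" "ctop X c = hs" "cleft X c = vlift X P x (cleft Y \<nu>)" "fC P c = \<nu>"
    by (simp_all add: is_clift_def)
  have "x \<in> Obj X" using hpath_ends[OF assms(1)] by simp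
  then have "vdom X (cleft X c) = x"
    unfolding c(3) using Y.cell_boundary[OF assms(2)] assms(3) by (intro vlift(2)) simp_all
  with c(1,2,4) show ?thesis by blast
qed

text \<open>
  Every multicell is the unique lift of its image along its own top. Together with
  \<open>vlift_eq\<close> this turns the definite descriptions in \<open>D_functor\<close> into evaluations: the functions of
  \<open>D_vert (P w)\<close> and \<open>D_cell (P c)\<close> are known at the points that come from \<open>w\<close> and \<open>c\<close>
  (\<open>D_vert_apply\<close>, \<open>D_cell_apply\<close>), and every point of their domains does come from some
  \<open>w\<close> or \<open>c\<close> (\<open>vlift\<close>, \<open>D_tuples_lift\<close>).
\<close>

lemma clift_eq:
  assumes c: "c \<in> Cell X"
  shows "clift X Y P (vdom X (cleft X c)) (ctop X c) (fC P c) = c"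
  unfolding clift_def
proof (rule the1_equality)
  have p: "path_in X (vdom X (cleft X c)) (ctop X c) (vdom X (cright X c))"
    and lr: "cleft X c \<in> Vert X" "cright X c \<in> Vert X"
    using X.cell_boundary[OF c] by simp_all
  show "\<exists>!c'. is_clift X Y P (vdom X (cleft X c)) (ctop X c) (fC P c) c'"
    by (rule ex1_clift[OF p]) (simp_all add: Pb c lr)
  show "is_clift X Y P (vdom X (cleft X c)) (ctop X c) (fC P c) c"
    using vlift_eq[OF lr(1)] vlift_eq[OF lr(2)]
    by (simp add: is_clift_def c Pb hpath_path_end[OF p])
qed

lemma D_vert_sel [simp]: "adom (Dv v) = fibO X P (vdom Y v)" "acod (Dv v) = fibO X P (vcod Y v)"
  by (simp_all add: D_vert_def)

lemma D_hor_sel [simp]: "ssrc (Dh \<psi>) = fibO X P (hsrc Y \<psi>)" "sapex (Dh \<psi>) = fibH X P \<psi>"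
  "stgt (Dh \<psi>) = fibO X P (htgt Y \<psi>)" "h \<in> fibH X P \<psi> \<Longrightarrow> sleg (Dh \<psi>) h = hsrc X h"
  "h \<in> fibH X P \<psi> \<Longrightarrow> sleg' (Dh \<psi>) h = htgt X h"
  by (simp_all add: D_hor_def)

lemma D_cell_sel [simp]: "mleft (Dc \<nu>) = Dv (cleft Y \<nu>)" "mright (Dc \<nu>) = Dv (cright Y \<nu>)"
  "mtop (Dc \<nu>) = map Dh (ctop Y \<nu>)" "mbot (Dc \<nu>) = Dh (cbot Y \<nu>)"
  by (simp_all add: D_cell_def)

text \<open>
  The limit of the zigzag of fibres over a path in \<open>Y\<close> is the set of paths in \<open>X\<close> over it.
\<close>

lemma matching_D_hor:
  assumes "x \<in> Obj X"
  shows "matching id x (map Dh \<Psi>s) hs \<longleftrightarrow> map (fH P) hs = \<Psi>s \<and> (\<exists>x'. path_in X x hs x')"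
  using assms
proof (induction \<Psi>s arbitrary: x hs)
  case Nil
  then show ?case by (cases hs) auto
next
  case (Cons \<psi> \<Psi>s)
  show ?case
  proof (cases hs)
    case (Cons h hs')
    have IH: "matching id (htgt X h) (map Dh \<Psi>s) hs' \<longleftrightarrow> map (fH P) hs' = \<Psi>s \<and> (\<exists>x'. path_in X (htgt X h) hs' x')"
      if "h \<in> Hor X" using Cons.IH[OF X.htgt_in[OF that]] .
    have step: "matching id x (map Dh (\<psi> # \<Psi>s)) hs \<longleftrightarrow>
        h \<in> fibH X P \<psi> \<and> sleg (Dh \<psi>) h = x \<and> matching id (sleg' (Dh \<psi>) h) (map Dh \<Psi>s) hs'"
      unfolding Cons list.map matching.simps id_apply D_hor_sel ..
    show ?thesis unfolding step using Cons Cons.prems IH by (auto simp: fibH_def)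
  qed simp
qed

lemma tuple_end_D_hor:
  "path_in X x hs x' \<Longrightarrow> tuple_end (map Dh (map (fH P) hs)) (x, hs) = x'"
  by (induction hs arbitrary: x) (auto simp: fibH_def)

lemma D_vert_apply: "w \<in> Vert X \<Longrightarrow> afn (Dv (fV P w)) (vdom X w) = vcod X w"
  by (simp add: D_vert_def fibO_def Pb X.vdom_in vlift_eq)

abbreviation "D_tuples v \<Psi>s \<equiv> fibprod id (fibO X P (vdom Y v)) (map Dh \<Psi>s)"

lemma D_tuples_iff: "(x, hs) \<in> D_tuples v \<Psi>s \<longleftrightarrow>
    x \<in> Obj X \<and> fO P x = vdom Y v \<and> map (fH P) hs = \<Psi>s \<and> (\<exists>x'. path_in X x hs x')"
  using matching_D_hor by (auto simp: fibO_def)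

lemma D_cell_apply:
  assumes c: "c \<in> Cell X"
  shows "(vdom X (cleft X c), ctop X c) \<in> D_tuples (cleft Y (fC P c)) (ctop Y (fC P c))"
    and "mfn (Dc (fC P c)) (vdom X (cleft X c), ctop X c) = cbot X c"
    and "tuple_end (map Dh (ctop Y (fC P c))) (vdom X (cleft X c), ctop X c) = vdom X (cright X c)"
proof -
  have p: "path_in X (vdom X (cleft X c)) (ctop X c) (vdom X (cright X c))"
    and l: "cleft X c \<in> Vert X"
    using X.cell_boundary[OF c] by simp_all
  show t: "(vdom X (cleft X c), ctop X c) \<in> D_tuples (cleft Y (fC P c)) (ctop Y (fC P c))"
    unfolding D_tuples_iff using p by (auto simp: Pb c l X.vdom_in)
  then show "mfn (Dc (fC P c)) (vdom X (cleft X c), ctop X c) = cbot X c"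
    by (simp add: D_cell_def clift_eq[OF c] del: fibprod_iff)
  show "tuple_end (map Dh (ctop Y (fC P c))) (vdom X (cleft X c), ctop X c) = vdom X (cright X c)"
    using tuple_end_D_hor[OF p] by (simp add: Pb c)
qed

lemma D_tuples_lift:
  assumes "\<nu> \<in> Cell Y" "p \<in> D_tuples (cleft Y \<nu>) (ctop Y \<nu>)"
  shows "\<exists>c\<in>Cell X. fC P c = \<nu> \<and> p = (vdom X (cleft X c), ctop X c)"
proof -
  obtain x hs where p: "p = (x, hs)" by fastforce
  then obtain x' where "path_in X x hs x'" "fO P x = vdom Y (cleft Y \<nu>)" "map (fH P) hs = ctop Y \<nu>"
    using assms(2) D_tuples_iff by blast
  then show ?thesis using cell_lift[of x hs x' \<nu>] assms(1) p by auto
qed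

lemma D_vert_in: assumes v: "v \<in> Vert Y" shows "Dv v \<in> Set_arrs S"
proof -
  have "vcod X (vlift X P x v) \<in> fibO X P (vcod Y v)" if "x \<in> fibO X P (vdom Y v)" for x
    using vlift[of x v] that v Pb(4)[of "vlift X P x v"] by (auto simp: fibO_def X.vcod_in)
  then show ?thesis
    using fibers Y.vdom_in[OF v] Y.vcod_in[OF v]
    by (auto simp: Set_arrs_def D_vert_def has_fibers_in_def)
qed

lemma D_hor_in: "\<psi> \<in> Hor Y \<Longrightarrow> Dh \<psi> \<in> Set_spans S"
  using fibers Y.hsrc_in[of \<psi>] Y.htgt_in[of \<psi>]
  by (auto simp: Set_spans_def D_hor_def has_fibers_in_def fibH_def fibO_def Pb X.hsrc_in X.htgt_in)

lemma fibO_in: "y \<in> Obj Y \<Longrightarrow> fibO X P y \<in> S"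
  using fibers by (simp add: has_fibers_in_def)

lemma D_cell_in: assumes \<nu>: "\<nu> \<in> Cell Y" shows "Dc \<nu> \<in> Set_mcells S"
proof -
  note b = Y.cell_boundary[OF \<nu>]
  have path: "hpath S (Set_spans S) ssrc stgt (fibO X P (vdom Y (cleft Y \<nu>)))
      (map Dh (ctop Y \<nu>)) (fibO X P (vdom Y (cright Y \<nu>)))"
    by (rule hpath_map[of "Obj Y" "Hor Y" "hsrc Y" "htgt Y"]) (use b in \<open>simp_all add: fibO_in D_hor_in\<close>)
  have app: "mfn (Dc \<nu>) p \<in> fibH X P (cbot Y \<nu>) \<and>
      sleg (Dh (cbot Y \<nu>)) (mfn (Dc \<nu>) p) = afn (Dv (cleft Y \<nu>)) (fst p) \<and>
      sleg' (Dh (cbot Y \<nu>)) (mfn (Dc \<nu>) p) = afn (Dv (cright Y \<nu>)) (tuple_end (map Dh (ctop Y \<nu>)) p)"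
    if p: "p \<in> D_tuples (cleft Y \<nu>) (ctop Y \<nu>)" for p
  proof -
    obtain c where c: "c \<in> Cell X" "fC P c = \<nu>" "p = (vdom X (cleft X c), ctop X c)"
      using D_tuples_lift[OF \<nu> p] by blast
    note bc = X.cell_boundary[OF c(1)]
    note a = D_cell_apply(2,3)[OF c(1), unfolded c(2)]
    have "cbot X c \<in> fibH X P (cbot Y \<nu>)" using bc c by (auto simp: fibH_def Pb(10)[symmetric])
    moreover have "afn (Dv (cleft Y \<nu>)) (vdom X (cleft X c)) = vcod X (cleft X c)"
      "afn (Dv (cright Y \<nu>)) (vdom X (cright X c)) = vcod X (cright X c)"
      using D_vert_apply[of "cleft X c"] D_vert_apply[of "cright X c"] bc c
      by (simp_all add: Pb(11,12)[symmetric])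
    ultimately show ?thesis using bc by (simp add: c(3) a)
  qed
  have "mfn (Dc \<nu>) \<in> D_tuples (cleft Y \<nu>) (ctop Y \<nu>) \<rightarrow>\<^sub>E fibH X P (cbot Y \<nu>)"
  proof (rule PiE_I)
    fix p assume "p \<notin> D_tuples (cleft Y \<nu>) (ctop Y \<nu>)"
    then show "mfn (Dc \<nu>) p = undefined" by (simp add: D_cell_def)
  qed (use app in blast)
  moreover have "\<forall>(i, ss) \<in> D_tuples (cleft Y \<nu>) (ctop Y \<nu>).
      sleg (Dh (cbot Y \<nu>)) (mfn (Dc \<nu>) (i, ss)) = afn (Dv (cleft Y \<nu>)) i \<and>
      sleg' (Dh (cbot Y \<nu>)) (mfn (Dc \<nu>) (i, ss)) = afn (Dv (cright Y \<nu>)) (tuple_end (map Dh (ctop Y \<nu>)) (i, ss))"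
    using app by fastforce
  ultimately show ?thesis
    using b path unfolding Set_mcells_def by (simp add: D_vert_in D_hor_in)
qed

text \<open>
  Lift the multicells from left to right. The lift of one multicell and that of its right
  neighbour share a boundary, since both boundaries lift the same vertical morphism at the same object.
\<close>

lemma lift_cell_path:
  assumes "cell_path Y u ts" "fO P x = vdom Y u" "path_in X x hs x'" "map (fH P) hs = concat (map (ctop Y) ts)"
  shows "\<exists>w cs. cell_path X w cs \<and> vdom X w = x \<and> fV P w = u \<and> map (fC P) cs = ts \<and>
    concat (map (ctop X) cs) = hs"
  using assms
proof (induction ts arbitrary: u x hs)
  case Nil
  then have "x \<in> Obj X" by (auto dest: hpath_ends)
  then have "cell_path X (vlift X P x u) []" "vdom X (vlift X P x u) = x" "fV P (vlift X P x u) = u"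
    using vlift[of x u] Nil by simp_all
  then show ?case using Nil by fastforce
next
  case (Cons t ts)
  let ?n = "length (ctop Y t)"
  have t: "t \<in> Cell Y" "cleft Y t = u" and ts: "cell_path Y (cright Y t) ts" using Cons.prems(1) by auto
  have "map (fH P) (take ?n hs) @ map (fH P) (drop ?n hs) = ctop Y t @ concat (map (ctop Y) ts)"
    using Cons.prems(4) by (simp add: map_append[symmetric] del: map_append)
  moreover have "length (map (fH P) (take ?n hs)) = ?n"
    using arg_cong[OF Cons.prems(4), of length] by simp
  ultimately have tops: "map (fH P) (take ?n hs) = ctop Y t" "map (fH P) (drop ?n hs) = concat (map (ctop Y) ts)"
    by (simp_all del: length_map)
  obtain y where y: "path_in X x (take ?n hs) y" "path_in X y (drop ?n hs) x'"
    using Cons.prems(3) hpath_append[of _ _ _ _ x "take ?n hs" "drop ?n hs" x'] by auto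
  obtain c where c: "c \<in> Cell X" "fC P c = t" "vdom X (cleft X c) = x" "ctop X c = take ?n hs"
    using cell_lift[OF y(1) t(1)] Cons.prems(2) t(2) tops(1) by auto
  note bc = X.cell_boundary[OF c(1)]
  have y': "y = vdom X (cright X c)" using hpath_unique[OF y(1)] bc c by simp
  have Pr: "fV P (cright X c) = cright Y t" and Pl: "fV P (cleft X c) = u" using c t Pb(11,12)[OF c(1)] by simp_all
  have "fO P y = vdom Y (cright Y t)" using Pb(3)[of "cright X c"] bc Pr y' by simp
  then obtain w cs where w: "cell_path X w cs" "vdom X w = y" "fV P w = cright Y t" "map (fC P) cs = ts"
    "concat (map (ctop X) cs) = drop ?n hs"
    using Cons.IH[OF ts _ y(2) tops(2)] by blast
  have "w = cright X c"
    using vlift_eq[of w] vlift_eq[of "cright X c"] X.cell_path_in[OF w(1)] bc w y' Pr by simp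
  then have "cell_path X (cleft X c) (c # cs)" using w c by simp
  then show ?case using c w Pl by (intro exI[of _ "cleft X c"] exI[of _ "c # cs"]) simp
qed

lemma apply_D_cells:
  "cell_path X w cs \<Longrightarrow>
    apply_mcells (map Dc (map (fC P) cs)) (vdom X w, concat (map (ctop X) cs)) = map (cbot X) cs"
proof (induction cs arbitrary: w)
  case (Cons c cs)
  then have c: "c \<in> Cell X" "w = cleft X c" and cs: "cell_path X (cright X c) cs" by auto
  have "length (ctop Y (fC P c)) = length (ctop X c)" by (simp add: Pb c)
  then show ?case
    using D_cell_apply(2,3)[OF c(1)] Cons.IH[OF cs] c(2) by (simp add: Let_def)
qed simp

lemma D_vert_vid: assumes a: "a \<in> Obj Y" shows "Dv (vid Y a) = arr_id id (fibO X P a)"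
proof -
  have "afn (Dv (vid Y a)) x = x" if "x \<in> fibO X P a" for x
    using D_vert_apply[of "vid X x"] that by (auto simp: fibO_def X.vid Pc(1))
  then have "afn (Dv (vid Y a)) = restrict (\<lambda>x. x) (fibO X P a)"
    using Y.vid[OF a] by (auto simp: fun_eq_iff restrict_def) (simp add: D_vert_def)
  then show ?thesis using Y.vid[OF a] by (intro arr.expand) (simp add: arr_id_def)
qed

lemma D_vert_vcomp:
  assumes u: "u \<in> Vert Y" and v: "v \<in> Vert Y" and uv: "vcod Y u = vdom Y v"
  shows "Dv (vcomp Y v u) = arr_comp id (Dv v) (Dv u)"
proof -
  note c = Y.vcomp[OF u v uv]
  have "afn (Dv (vcomp Y v u)) x = afn (Dv v) (afn (Dv u) x)" if "x \<in> fibO X P (vdom Y u)" for x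
  proof -
    let ?w = "vlift X P x u"
    have x: "x \<in> Obj X" "fO P x = vdom Y u" using that by (auto simp: fibO_def)
    note w = vlift[OF x(1) u x(2)[symmetric]]
    have "vdom Y v = fO P (vcod X ?w)" using Pb(4)[OF w(1)] w(3) uv by simp
    note w' = vlift[OF X.vcod_in[OF w(1)] v this]
    have "vcod X ?w = vdom X (vlift X P (vcod X ?w) v)" using w'(2) by simp
    note cw = X.vcomp[OF w(1) w'(1) this] Pc(2)[OF w(1) w'(1) this]
    show ?thesis
      using D_vert_apply[OF w(1)] D_vert_apply[OF w'(1)]
        D_vert_apply[of "vcomp X (vlift X P (vcod X ?w) v) ?w"] cw w w' by simp
  qed
  then have "afn (Dv (vcomp Y v u)) = restrict (\<lambda>x. afn (Dv v) (afn (Dv u) x)) (fibO X P (vdom Y u))"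
    using c by (auto simp: fun_eq_iff restrict_def) (simp add: D_vert_def)
  then show ?thesis using c by (intro arr.expand) (simp add: arr_comp_def)
qed

lemma D_cell_cid: assumes h: "h \<in> Hor Y" shows "Dc (cid Y h) = mcell_id id (Dh h)"
proof -
  note c = Y.cid[OF h]
  have "mfn (Dc (cid Y h)) p = (\<lambda>(i, ss)\<in>fibprod id (fibO X P (hsrc Y h)) [Dh h]. hd ss) p" for p
  proof (cases "p \<in> fibprod id (fibO X P (hsrc Y h)) [Dh h]")
    case True
    obtain i ss where p: "p = (i, ss)" by fastforce
    with True obtain s where s: "ss = [s]" "s \<in> Hor X" "fH P s = h" "hsrc X s = i"
      by (cases ss; cases "tl ss") (auto simp: fibH_def)
    have "mfn (Dc (cid Y h)) (i, [s]) = s"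
      using D_cell_apply(2)[of "cid X s"] X.cid[OF s(2)] s(3,4) X.vid[OF X.hsrc_in[OF s(2)]] Pc(3)[OF s(2)]
      by simp
    then show ?thesis using True p s(1) by simp
  next
    case False
    then show ?thesis using c h Y.vid[OF Y.hsrc_in[OF h]] by (simp add: D_cell_def)
  qed
  then show ?thesis
    using c h by (intro mcell.expand) (simp add: mcell_id_def D_vert_vid Y.hsrc_in Y.htgt_in fun_eq_iff)
qed

text \<open>
  Over a tuple in the domain, lift first the row \<open>ts\<close> and then \<open>k\<close>. The composite of these lifts lies over
  \<open>ccomp Y k u ts\<close>, so it computes the left-hand side; evaluating its parts computes the right-hand side.
\<close>

lemma D_cell_ccomp:
  assumes comp: "composable Y k u ts"
  shows "Dc (ccomp Y k u ts) = mcell_comp id (Dc k) (Dv u) (map Dc ts)"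
proof -
  have k: "k \<in> Cell Y" and ts: "cell_path Y u ts" and top: "map (cbot Y) ts = ctop Y k"
    and u: "vcod Y u = vdom Y (cleft Y k)" using comp by (auto simp: composable_def)
  note in_Y = Y.cell_path_in[OF ts]
  note b = Y.ccomp[OF comp]
  note bk = Y.cell_boundary[OF k]
  note r = Y.composable_right[OF comp]
  have dom: "vdom Y (cleft Y (ccomp Y k u ts)) = vdom Y u" using b bk in_Y u Y.vcomp by simp
  have tops: "concat (map (mtop \<circ> Dc) ts) = map Dh (concat (map (ctop Y) ts))"
    by (induction ts) simp_all
  have right: "(if ts = [] then Dv u else mright (last (map Dc ts))) = Dv (path_right Y u ts)"
    by (simp add: path_right_def last_map)
  have "mfn (Dc (ccomp Y k u ts)) p = (\<lambda>(i, ss)\<in>D_tuples u (concat (map (ctop Y) ts)).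
      mfn (Dc k) (afn (Dv u) i, apply_mcells (map Dc ts) (i, ss))) p" for p
  proof (cases "p \<in> D_tuples u (concat (map (ctop Y) ts))")
    case True
    obtain x hs where p: "p = (x, hs)" by fastforce
    with True obtain x' where x: "fO P x = vdom Y u" "map (fH P) hs = concat (map (ctop Y) ts)" "path_in X x hs x'"
      using D_tuples_iff by blast
    obtain w cs where w: "cell_path X w cs" "vdom X w = x" "fV P w = u" "map (fC P) cs = ts"
      "concat (map (ctop X) cs) = hs"
      using lift_cell_path[OF ts x(1,3,2)] by blast
    note in_X = X.cell_path_in[OF w(1)]
    have bots: "map (fH P) (map (cbot X) cs) = map (cbot Y) ts"
      using in_X by (auto simp: w(4)[symmetric] Pb)
    have "vdom Y (cleft Y k) = fO P (vcod X w)" using Pb(4)[of w] in_X w(3) u by simp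
    then obtain k' where k': "k' \<in> Cell X" "fC P k' = k" "vdom X (cleft X k') = vcod X w" "ctop X k' = map (cbot X) cs"
      using cell_lift[OF X.cell_path_bot[OF w(1)] k] bots top by auto
    have comp': "composable X k' w cs" using k' w(1) by (simp add: composable_def)
    note b' = X.ccomp[OF comp']
    have Pcomp: "fC P (ccomp X k' w cs) = ccomp Y k u ts"
      using Pc(4)[OF comp'] k' w by simp
    have "vdom X (cleft X (ccomp X k' w cs)) = x"
      using b' X.vcomp[of w "cleft X k'"] X.cell_boundary[OF k'(1)] in_X k'(3) w(2) by simp
    then have "mfn (Dc (ccomp Y k u ts)) (x, hs) = cbot X k'"
      using D_cell_apply(2)[of "ccomp X k' w cs"] b' Pcomp w(5) by simp
    also have "\<dots> = mfn (Dc k) (afn (Dv u) x, apply_mcells (map Dc ts) (x, hs))"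
      using D_cell_apply(2)[OF k'(1)] k' D_vert_apply[of w] in_X w apply_D_cells[OF w(1)] by simp
    finally show ?thesis using True p by (simp del: fibprod_iff)
  next
    case False
    then show ?thesis using b dom by (simp add: D_cell_def)
  qed
  moreover have "Dv (vcomp Y (cleft Y k) u) = arr_comp id (Dv (cleft Y k)) (Dv u)"
    using D_vert_vcomp in_Y bk u by simp
  moreover have "Dv (vcomp Y (cright Y k) (path_right Y u ts)) = arr_comp id (Dv (cright Y k)) (Dv (path_right Y u ts))"
    using D_vert_vcomp in_Y bk r by simp
  ultimately show ?thesis
    using b by (intro mcell.expand) (simp add: mcell_comp_def tops right fun_eq_iff)
qed

lemma D_functor_simps [simp]:
  "fO (D_functor X Y P) = fibO X P" "fV (D_functor X Y P) = Dv" "fH (D_functor X Y P) = Dh" "fC (D_functor X Y P) = Dc"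
  by (simp_all add: D_functor_def)

lemma D_vd_functor: "vd_functor Y (SPAN S) (D_functor X Y P)"
  unfolding vd_functor_def
  by (simp add: fibO_in D_vert_in D_hor_in D_cell_in D_vert_vid D_vert_vcomp D_cell_cid D_cell_ccomp)

section \<open>The pullback square\<close>

text \<open>
  The fibre through an object or a horizontal morphism, pointed by it. On vertical morphisms and
  multicells, \<open>E_functor\<close> is the lift of \<open>D \<circ> P\<close> along \<open>Q\<close> that starts at these points.
\<close>

definition fibO_pt :: "'w \<Rightarrow> 'w set \<times> 'w" where
  "fibO_pt x = (fibO X P (fO P x), x)"

definition fibH_pt :: "'w \<Rightarrow> ('w set \<times> 'w, 'w) span" where
  "fibH_pt h = pt_span (Dh (fH P h)) h"

definition E_functor ::
  "('w, 'xv, 'w, 'xc, 'w set \<times> 'w, ('w set \<times> 'w, 'w) arr, ('w set \<times> 'w, 'w) span, ('w set \<times> 'w, 'w) mcell) vdf" where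
  "E_functor = \<lparr>fO = fibO_pt, fV = \<lambda>w. pt_arr (fibO_pt (vdom X w)) (Dv (fV P w)), fH = fibH_pt,
     fC = \<lambda>c. pt_cell (fibO_pt (vdom X (cleft X c))) (map fibH_pt (ctop X c)) (Dc (fC P c))\<rparr>"

lemma E_functor_simps [simp]:
  "fO E_functor = fibO_pt" "fV E_functor w = pt_arr (fibO_pt (vdom X w)) (Dv (fV P w))" "fH E_functor = fibH_pt"
  "fC E_functor c = pt_cell (fibO_pt (vdom X (cleft X c))) (map fibH_pt (ctop X c)) (Dc (fC P c))"
  by (simp_all add: E_functor_def)

lemma fibO_pt_in: "x \<in> Obj X \<Longrightarrow> fibO_pt x \<in> Ptd_sets S"
  using fibO_in Pb(1) by (auto simp: fibO_pt_def Ptd_sets_def fibO_def)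

lemma E_vert:
  assumes w: "w \<in> Vert X"
  shows "fV E_functor w \<in> Ptd_arrs S" "map_arr fst (fV E_functor w) = Dv (fV P w)"
    "adom (fV E_functor w) = fibO_pt (vdom X w)" "acod (fV E_functor w) = fibO_pt (vcod X w)"
proof -
  show "fV E_functor w \<in> Ptd_arrs S" "map_arr fst (fV E_functor w) = Dv (fV P w)"
    using pt_arr_in[OF fibO_pt_in[OF X.vdom_in[OF w]] D_vert_in[OF Pb(2)[OF w]]] Pb(3)[OF w]
    by (simp_all add: fibO_pt_def)
  show "adom (fV E_functor w) = fibO_pt (vdom X w)" "acod (fV E_functor w) = fibO_pt (vcod X w)"
    using D_vert_apply[OF w] Pb(4)[OF w] by (simp_all add: pt_arr_def fibO_pt_def)
qed

lemma E_hor: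
  assumes h: "h \<in> Hor X"
  shows "fibH_pt h \<in> Ptd_spans S" "map_span fst (fibH_pt h) = Dh (fH P h)"
    "ssrc (fibH_pt h) = fibO_pt (hsrc X h)" "stgt (fibH_pt h) = fibO_pt (htgt X h)"
proof -
  have f: "h \<in> fibH X P (fH P h)" using h by (simp add: fibH_def)
  then show "fibH_pt h \<in> Ptd_spans S" "map_span fst (fibH_pt h) = Dh (fH P h)"
    using pt_span_in[OF D_hor_in[OF Pb(5)[OF h]]] by (simp_all add: fibH_pt_def)
  show "ssrc (fibH_pt h) = fibO_pt (hsrc X h)" "stgt (fibH_pt h) = fibO_pt (htgt X h)"
    using f Pb(6,7)[OF h] by (simp_all add: fibH_pt_def pt_span_def fibO_pt_def)
qed

lemma sapex_fibH_pt [simp]: "sapex (fibH_pt h) = (fibH X P (fH P h), h)"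
  by (simp add: fibH_pt_def)

text \<open>
  The lift has the right codomain: \<open>D_cell (P c)\<close> maps the point given by the top of \<open>c\<close> to \<open>cbot c\<close>.
\<close>

lemma E_cell:
  assumes c: "c \<in> Cell X"
  shows "fC E_functor c \<in> Ptd_mcells S" "map_mcell fst (fC E_functor c) = Dc (fC P c)"
    "mtop (fC E_functor c) = map fibH_pt (ctop X c)" "mbot (fC E_functor c) = fibH_pt (cbot X c)"
    "mleft (fC E_functor c) = fV E_functor (cleft X c)" "mright (fC E_functor c) = fV E_functor (cright X c)"
proof -
  note b = X.cell_boundary[OF c]
  have p: "path_in (SPAN_pt S) (fibO_pt (vdom X (cleft X c))) (map fibH_pt (ctop X c)) (fibO_pt (vdom X (cright X c)))"
    by (rule hpath_map[of "Obj X" "Hor X" "hsrc X" "htgt X"]) (use b in \<open>simp_all add: fibO_pt_in E_hor\<close>)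
  have "map Dh (map (fH P) (ctop X c)) = map (map_span fst) (map fibH_pt (ctop X c))"
    using b hpath_ends by (fastforce simp: E_hor)
  then show "fC E_functor c \<in> Ptd_mcells S" "map_mcell fst (fC E_functor c) = Dc (fC P c)"
    using pt_cell_in[OF p D_cell_in[OF Pb(8)[OF c]]] b by (simp_all add: Pb c fibO_pt_def)
  show "mtop (fC E_functor c) = map fibH_pt (ctop X c)" "mleft (fC E_functor c) = fV E_functor (cleft X c)"
    by (simp_all add: Pb c)
  have "map (snd \<circ> sapex) (map fibH_pt (ctop X c)) = ctop X c" by (simp add: comp_def)
  then show "mbot (fC E_functor c) = fibH_pt (cbot X c)"
    using D_cell_apply(2)[OF c] by (simp add: pt_cell_def fibO_pt_def fibH_pt_def Pb c del: map_map)
  show "mright (fC E_functor c) = fV E_functor (cright X c)"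
    using hpath_path_end[OF p] unfolding path_end_SPAN_pt by (simp add: pt_cell_def Pb c)
qed

lemma E_boundary_preserving: "boundary_preserving X (SPAN_pt S) E_functor"
  unfolding boundary_preserving_def
  by (simp add: fibO_pt_in E_vert E_hor E_cell del: E_functor_simps(2,4))

text \<open>
  Uniqueness of lifts along \<open>Q_functor\<close>, the tool for showing that \<open>E_functor\<close> preserves identities and
  composites: both sides lift the same thing at the same points.
\<close>

lemma Ptd_arrs_eqI:
  "f \<in> Ptd_arrs S \<Longrightarrow> g \<in> Ptd_arrs S \<Longrightarrow> adom f = adom g \<Longrightarrow> map_arr fst f = map_arr fst g \<Longrightarrow> f = g"
  by (metis pt_arr_collapse)

lemma Ptd_mcells_eqI:
  "s \<in> Ptd_mcells S \<Longrightarrow> t \<in> Ptd_mcells S \<Longrightarrow> adom (mleft s) = adom (mleft t) \<Longrightarrow> mtop s = mtop t \<Longrightarrow>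
    map_mcell fst s = map_mcell fst t \<Longrightarrow> s = t"
  by (metis pt_cell_collapse)

lemma E_vd_functor: "vd_functor X (SPAN_pt S) E_functor"
proof -
  interpret Z': virtual_double_category "SPAN_pt S" by (rule virtual_double_category_SPAN_pt)
  note Qc = vd_functor_composites[OF Q_vd_functor[of S]]
  note Dfc = vd_functor_composites[OF D_vd_functor]
  show ?thesis
    unfolding vd_functor_iff
  proof (intro conjI ballI allI impI E_boundary_preserving)
    fix x assume x: "x \<in> Obj X"
    show "fV E_functor (vid X x) = vid (SPAN_pt S) (fO E_functor x)"
      using X.vid[OF x] Z'.vid[of "fibO_pt x"] fibO_pt_in[OF x] E_vert[of "vid X x"] Qc(1)[of "fibO_pt x"] Dfc(1)[OF Pb(1)[OF x]] Pc(1)[OF x]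
      by (intro Ptd_arrs_eqI) (simp_all del: E_functor_simps(2,4) add: fibO_pt_def)
  next
    fix u v assume u: "u \<in> Vert X" and v: "v \<in> Vert X" and uv: "vcod X u = vdom X v"
    have "vcod Y (fV P u) = vdom Y (fV P v)" using Pb(3,4) u v uv by simp
    note D = Dfc(2)[OF Pb(2)[OF u] Pb(2)[OF v] this]
    have "acod (fV E_functor u) = adom (fV E_functor v)" using E_vert u v uv by (simp del: E_functor_simps(2,4))
    then show "fV E_functor (vcomp X v u) = vcomp (SPAN_pt S) (fV E_functor v) (fV E_functor u)"
      using X.vcomp[OF u v uv] Z'.vcomp[of "fV E_functor u" "fV E_functor v"] D Pc(2)[OF u v uv]
        Qc(2)[of "fV E_functor u" "fV E_functor v"] E_vert[OF u] E_vert[OF v] E_vert[of "vcomp X v u"]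
      by (intro Ptd_arrs_eqI) (simp_all del: E_functor_simps(2,4))
  next
    fix h assume h: "h \<in> Hor X"
    show "fC E_functor (cid X h) = cid (SPAN_pt S) (fH E_functor h)"
      using X.cid[OF h] X.vid[OF X.hsrc_in[OF h]] Z'.cid[of "fibH_pt h"] E_hor[OF h] E_cell[of "cid X h"] E_vert(3)[of "vid X (hsrc X h)"]
        Qc(3)[of "fibH_pt h"] Dfc(3)[OF Pb(5)[OF h]] Pc(3)[OF h]
      by (intro Ptd_mcells_eqI) (simp_all del: E_functor_simps(2,4))
  next
    fix k u ts assume c: "composable X k u ts"
    have cE: "composable (SPAN_pt S) (fC E_functor k) (fV E_functor u) (map (fC E_functor) ts)"
      by (rule boundary_preserving_composable[OF X.virtual_double_category_axioms E_boundary_preserving c])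
    have cP: "composable Y (fC P k) (fV P u) (map (fC P) ts)"
      by (rule boundary_preserving_composable[OF X.virtual_double_category_axioms vd_functor_boundary[OF P] c])
    have k: "k \<in> Cell X" "u \<in> Vert X" "set ts \<subseteq> Cell X" "vcod X u = vdom X (cleft X k)"
      using c X.cell_path_in by (auto simp: composable_def)
    note b = X.ccomp[OF c] Z'.ccomp[OF cE]
    have "vdom X (vcomp X (cleft X k) u) = vdom X u" "vcomp X (cleft X k) u \<in> Vert X"
      using X.vcomp k X.cell_boundary[OF k(1)] by simp_all
    moreover have "concat (map mtop (map (fC E_functor) ts)) = map fibH_pt (concat (map (ctop X) ts))"
      using k(3) by (induction ts) (simp_all add: E_cell del: E_functor_simps(2,4))
    moreover have "map (map_mcell fst) (map (fC E_functor) ts) = map Dc (map (fC P) ts)"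
      using k(3) by (auto simp: E_cell simp del: E_functor_simps(2,4))
    ultimately show "fC E_functor (ccomp X k u ts) = ccomp (SPAN_pt S) (fC E_functor k) (fV E_functor u) (map (fC E_functor) ts)"
      using b E_cell[of "ccomp X k u ts"] E_vert[OF k(2)] E_vert(3)[of "vcomp X (cleft X k) u"] E_cell(2)[OF k(1)]
        Qc(4)[OF cE] Dfc(4)[OF cP] Pc(4)[OF c]
      by (intro Ptd_mcells_eqI) (simp_all del: E_functor_simps(2,4) map_map)
  qed
qed

text \<open>
  An element of a fibre product of \<open>Y\<close> with pointed spans consists of an element of \<open>Y\<close> and base points
  in its fibres; these base points are the objects or horizontal morphisms of \<open>X\<close> at which to lift.
\<close>

lemma ex1_Obj_over:
  assumes z: "z \<in> Ptd_sets S" and eq: "fibO X P y = fst z"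
  shows "\<exists>!x. x \<in> Obj X \<and> fO P x = y \<and> fibO_pt x = z"
proof (rule ex1I)
  have "snd z \<in> fst z" using z by (auto simp: Ptd_sets_def)
  then have x: "snd z \<in> Obj X" "fO P (snd z) = y" unfolding eq[symmetric] fibO_def by simp_all
  then have "fibO_pt (snd z) = z" by (intro prod_eqI) (simp_all add: fibO_pt_def eq)
  with x show "snd z \<in> Obj X \<and> fO P (snd z) = y \<and> fibO_pt (snd z) = z" by blast
  fix x assume "x \<in> Obj X \<and> fO P x = y \<and> fibO_pt x = z"
  then have "fibO_pt x = z" by blast
  then show "x = snd z" by (auto simp: fibO_pt_def)
qed

lemma ex1_Vert_over:
  assumes v: "v \<in> Vert Y" and f: "f \<in> Ptd_arrs S" and eq: "Dv v = map_arr fst f"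
  shows "\<exists>!w. w \<in> Vert X \<and> fV P w = v \<and> fV E_functor w = f"
proof -
  let ?x = "snd (adom f)"
  have dom: "fst (adom f) = fibO X P (vdom Y v)" using arg_cong[OF eq, of adom] by simp
  moreover have "?x \<in> fst (adom f)" using f by (auto simp: Ptd_arrs_def Ptd_sets_def)
  ultimately have "?x \<in> fibO X P (vdom Y v)" by simp
  then have x: "?x \<in> Obj X" "vdom Y v = fO P ?x" by (auto simp: fibO_def)
  note w = vlift[OF x(1) v x(2)]
  have pt_x: "fibO_pt ?x = adom f" using dom x(2) by (simp add: fibO_pt_def prod_eq_iff)
  show "\<exists>!w. w \<in> Vert X \<and> fV P w = v \<and> fV E_functor w = f"
  proof (rule ex1I)
    show "vlift X P ?x v \<in> Vert X \<and> fV P (vlift X P ?x v) = v \<and> fV E_functor (vlift X P ?x v) = f"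
      using w pt_x pt_arr_collapse[of f S] f eq by simp
    fix w' assume w': "w' \<in> Vert X \<and> fV P w' = v \<and> fV E_functor w' = f"
    then have "fibO_pt (vdom X w') = adom f" using E_vert(3)[of w'] by (simp del: E_functor_simps)
    then have "vdom X w' = ?x" by (simp add: fibO_pt_def prod_eq_iff)
    then show "w' = vlift X P ?x v" using vlift_eq[of w'] w' by (simp del: E_functor_simps)
  qed
qed

lemma ex1_Hor_over:
  assumes R: "R \<in> Ptd_spans S" and eq: "Dh \<psi> = map_span fst R"
  shows "\<exists>!h. h \<in> Hor X \<and> fH P h = \<psi> \<and> fibH_pt h = R"
proof -
  let ?h = "snd (sapex R)"
  have "fst (sapex R) = fibH X P \<psi>" using arg_cong[OF eq, of sapex] by simp
  moreover have "?h \<in> fst (sapex R)" using R by (auto simp: Ptd_spans_def Ptd_sets_def)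
  ultimately have h: "?h \<in> Hor X" "fH P ?h = \<psi>" by (auto simp: fibH_def)
  show "\<exists>!h. h \<in> Hor X \<and> fH P h = \<psi> \<and> fibH_pt h = R"
  proof (rule ex1I)
    show "?h \<in> Hor X \<and> fH P ?h = \<psi> \<and> fibH_pt ?h = R"
      using h pt_span_collapse[of R S] R eq by (simp add: fibH_pt_def)
  qed auto
qed

lemma ex1_Cell_over:
  assumes \<nu>: "\<nu> \<in> Cell Y" and t: "t \<in> Ptd_mcells S" and eq: "Dc \<nu> = map_mcell fst t"
  shows "\<exists>!c. c \<in> Cell X \<and> fC P c = \<nu> \<and> fC E_functor c = t"
proof -
  let ?p = "(snd (adom (mleft t)), map (snd \<circ> sapex) (mtop t))"
  have path: "path_in (SPAN_pt S) (adom (mleft t)) (mtop t) (adom (mright t))"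
    using t by (simp add: Ptd_mcells_def)
  have dom: "fst (adom (mleft t)) = fibO X P (vdom Y (cleft Y \<nu>))"
    using arg_cong[OF eq, of "adom \<circ> mleft"] by simp
  have top: "map (map_span fst) (mtop t) = map Dh (ctop Y \<nu>)"
    using arg_cong[OF eq, of mtop] by simp
  have "?p \<in> D_tuples (cleft Y \<nu>) (ctop Y \<nu>)"
    using path_in_SPAN_pt[OF path] unfolding dom top by blast
  then obtain c where c: "c \<in> Cell X" "fC P c = \<nu>" "?p = (vdom X (cleft X c), ctop X c)"
    using D_tuples_lift[OF \<nu>] by blast
  have "map fibH_pt (ctop X c) = mtop t"
  proof (rule nth_equalityI)
    show len: "length (map fibH_pt (ctop X c)) = length (mtop t)" using arg_cong[OF c(3), of "\<lambda>p. length (snd p)"] by simp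
    fix i assume i: "i < length (map fibH_pt (ctop X c))"
    let ?R = "mtop t ! i"
    have R: "?R \<in> Ptd_spans S" using hpath_ends[OF path] i len by (auto simp: subset_iff)
    have h: "ctop X c ! i = snd (sapex ?R)" using arg_cong[OF c(3), of "\<lambda>p. snd p ! i"] i len by simp
    have "map Dh (map (fH P) (ctop X c)) = map (map_span fst) (mtop t)" using top c(2) Pb(9)[OF c(1)] by simp
    then have "map Dh (map (fH P) (ctop X c)) ! i = map (map_span fst) (mtop t) ! i" by simp
    then have "Dh (fH P (ctop X c ! i)) = map_span fst ?R" using i len by simp
    then show "map fibH_pt (ctop X c) ! i = ?R" using i pt_span_collapse[OF R] by (simp add: fibH_pt_def h)
  qed
  moreover have "fibO_pt (vdom X (cleft X c)) = adom (mleft t)"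
  proof -
    have "fO P (vdom X (cleft X c)) = vdom Y (cleft Y \<nu>)"
      using X.cell_boundary[OF c(1)] Pb(3)[of "cleft X c"] Pb(11)[OF c(1)] c(2) by simp
    then show ?thesis using dom arg_cong[OF c(3), of fst] by (simp add: fibO_pt_def prod_eq_iff)
  qed
  ultimately have E: "fC E_functor c = t"
    using pt_cell_collapse[of t S] t eq c(2) by simp
  show "\<exists>!c. c \<in> Cell X \<and> fC P c = \<nu> \<and> fC E_functor c = t"
  proof (rule ex1I)
    show "c \<in> Cell X \<and> fC P c = \<nu> \<and> fC E_functor c = t" using c E by simp
    fix c' assume c': "c' \<in> Cell X \<and> fC P c' = \<nu> \<and> fC E_functor c' = t"
    then have eqE: "fC E_functor c' = fC E_functor c" using E by (simp only:)
    have "fibO_pt (vdom X (cleft X c')) = fibO_pt (vdom X (cleft X c))"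
      using arg_cong[OF eqE, of "\<lambda>t. adom (mleft t)"] by simp
    then have dom_eq: "vdom X (cleft X c') = vdom X (cleft X c)" by (simp add: fibO_pt_def)
    have "inj fibH_pt"
    proof (rule injI)
      fix h h' assume "fibH_pt h = fibH_pt h'"
      from arg_cong[OF this, of sapex] show "h = h'" by simp
    qed
    moreover have "map fibH_pt (ctop X c') = map fibH_pt (ctop X c)"
      using arg_cong[OF eqE, of mtop] by simp
    ultimately have "ctop X c' = ctop X c" by simp
    with dom_eq show "c' = c"
      using clift_eq[of c'] clift_eq[OF c(1)] c(2) c' by metis
  qed
qed

lemma E_pullback: "levelwise_pullback X Y (SPAN_pt S) P E_functor (D_functor X Y P) Q_functor"
proof -
  interpret Z': virtual_double_category "SPAN_pt S" by (rule virtual_double_category_SPAN_pt)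
  have "vdf_eq X (vdf_comp (D_functor X Y P) P) (vdf_comp Q_functor E_functor)"
    by (simp add: vdf_eq_def vdf_comp_def E_vert E_hor E_cell fibO_pt_def del: E_functor_simps(2,4))
  then show ?thesis
    using P E_vd_functor ex1_Obj_over ex1_Vert_over ex1_Hor_over ex1_Cell_over
    by unfold_locales (simp_all del: E_functor_simps(2,4))
qed

end

theorem mainTheorem11:
  fixes el :: "'w \<Rightarrow> 'w set" and u1 :: 'w
  assumes "universe_pair el u1"
  shows
    "large_vdc el (SPAN (small_sets el u1)) \<and>
     large_vdc el (SPAN_pt (small_sets el u1)) \<and>
     discrete_opfibration (SPAN_pt (small_sets el u1)) (SPAN (small_sets el u1)) Q_functor \<and>
     has_fibers_in (up_to_bij (small_sets el u1)) (up_to_bij (small_sets el u1))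
       (SPAN_pt (small_sets el u1)) (SPAN (small_sets el u1)) Q_functor \<and>
     (\<forall>(X :: ('w, 'xv, 'w, 'xc) vdc) (Y :: ('yo, 'yv, 'yh, 'yc) vdc) P.
        large_vdc el X \<and> large_vdc el Y \<and>
        discrete_opfibration X Y P \<and>
        has_fibers_in (small_sets el u1) (small_sets el u1) X Y P \<longrightarrow>
        (\<exists>E. VDBL_pullback el X Y (SPAN_pt (small_sets el u1)) (SPAN (small_sets el u1))
               P E (D_functor X Y P) Q_functor))"
proof (intro conjI allI impI)
  fix X :: "('w, 'xv, 'w, 'xc) vdc" and Y :: "('yo, 'yv, 'yh, 'yc) vdc" and P
  let ?S = "small_sets el u1"
  assume "large_vdc el X \<and> large_vdc el Y \<and> discrete_opfibration X Y P \<and> has_fibers_in ?S ?S X Y P"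
  then have X: "large_vdc el X" and Y: "large_vdc el Y"
    and P: "discrete_opfibration X Y P" "has_fibers_in ?S ?S X Y P" by auto
  have F: "fibred_in_sets X Y P ?S"
    using X Y P by (simp add: fibred_in_sets_def fibred_in_sets_axioms_def large_vdc_def)
  have "VDBL_pullback el X Y (SPAN_pt ?S) (SPAN ?S) P (fibred_in_sets.E_functor X Y P) (D_functor X Y P) Q_functor"
    by (rule levelwise_pullback.VDBL_pullback[OF fibred_in_sets.E_pullback[OF F] X Y
          large_vdc_SPAN_pt[OF assms] large_vdc_SPAN[OF assms] fibred_in_sets.D_vd_functor[OF F] Q_vd_functor])
  then show "\<exists>E. VDBL_pullback el X Y (SPAN_pt ?S) (SPAN ?S) P E (D_functor X Y P) Q_functor" by blast
qed (intro large_vdc_SPAN large_vdc_SPAN_pt Q_discrete_opfibration Q_fibers assms)+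

end
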